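(* Let $T>0$ and let $(\Omega,(\mathcal{F}_t)_{t\in[0,T]},P)$ be a filtered probability space satisfying the usual conditions, with $\mathcal{F}_0$ trivial. Let $W$ be a Brownian motion in the filtration $(\mathcal{F}_t)$ and let $X$ be a $d$-dimensional Itô process on $[0,T]$, \[ dX_t=\mu_t\,dt+\sigma_t\,dW_t, \] with progressively measurable coefficients. Let $a_t=\sigma_t\sigma_t^T$ and assume that $|\mu|$, $\|a\|$ and $\|a^{-1}\|$ are bounded processes. Then $X$ has full support; in fact, $X$ has conditional full support.
   Context: $X$ has conditional full support if for all $t\in[0,T]$ and every open set $G\subset C([0,T],\mathbb{R}^d)$ (topology of uniform convergence), $P(X\in G\mid\mathcal{F}_t)>0$ almost surely on the event $\{X|_{[0,t]}\in\{g|_{[0,t]}: g\in G\}\}$; $X$ has full support if this holds for $t=0$, i.e. $P(X\in G)>0$ for every open $G\subset C([0,T],\mathbb{R}^d)$ with $X_0\in\{g(0):g\in G\}$. *)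

theory Defs
  imports "HOL-Probability.Probability"
begin

definition filtration_on :: "'a measure \<Rightarrow> real \<Rightarrow> (real \<Rightarrow> 'a measure) \<Rightarrow> bool" where
  "filtration_on M T F \<longleftrightarrow>
     (\<forall>t\<in>{0..T}. subalgebra M (F t)) \<and>
     (\<forall>s\<in>{0..T}. \<forall>t\<in>{0..T}. s \<le> t \<longrightarrow> sets (F s) \<subseteq> sets (F t))"

definition usual_conditions :: "'a measure \<Rightarrow> real \<Rightarrow> (real \<Rightarrow> 'a measure) \<Rightarrow> bool" where
  "usual_conditions M T F \<longleftrightarrow>
     (\<forall>t\<in>{0..<T}. sets (F t) = (\<Inter>s\<in>{t<..T}. sets (F s))) \<and>
     (\<forall>N A. A \<in> sets M \<longrightarrow> emeasure M A = 0 \<longrightarrow> N \<subseteq> A \<longrightarrow> N \<in> sets (F 0))"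

definition trivial_sigma :: "'a measure \<Rightarrow> 'a measure \<Rightarrow> bool" where
  "trivial_sigma M F0 \<longleftrightarrow> (\<forall>A\<in>sets F0. measure M A = 0 \<or> measure M A = 1)"

definition adapted_on :: "real \<Rightarrow> (real \<Rightarrow> 'a measure) \<Rightarrow> (real \<Rightarrow> 'a \<Rightarrow> 'b::topological_space) \<Rightarrow> bool" where
  "adapted_on T F X \<longleftrightarrow> (\<forall>t\<in>{0..T}. X t \<in> borel_measurable (F t))"

definition progressive_on :: "real \<Rightarrow> (real \<Rightarrow> 'a measure) \<Rightarrow> (real \<Rightarrow> 'a \<Rightarrow> 'b::topological_space) \<Rightarrow> bool" where
  "progressive_on T F X \<longleftrightarrow>
     (\<forall>t\<in>{0..T}. (\<lambda>(s,\<omega>). X s \<omega>) \<in> borel_measurable (restrict_space borel {0..t} \<Otimes>\<^sub>M F t))"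

definition continuous_paths :: "'a measure \<Rightarrow> real \<Rightarrow> (real \<Rightarrow> 'a \<Rightarrow> 'b::topological_space) \<Rightarrow> bool" where
  "continuous_paths M T X \<longleftrightarrow> (\<forall>\<omega>\<in>space M. continuous_on {0..T} (\<lambda>t. X t \<omega>))"

definition gauss_vec :: "real \<Rightarrow> (real^'m) measure" where
  "gauss_vec v = density lborel (\<lambda>x. ennreal (\<Prod>i\<in>UNIV. normal_density 0 (sqrt v) (x $ i)))"

definition brownian_motion_on :: "'a measure \<Rightarrow> real \<Rightarrow> (real \<Rightarrow> 'a measure) \<Rightarrow> (real \<Rightarrow> 'a \<Rightarrow> real^'m) \<Rightarrow> bool" where
  "brownian_motion_on M T F W \<longleftrightarrow>
     (\<forall>\<omega>\<in>space M. W 0 \<omega> = 0) \<and> continuous_paths M T W \<and> adapted_on T F W \<and>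
     (\<forall>s t A B. 0 \<le> s \<longrightarrow> s < t \<longrightarrow> t \<le> T \<longrightarrow> A \<in> sets (F s) \<longrightarrow> B \<in> sets borel \<longrightarrow>
        measure M (A \<inter> {\<omega>\<in>space M. W t \<omega> - W s \<omega> \<in> B}) = measure M A * measure (gauss_vec (t - s)) B)"

definition simple_integrand ::
  "'a measure \<Rightarrow> real \<Rightarrow> (real \<Rightarrow> 'a measure) \<Rightarrow> (real \<Rightarrow> 'a \<Rightarrow> real^'m^'d) \<Rightarrow> (real \<Rightarrow> 'a \<Rightarrow> real^'m) \<Rightarrow> (real \<Rightarrow> 'a \<Rightarrow> real^'d) \<Rightarrow> bool" where
  "simple_integrand M T F H W J \<longleftrightarrow>
     (\<exists>n::nat. \<exists>p::nat \<Rightarrow> real. \<exists>\<xi>::nat \<Rightarrow> 'a \<Rightarrow> real^'m^'d.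
        p 0 = 0 \<and> p n = T \<and> (\<forall>k<n. p k < p (Suc k)) \<and>
        (\<forall>k<n. \<xi> k \<in> borel_measurable (F (p k)) \<and> (\<exists>C. \<forall>\<omega>\<in>space M. norm (\<xi> k \<omega>) \<le> C)) \<and>
        (\<forall>k<n. \<forall>s\<in>{p k<..p (Suc k)}. \<forall>\<omega>\<in>space M. H s \<omega> = \<xi> k \<omega>) \<and>
        (\<forall>t\<in>{0..T}. \<forall>\<omega>\<in>space M.
           J t \<omega> = (\<Sum>k<n. \<xi> k \<omega> *v (W (min t (p (Suc k))) \<omega> - W (min t (p k)) \<omega>))))"

definition tendsto_zero_in_prob :: "'a measure \<Rightarrow> (nat \<Rightarrow> 'a \<Rightarrow> real) \<Rightarrow> bool" where
  "tendsto_zero_in_prob M Z \<longleftrightarrow>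
     (\<forall>e>0. (\<lambda>n. measure M {\<omega>\<in>space M. \<bar>Z n \<omega>\<bar> > e}) \<longlonglongrightarrow> 0)"

definition ito_integral ::
  "'a measure \<Rightarrow> real \<Rightarrow> (real \<Rightarrow> 'a measure) \<Rightarrow> (real \<Rightarrow> 'a \<Rightarrow> real^'m^'d) \<Rightarrow> (real \<Rightarrow> 'a \<Rightarrow> real^'m) \<Rightarrow> (real \<Rightarrow> 'a \<Rightarrow> real^'d) \<Rightarrow> bool" where
  "ito_integral M T F \<sigma> W I \<longleftrightarrow>
     continuous_paths M T I \<and> adapted_on T F I \<and>
     (\<exists>H J. (\<forall>n. simple_integrand M T F (H n) W (J n)) \<and>
        tendsto_zero_in_prob M (\<lambda>n \<omega>. LINT s|restrict_space lborel {0..T}. (norm (H n s \<omega> - \<sigma> s \<omega>))\<^sup>2) \<and>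
        tendsto_zero_in_prob M (\<lambda>n \<omega>. Sup ((\<lambda>t. norm (J n t \<omega> - I t \<omega>)) ` {0..T})))"

definition ito_process ::
  "'a measure \<Rightarrow> real \<Rightarrow> (real \<Rightarrow> 'a measure) \<Rightarrow> (real \<Rightarrow> 'a \<Rightarrow> real^'m) \<Rightarrow> (real \<Rightarrow> 'a \<Rightarrow> real^'d) \<Rightarrow> (real \<Rightarrow> 'a \<Rightarrow> real^'m^'d) \<Rightarrow> (real \<Rightarrow> 'a \<Rightarrow> real^'d) \<Rightarrow> bool" where
  "ito_process M T F W \<mu> \<sigma> X \<longleftrightarrow>
     continuous_paths M T X \<and> X 0 \<in> borel_measurable (F 0) \<and>
     (\<exists>I. ito_integral M T F \<sigma> W I \<and>
        (\<forall>t\<in>{0..T}. AE \<omega> in M.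
           X t \<omega> = X 0 \<omega> + (LINT s|restrict_space lborel {0..t}. \<mu> s \<omega>) + I t \<omega>))"

definition cpath_space :: "real \<Rightarrow> (real \<Rightarrow> 'b::metric_space) set" where
  "cpath_space T = {f. continuous_on {0..T} f \<and> f \<in> extensional {0..T}}"

definition uniformly_open :: "real \<Rightarrow> (real \<Rightarrow> 'b::metric_space) set \<Rightarrow> bool" where
  "uniformly_open T G \<longleftrightarrow> G \<subseteq> cpath_space T \<and>
     (\<forall>g\<in>G. \<exists>e>0. \<forall>h\<in>cpath_space T.
        (SUP t\<in>{0..T}. dist (h t) (g t)) < e \<longrightarrow> h \<in> G)"

definition path_of :: "real \<Rightarrow> (real \<Rightarrow> 'a \<Rightarrow> 'b) \<Rightarrow> 'a \<Rightarrow> real \<Rightarrow> 'b" where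
  "path_of T X \<omega> = restrict (\<lambda>t. X t \<omega>) {0..T}"

definition conditional_full_support ::
  "'a measure \<Rightarrow> real \<Rightarrow> (real \<Rightarrow> 'a measure) \<Rightarrow> (real \<Rightarrow> 'a \<Rightarrow> 'b::metric_space) \<Rightarrow> bool" where
  "conditional_full_support M T F X \<longleftrightarrow>
     (\<forall>t\<in>{0..T}. \<forall>G. uniformly_open T G \<longrightarrow>
        (AE \<omega> in M. (\<exists>g\<in>G. \<forall>s\<in>{0..t}. X s \<omega> = g s) \<longrightarrow>
           real_cond_exp M (F t) (indicator {\<omega>'\<in>space M. path_of T X \<omega>' \<in> G}) \<omega> > 0))"

text \<open>Full support: P(X \<in> G) > 0 for every open G with X 0 \<in> {g 0 | g \<in> G}
  (X 0 is a.s. constant as F 0 is trivial; we require it for almost every \<omega>).\<close>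
definition full_support ::
  "'a measure \<Rightarrow> real \<Rightarrow> (real \<Rightarrow> 'a \<Rightarrow> 'b::metric_space) \<Rightarrow> bool" where
  "full_support M T X \<longleftrightarrow>
     (\<forall>G. uniformly_open T G \<longrightarrow>
        (AE \<omega> in M. (\<exists>g\<in>G. X 0 \<omega> = g 0) \<longrightarrow>
           measure M {\<omega>'\<in>space M. path_of T X \<omega>' \<in> G} > 0))"

end

theory Submission
  imports Defs
begin

text \<open>
  Fix \<open>t\<close>, a polynomial path \<open>f\<close> and \<open>\<epsilon> > 0\<close>, and put \<open>Y r = X r - X t - (f r - f t)\<close>.
  It suffices to bound \<open>P(sup |Y| \<le> \<epsilon> on [t,T] | F t)\<close> from below by a positive constant: polynomials are
  dense, and countably many pairs \<open>(f, \<epsilon>)\<close> cover an open set of paths.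

  The bound needs neither Girsanov's theorem nor Ito's formula nor stopping times. Let
  \<open>\<phi>(y) = (max 0 (\<epsilon>\<^sup>2 - |y|\<^sup>2))\<^sup>3\<close>. Bounded drift and uniform ellipticity give \<open>L \<phi> \<ge> - l \<phi>\<close> on the ball for
  every generator \<open>L\<close> that \<open>Y\<close> can have, because near the boundary the second order term, of order \<open>u\<close>
  in \<open>u = \<epsilon>\<^sup>2 - |y|\<^sup>2\<close>, dominates the negative ones, of order \<open>u\<^sup>2\<close>. A Taylor expansion over a time step
  \<open>h\<close> then yields \<open>E[\<phi>(Y (r + h)) | F r] \<ge> (1 - l h) \<phi>(Y r) - C h\<^sup>3\<^sup>/\<^sup>2\<close> as long as \<open>|Y r| < \<epsilon>\<close>. Since \<open>\<phi>\<close>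
  vanishes outside the ball, the estimate survives killing \<open>Y\<close> at the first grid time outside the ball,
  and iterating it over the grid of mesh \<open>(T - t) / 2^n\<close> bounds the probability of staying inside by
  \<open>exp (- l (T - t))\<close> in the limit.

  The moments of the increments are computed for discrete stochastic integrals with bounded integrands
  only; \<open>\<phi>\<close> is bounded and Lipschitz, so the estimate passes to the Ito integral under convergence in
  probability.
\<close>

text \<open>\<open>X\<close> need not be Markov and \<open>\<sigma>\<close> is arbitrary within its
  bounds, so no transition density is at hand and the lower bound has to be uniform over all
  coefficients allowed. Write \<open>u = \<epsilon>^2 - |y|^2\<close>, let \<open>K\<close> bound
  the drift, \<open>R\<close> the norm of \<open>\<sigma>\<close>, and let \<open>c\<close> be the
  ellipticity constant. The generator applied to \<open>u^3\<close> is at least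
  \<open>u (12 c \<epsilon>^2 - b u)\<close> with \<open>b = 6 \<epsilon> K + 3 R^2 + 12 c\<close>:
  drift, trace of \<open>a\<close>, and the price of writing \<open>|y|^2\<close> as
  \<open>\<epsilon>^2 - u\<close> in the elliptic term. Completing the square gives
  \<open>l = b^2 / (48 c \<epsilon>^2)\<close>. A step costs \<open>h^(3/2)\<close> and there are
  \<open>(T - t) / h\<close> of them, so the accumulated error is of order \<open>sqrt h\<close>.
  Conditioning on \<open>F t\<close> is expressed by testing on events: one constant \<pi> with
  \<open>\<pi> P(B) \<le> P(B \<inter> E)\<close> for all \<open>B\<close> in \<open>F t\<close>
  inside an event \<open>A\<close> makes the conditional probability of \<open>E\<close> positive
  almost everywhere on \<open>A\<close>.\<close>

section \<open>Moments of Gaussian increments\<close>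

text \<open>Lebesgue measure on a Euclidean space is the image of a product measure indexed by
  \<open>Basis\<close>. For \<open>real^'n\<close> the map from \<open>i\<close> to
  \<open>axis i 1\<close> identifies the coordinates with \<open>Basis\<close>, so the product
  integral formula carries over.\<close>

lemma has_bochner_integral_lborel_prod:
  fixes f :: "'n::finite \<Rightarrow> real \<Rightarrow> real"
  assumes f: "\<And>i. has_bochner_integral lborel (f i) (c i)"
  shows "has_bochner_integral lborel (\<lambda>x::real^'n. \<Prod>i\<in>UNIV. f i (x $ i)) (\<Prod>i\<in>UNIV. c i)"
proof -
  have inj: "inj (\<lambda>i::'n. axis i (1::real))"
    by (auto simp: inj_on_def axis_eq_axis)
  have Basis: "(Basis :: (real^'n) set) = range (\<lambda>i. axis i 1)"
    by (auto simp: Basis_vec_def)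
  define g where "g b = f (inv (\<lambda>i. axis i 1) b)" for b :: "real^'n"
  have g: "g (axis i 1) = f i" for i
    unfolding g_def by (simp add: inv_f_f[OF inj])
  interpret product_sigma_finite "\<lambda>b::real^'n. lborel :: real measure" ..
  have gi: "integrable lborel (g b)" if "b \<in> Basis" for b
    using that integrable.intros[OF f] by (auto simp: Basis g)
  have gm: "g b \<in> borel_measurable borel" if "b \<in> Basis" for b
    using gi[OF that] by auto
  have "has_bochner_integral (Pi\<^sub>M Basis (\<lambda>b::real^'n. lborel)) (\<lambda>x. \<Prod>b\<in>Basis. g b (x b))
        (\<Prod>b\<in>Basis. integral\<^sup>L lborel (g b))"
    using gi by (simp add: has_bochner_integral_iff product_integrable_prod product_integral_prod)
  also have "(\<Prod>b\<in>Basis. integral\<^sup>L lborel (g b)) = (\<Prod>i\<in>UNIV. c i)"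
    unfolding Basis
    by (simp add: prod.reindex[OF inj] g has_bochner_integral_integral_eq[OF f])
  also have "has_bochner_integral (Pi\<^sub>M Basis (\<lambda>b::real^'n. lborel)) (\<lambda>x. \<Prod>b\<in>Basis. g b (x b)) =
      (\<lambda>c. has_bochner_integral (Pi\<^sub>M Basis (\<lambda>b::real^'n. lborel))
        (\<lambda>x. \<Prod>b\<in>Basis. g b ((\<Sum>b\<in>Basis. x b *\<^sub>R b) \<bullet> b)) c)"
    by (intro ext has_bochner_integral_cong refl) (auto intro!: prod.cong)
  finally have *: "has_bochner_integral (Pi\<^sub>M Basis (\<lambda>b::real^'n. lborel))
        (\<lambda>x. \<Prod>b\<in>Basis. g b ((\<Sum>b\<in>Basis. x b *\<^sub>R b) \<bullet> b)) (\<Prod>i\<in>UNIV. c i)" .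
  have "has_bochner_integral (distr (Pi\<^sub>M Basis (\<lambda>b::real^'n. lborel)) borel (\<lambda>f. \<Sum>b\<in>Basis. f b *\<^sub>R b))
        (\<lambda>x. \<Prod>b\<in>Basis. g b (x \<bullet> b)) (\<Prod>i\<in>UNIV. c i)"
    using * gm by (subst has_bochner_integral_distr) (auto intro!: borel_measurable_prod)
  then have "has_bochner_integral lborel (\<lambda>x. \<Prod>b\<in>Basis. g b (x \<bullet> b)) (\<Prod>i\<in>UNIV. c i)"
    by (subst lborel_eq)
  also have "(\<lambda>x. \<Prod>b\<in>Basis. g b (x \<bullet> b)) = (\<lambda>x::real^'n. \<Prod>i\<in>UNIV. f i (x $ i))"
    unfolding Basis by (simp add: prod.reindex[OF inj] g cart_eq_inner_axis)
  finally show ?thesis .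
qed

lemma has_bochner_integral_gauss_vec_prod:
  fixes f :: "'m::finite \<Rightarrow> real \<Rightarrow> real"
  assumes f: "\<And>i. has_bochner_integral lborel (\<lambda>x. normal_density 0 (sqrt v) x * f i x) (c i)"
    and fm: "\<And>i. f i \<in> borel_measurable borel"
  shows "has_bochner_integral (gauss_vec v) (\<lambda>x::real^'m. \<Prod>i\<in>UNIV. f i (x $ i)) (\<Prod>i\<in>UNIV. c i)"
proof -
  have [measurable]: "(\<lambda>x::real^'m. x $ i) \<in> borel_measurable borel" for i
    by (intro borel_measurable_continuous_onI continuous_intros)
  have [measurable]: "f i \<in> borel_measurable borel" for i by fact
  show ?thesis
    unfolding gauss_vec_def
    using has_bochner_integral_lborel_prod[OF f]
    by (intro has_bochner_integral_density)
       (auto simp: prod.distrib intro!: prod_nonneg)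
qed

lemma
  fixes v :: real
  assumes v: "v > 0"
  shows gauss_vec_component: "has_bochner_integral (gauss_vec v) (\<lambda>x::real^'m. x $ i) 0"
    and gauss_vec_component_sq: "has_bochner_integral (gauss_vec v) (\<lambda>x::real^'m. x $ i * x $ i) v"
    and gauss_vec_component_4: "has_bochner_integral (gauss_vec v) (\<lambda>x::real^'m. (x $ i)^4) (3 * v\<^sup>2)"
    and gauss_vec_component_mult: "i \<noteq> j \<Longrightarrow> has_bochner_integral (gauss_vec v) (\<lambda>x::real^'m. x $ i * x $ j) 0"
    and prob_space_gauss_vec: "prob_space (gauss_vec v :: (real^'m) measure)"
proof -
  have s: "0 < sqrt v" using v by simp
  have m0: "has_bochner_integral lborel (\<lambda>x. normal_density 0 (sqrt v) x * 1) 1"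
    using normal_moment_even[OF s, of 0 0] by simp
  have m1: "has_bochner_integral lborel (\<lambda>x. normal_density 0 (sqrt v) x * x) 0"
    using normal_moment_odd[OF s, of 0 0] by simp
  have m2: "has_bochner_integral lborel (\<lambda>x. normal_density 0 (sqrt v) x * (x * x)) v"
    using normal_moment_even[OF s, of 0 1] v by (simp add: power2_eq_square)
  have m4: "has_bochner_integral lborel (\<lambda>x. normal_density 0 (sqrt v) x * x ^ 4) (3 * v\<^sup>2)"
    using normal_moment_even[OF s, of 0 2] v by (simp add: fact_numeral power_divide power_numeral_reduce)
  \<comment> \<open>One-dimensional marginals: all factors but the one at \<open>i\<close> are the
    constant 1, and each of these integrates to 1 by \<open>m0\<close>.\<close>
  have *: "has_bochner_integral (gauss_vec v) (\<lambda>x::real^'m. f (x $ i)) c"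
    if "has_bochner_integral lborel (\<lambda>x. normal_density 0 (sqrt v) x * f x) c" "f \<in> borel_measurable borel" for f c i
    using has_bochner_integral_gauss_vec_prod[of v "\<lambda>k. if k = i then f else (\<lambda>_. 1)" "\<lambda>k. if k = i then c else 1"] that m0
    by (simp add: if_distrib[where f="\<lambda>g. g _"] if_distrib[where f="\<lambda>x. _ * x"] prod.delta cong: if_cong)
  show "has_bochner_integral (gauss_vec v) (\<lambda>x::real^'m. x $ i) 0"
    by (rule *[OF m1]) auto
  show "has_bochner_integral (gauss_vec v) (\<lambda>x::real^'m. x $ i * x $ i) v"
    by (rule *[OF m2]) auto
  show "has_bochner_integral (gauss_vec v) (\<lambda>x::real^'m. (x $ i)^4) (3 * v\<^sup>2)"
    by (rule *[OF m4]) auto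
  show "has_bochner_integral (gauss_vec v) (\<lambda>x::real^'m. x $ i * x $ j) 0" if "i \<noteq> j"
  proof -
    have "has_bochner_integral (gauss_vec v)
        (\<lambda>x::real^'m. \<Prod>k\<in>UNIV. (if k \<in> {i,j} then (\<lambda>x. x) else (\<lambda>_. 1)) (x $ k)) (\<Prod>k\<in>UNIV. if k \<in> {i,j} then 0 else 1)"
      using m0 m1 by (intro has_bochner_integral_gauss_vec_prod) auto
    also have "(\<Prod>k\<in>(UNIV::'m set). if k \<in> {i,j} then 0 else (1::real)) = 0"
      by (rule prod_zero) auto
    also have "(\<lambda>x::real^'m. \<Prod>k\<in>UNIV. (if k \<in> {i,j} then (\<lambda>x. x) else (\<lambda>_. 1)) (x $ k))
       = (\<lambda>x::real^'m. \<Prod>k\<in>UNIV. if k \<in> {i,j} then x $ k else 1)"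
      by (intro ext prod.cong) auto
    also have "\<dots> = (\<lambda>x::real^'m. x $ i * x $ j)"
      using that by (subst prod.If_cases) (auto simp: Collect_disj_eq)
    finally show ?thesis .
  qed
  have "has_bochner_integral (gauss_vec v) (\<lambda>x::real^'m. 1::real) 1"
    using *[of "\<lambda>_. 1" 1] m0 by simp
  then have "integrable (gauss_vec v) (\<lambda>x::real^'m. 1::real)" "measure (gauss_vec v) (space (gauss_vec v :: (real^'m) measure)) = 1"
    by (auto simp: has_bochner_integral_iff)
  then show "prob_space (gauss_vec v :: (real^'m) measure)"
    by (metis measure_eq_emeasure_eq_ennreal[of 1] prob_spaceI ennreal_1 emeasure_eq_ennreal_measure measure_zero_top top.not_eq_extremum zero_neq_one zero_le_one)
qed

section \<open>Matrix-vector products\<close>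

lemma inner_matrix_vector_mult: "y \<bullet> (A *v x) = (y v* A) \<bullet> (x :: real^'m)" for A :: "real^'m^'d"
  by (simp add: dot_lmul_matrix)

text \<open>The norm of \<open>real^'m^'d\<close> is the Frobenius norm, which dominates the
  operator norm; Cauchy-Schwarz in each row.\<close>

lemma norm_matrix_vector_mult_le: "norm (A *v x) \<le> norm A * norm x" for A :: "real^'m^'d"
proof -
  have "norm (A *v x) \<le> L2_set (\<lambda>i. norm (A $ i) * norm x) UNIV"
    unfolding norm_vec_def[of "A *v x"]
    by (rule L2_set_mono)
       (auto simp: matrix_vector_mul_component Cauchy_Schwarz_ineq2)
  also have "\<dots> = norm A * norm x"
    by (simp add: norm_vec_def[of A] L2_set_right_distrib[symmetric] L2_set_left_distrib)
  finally show ?thesis .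
qed

lemma norm_vector_matrix_mult_le: "norm (y v* A) \<le> norm y * norm A" for A :: "real^'m^'d"
proof (cases "y v* A = 0")
  case False
  have "(norm (y v* A))\<^sup>2 = y \<bullet> (A *v (y v* A))"
    by (simp add: inner_matrix_vector_mult power2_norm_eq_inner)
  also have "\<dots> \<le> norm y * norm (A *v (y v* A))"
    by (rule norm_cauchy_schwarz)
  also have "\<dots> \<le> norm y * (norm A * norm (y v* A))"
    by (intro mult_left_mono norm_matrix_vector_mult_le) auto
  finally show ?thesis
    using False by (simp add: power2_eq_square)
qed simp

text \<open>Row \<open>i\<close> is \<open>axis i 1 v* A\<close>. Second moments are computed
  direction by direction, and this adds the directions up to the Frobenius norm.\<close>

lemma norm_matrix_sq_eq_sum_rows: "(norm A)\<^sup>2 = (\<Sum>i\<in>UNIV. (norm (axis i 1 v* A))\<^sup>2)" for A :: "real^'m^'d"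
proof -
  have "axis i 1 v* A = A $ i" for i
    by (simp add: vec_eq_iff vector_matrix_mult_def axis_def if_distrib[where f="\<lambda>x. x * _"] sum.delta cong: if_cong)
  then show ?thesis
    by (simp add: norm_vec_def[of A] L2_set_def sum_nonneg)
qed

lemma bounded_bilinear_matrix_vector_mult:
  "bounded_bilinear ((*v) :: real^'m^'d \<Rightarrow> real^'m \<Rightarrow> real^'d)"
proof
  show "\<exists>K. \<forall>(A::real^'m^'d) x. norm (A *v x) \<le> norm A * norm x * K"
    by (rule exI[of _ 1]) (simp add: norm_matrix_vector_mult_le)
qed (auto simp: matrix_vector_mult_def vec_eq_iff algebra_simps sum.distrib sum_distrib_left)

lemma bounded_bilinear_vector_matrix_mult:
  "bounded_bilinear ((v*) :: real^'d \<Rightarrow> real^'m^'d \<Rightarrow> real^'m)"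
proof
  show "\<exists>K. \<forall>(x::real^'d) (A::real^'m^'d). norm (x v* A) \<le> norm x * norm A * K"
    by (rule exI[of _ 1]) (simp add: norm_vector_matrix_mult_le)
qed (auto simp: vector_matrix_mult_def vec_eq_iff algebra_simps sum.distrib sum_distrib_left)

lemma borel_measurable_bounded_bilinear:
  fixes h :: "'b::euclidean_space \<Rightarrow> 'c::euclidean_space \<Rightarrow> 'e::euclidean_space"
  assumes "bounded_bilinear h" "f \<in> borel_measurable N" "g \<in> borel_measurable N"
  shows "(\<lambda>x. h (f x) (g x)) \<in> borel_measurable N"
  using assms(2,3)
proof (rule borel_measurable_continuous_Pair)
  show "continuous_on UNIV (\<lambda>x. h (fst x) (snd x))"
    by (intro bounded_bilinear.continuous_on[OF assms(1)] continuous_intros)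
qed

lemmas borel_measurable_matrix_vector_mult [measurable (raw)] =
  borel_measurable_bounded_bilinear[OF bounded_bilinear_matrix_vector_mult]
lemmas borel_measurable_vector_matrix_mult [measurable (raw)] =
  borel_measurable_bounded_bilinear[OF bounded_bilinear_vector_matrix_mult]

lemma borel_measurable_vec_component [measurable (raw)]:
  "f \<in> borel_measurable N \<Longrightarrow> (\<lambda>x. f x $ i) \<in> borel_measurable N" for f :: "'a \<Rightarrow> real^'m"
  by (simp add: cart_eq_inner_axis)

section \<open>Increments of a Brownian motion\<close>

locale brownian = prob_space M for M :: "'a measure" +
  fixes T :: real and F :: "real \<Rightarrow> 'a measure" and W :: "real \<Rightarrow> 'a \<Rightarrow> real^'m"
  assumes filtration: "filtration_on M T F" and brownian_motion: "brownian_motion_on M T F W"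
begin

lemma subalgebra_F: "0 \<le> t \<Longrightarrow> t \<le> T \<Longrightarrow> subalgebra M (F t)"
  using filtration by (auto simp: filtration_on_def)

lemma space_F [simp]: "0 \<le> t \<Longrightarrow> t \<le> T \<Longrightarrow> space (F t) = space M"
  using subalgebra_F by (auto simp: subalgebra_def)

lemma measurable_F: "f \<in> measurable (F t) N \<Longrightarrow> 0 \<le> t \<Longrightarrow> t \<le> T \<Longrightarrow> f \<in> measurable M N"
  using subalgebra_F measurable_from_subalg by blast

lemma measurable_F_mono: "f \<in> measurable (F s) N \<Longrightarrow> 0 \<le> s \<Longrightarrow> s \<le> t \<Longrightarrow> t \<le> T \<Longrightarrow> f \<in> measurable (F t) N"
  using filtration by (intro measurable_from_subalg[of "F t" "F s"]) (auto simp: filtration_on_def subalgebra_def)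

lemma sets_F: "A \<in> sets (F t) \<Longrightarrow> 0 \<le> t \<Longrightarrow> t \<le> T \<Longrightarrow> A \<in> sets M"
  using subalgebra_F by (auto simp: subalgebra_def)

lemma sets_F_mono: "A \<in> sets (F s) \<Longrightarrow> 0 \<le> s \<Longrightarrow> s \<le> t \<Longrightarrow> t \<le> T \<Longrightarrow> A \<in> sets (F t)"
  using filtration by (fastforce simp: filtration_on_def)

lemma W_adapted: "0 \<le> t \<Longrightarrow> t \<le> T \<Longrightarrow> W t \<in> borel_measurable (F t)"
  using brownian_motion by (auto simp: brownian_motion_on_def adapted_on_def)

lemma W_measurable: "0 \<le> t \<Longrightarrow> t \<le> T \<Longrightarrow> W t \<in> borel_measurable M"
  using W_adapted measurable_F by blast

text \<open>The definition of Brownian motion couples independence and Gaussian law in one product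
  formula. Taking \<open>A = space M\<close> isolates the law of the increment; the formula then
  becomes the product rule on the intersection-stable families of preimages, so \<open>g\<close> and
  \<open>k\<close> of the increment are independent and the expectation factorises.\<close>

lemma increment_indep:
  fixes g :: "'a \<Rightarrow> real" and k :: "real^'m \<Rightarrow> real"
  assumes st: "0 \<le> s" "s < t" "t \<le> T" and g: "g \<in> borel_measurable (F s)" "integrable M g"
    and k: "has_bochner_integral (gauss_vec (t - s)) k c"
  shows "has_bochner_integral M (\<lambda>\<omega>. g \<omega> * k (W t \<omega> - W s \<omega>)) (expectation g * c)"
proof -
  define D where "D \<omega> = W t \<omega> - W s \<omega>" for \<omega>
  have Dm[measurable]: "D \<in> borel_measurable M"
    unfolding D_def using st by (intro borel_measurable_diff W_measurable) auto
  have km[measurable]: "k \<in> borel_measurable borel"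
    using borel_measurable_has_bochner_integral[OF k] by (simp add: gauss_vec_def)
  have gm[measurable]: "g \<in> borel_measurable M" using g by auto
  interpret G: prob_space "gauss_vec (t - s) :: (real^'m) measure"
    using st by (intro prob_space_gauss_vec) auto
  have eq: "prob (A \<inter> (D -` B \<inter> space M)) = prob A * measure (gauss_vec (t - s)) B"
    if "A \<in> sets (F s)" "B \<in> sets borel" for A B
  proof -
    have "A \<inter> (D -` B \<inter> space M) = A \<inter> {\<omega> \<in> space M. W t \<omega> - W s \<omega> \<in> B}"
      by (auto simp: D_def)
    then show ?thesis
      using brownian_motion st that unfolding brownian_motion_on_def by simp
  qed
  have spF: "space M \<in> sets (F s)"
    using st by (metis sets.top space_F less_imp_le order_trans)
  have eq1: "prob (D -` B \<inter> space M) = measure (gauss_vec (t - s)) B" if "B \<in> sets borel" for B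
    using eq[OF spF that] prob_space by (simp add: Int_left_absorb Int_absorb1)
  have distr: "distr M borel D = gauss_vec (t - s)"
  proof (rule measure_eqI)
    fix B assume "B \<in> sets (distr M borel D)"
    then have B: "B \<in> sets borel" by simp
    show "emeasure (distr M borel D) B = emeasure (gauss_vec (t - s)) B"
      unfolding emeasure_distr[OF Dm B] emeasure_eq_measure G.emeasure_eq_measure eq1[OF B] ..
  qed (simp add: gauss_vec_def)
  have kD: "has_bochner_integral M (\<lambda>\<omega>. k (D \<omega>)) c"
    using k integrable_distr_eq[OF Dm km] integral_distr[OF Dm km]
    unfolding distr has_bochner_integral_iff by metis
  have "indep_var borel g borel (\<lambda>\<omega>. k (D \<omega>))"
    unfolding indep_var_eq
  proof (intro conjI indep_set_sigma_sets indep_setI)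
    show "{g -` A \<inter> space M |A. A \<in> sets borel} \<subseteq> events"
      "{(\<lambda>\<omega>. k (D \<omega>)) -` A \<inter> space M |A. A \<in> sets borel} \<subseteq> events"
      by (auto intro!: measurable_sets[OF gm] measurable_sets[of "\<lambda>\<omega>. k (D \<omega>)" M borel])
    have stable: "Int_stable {f -` A \<inter> space M |A. A \<in> sets borel}" for f :: "'a \<Rightarrow> real"
    proof (rule Int_stableI)
      fix a b assume "a \<in> {f -` A \<inter> space M |A. A \<in> sets borel}" "b \<in> {f -` A \<inter> space M |A. A \<in> sets borel}"
      then obtain A B where "a = f -` A \<inter> space M" "A \<in> sets borel" "b = f -` B \<inter> space M" "B \<in> sets borel"
        by blast
      then show "a \<inter> b \<in> {f -` A \<inter> space M |A. A \<in> sets borel}"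
        by (intro CollectI exI[of _ "A \<inter> B"]) auto
    qed
    show "Int_stable {g -` A \<inter> space M |A. A \<in> sets borel}" by (rule stable)
    show "Int_stable {(\<lambda>\<omega>. k (D \<omega>)) -` A \<inter> space M |A. A \<in> sets borel}" by (rule stable)
    fix a b assume "a \<in> {g -` A \<inter> space M |A. A \<in> sets borel}"
      and "b \<in> {(\<lambda>\<omega>. k (D \<omega>)) -` A \<inter> space M |A. A \<in> sets borel}"
    then obtain A B where A: "A \<in> sets borel" "a = g -` A \<inter> space M"
      and B: "B \<in> sets borel" "b = (\<lambda>\<omega>. k (D \<omega>)) -` B \<inter> space M" by blast
    have "g -` A \<inter> space (F s) \<in> sets (F s)" by (rule measurable_sets[OF g(1) A(1)])
    then have "a \<in> sets (F s)" using A(2) st by simp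
    moreover have "k -` B \<in> sets borel" using measurable_sets[OF km B(1)] by simp
    moreover have "b = D -` (k -` B) \<inter> space M" using B by auto
    ultimately show "prob (a \<inter> b) = prob a * prob b"
      using eq[of a "k -` B"] eq1[of "k -` B"] by simp
  qed measurable
  from indep_var_integrable[OF this g(2)] indep_var_lebesgue_integral[OF this g(2)] kD
  show ?thesis by (simp add: has_bochner_integral_iff D_def)
qed

text \<open>Degenerate steps \<open>s = t\<close> are included because clamping a partition to a
  subinterval produces them. There \<open>gauss_vec 0\<close> has density 0 and is no probability
  law, but the increment is 0 and both sides vanish.\<close>

lemma
  fixes g :: "'a \<Rightarrow> real"
  assumes st: "0 \<le> s" "s \<le> t" "t \<le> T" and g: "g \<in> borel_measurable (F s)" "integrable M g"
  shows increment_1: "has_bochner_integral M (\<lambda>\<omega>. g \<omega> * (W t \<omega> - W s \<omega>) $ i) 0"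
    and increment_2: "has_bochner_integral M (\<lambda>\<omega>. g \<omega> * ((W t \<omega> - W s \<omega>) $ i * (W t \<omega> - W s \<omega>) $ j))
      (if i = j then (t - s) * expectation g else 0)"
    and increment_4: "has_bochner_integral M (\<lambda>\<omega>. g \<omega> * ((W t \<omega> - W s \<omega>) $ i) ^ 4) (3 * (t - s)\<^sup>2 * expectation g)"
proof -
  show "has_bochner_integral M (\<lambda>\<omega>. g \<omega> * (W t \<omega> - W s \<omega>) $ i) 0"
    using increment_indep[OF st(1) _ st(3) g gauss_vec_component[of "t - s" i]] st(2)
    by (cases "s = t") auto
  show "has_bochner_integral M (\<lambda>\<omega>. g \<omega> * ((W t \<omega> - W s \<omega>) $ i * (W t \<omega> - W s \<omega>) $ j))
      (if i = j then (t - s) * expectation g else 0)"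
    using increment_indep[OF st(1) _ st(3) g gauss_vec_component_sq[of "t - s" i]]
      increment_indep[OF st(1) _ st(3) g gauss_vec_component_mult[of "t - s" i j]] st(2)
    by (cases "s = t") (auto simp: mult.commute)
  show "has_bochner_integral M (\<lambda>\<omega>. g \<omega> * ((W t \<omega> - W s \<omega>) $ i) ^ 4) (3 * (t - s)\<^sup>2 * expectation g)"
    using increment_indep[OF st(1) _ st(3) g gauss_vec_component_4[of "t - s" i]] st(2)
    by (cases "s = t") (auto simp: ac_simps)
qed

lemma increment_linear:
  fixes w :: "'a \<Rightarrow> real^'m"
  assumes st: "0 \<le> s" "s \<le> t" "t \<le> T" and w: "w \<in> borel_measurable (F s)" "integrable M (\<lambda>\<omega>. norm (w \<omega>))"
  shows "has_bochner_integral M (\<lambda>\<omega>. w \<omega> \<bullet> (W t \<omega> - W s \<omega>)) 0"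
proof -
  have [measurable]: "w \<in> borel_measurable M" using measurable_F[OF w(1)] st by auto
  have "integrable M (\<lambda>\<omega>. w \<omega> $ i)" for i
    by (rule Bochner_Integration.integrable_bound[OF w(2)]) (auto intro!: component_le_norm_cart)
  then have "has_bochner_integral M (\<lambda>\<omega>. \<Sum>i\<in>UNIV. w \<omega> $ i * (W t \<omega> - W s \<omega>) $ i) (\<Sum>i\<in>(UNIV::'m set). 0)"
    using w(1) by (intro has_bochner_integral_sum increment_1[OF st]) auto
  then show ?thesis by (simp add: inner_vec_def)
qed

text \<open>Mixed products of coordinates have mean zero, so only the diagonal survives and adds up
  to the squared norm of \<open>w\<close>. The weight \<open>\<eta>\<close> is separate from
  \<open>w\<close> because integrability is known only for the combination.\<close>

lemma increment_quadratic:
  fixes w :: "'a \<Rightarrow> real^'m" and \<eta> :: "'a \<Rightarrow> real"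
  assumes st: "0 \<le> s" "s \<le> t" "t \<le> T" and w: "w \<in> borel_measurable (F s)"
    and eta: "\<eta> \<in> borel_measurable (F s)"
    and int: "integrable M (\<lambda>\<omega>. \<eta> \<omega> * (norm (w \<omega>))\<^sup>2)"
  shows "has_bochner_integral M (\<lambda>\<omega>. \<eta> \<omega> * (w \<omega> \<bullet> (W t \<omega> - W s \<omega>))\<^sup>2) ((t - s) * expectation (\<lambda>\<omega>. \<eta> \<omega> * (norm (w \<omega>))\<^sup>2))"
proof -
  have [measurable]: "w \<in> borel_measurable M" "\<eta> \<in> borel_measurable M" using measurable_F[OF w(1)] measurable_F[OF eta] st by auto
  have int': "integrable M (\<lambda>\<omega>. \<eta> \<omega> * (w \<omega> $ i * w \<omega> $ j))" for i j
  proof (rule Bochner_Integration.integrable_bound[OF int _ AE_I2])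
    show "(\<lambda>\<omega>. \<eta> \<omega> * (w \<omega> $ i * w \<omega> $ j)) \<in> borel_measurable M"
      by (intro borel_measurable_times borel_measurable_vec_component) fact+
    fix \<omega>
    have "\<bar>w \<omega> $ i\<bar> * \<bar>w \<omega> $ j\<bar> \<le> norm (w \<omega>) * norm (w \<omega>)"
      by (intro mult_mono component_le_norm_cart) auto
    then show "norm (\<eta> \<omega> * (w \<omega> $ i * w \<omega> $ j)) \<le> norm (\<eta> \<omega> * (norm (w \<omega>))\<^sup>2)"
      by (auto simp: abs_mult power2_eq_square intro!: mult_left_mono)
  qed
  have "has_bochner_integral M (\<lambda>\<omega>. \<Sum>i\<in>UNIV. \<Sum>j\<in>UNIV. (\<eta> \<omega> * (w \<omega> $ i * w \<omega> $ j)) * ((W t \<omega> - W s \<omega>) $ i * (W t \<omega> - W s \<omega>) $ j))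
     (\<Sum>i\<in>UNIV. \<Sum>j\<in>UNIV. if i = j then (t - s) * expectation (\<lambda>\<omega>. \<eta> \<omega> * (w \<omega> $ i * w \<omega> $ j)) else 0)"
  proof (intro has_bochner_integral_sum)
    fix i j
    have "(\<lambda>\<omega>. \<eta> \<omega> * (w \<omega> $ i * w \<omega> $ j)) \<in> borel_measurable (F s)"
      by (intro borel_measurable_times borel_measurable_vec_component w eta)
    from increment_2[OF st this int', of i j]
    show "has_bochner_integral M (\<lambda>\<omega>. (\<eta> \<omega> * (w \<omega> $ i * w \<omega> $ j)) * ((W t \<omega> - W s \<omega>) $ i * (W t \<omega> - W s \<omega>) $ j))
     (if i = j then (t - s) * expectation (\<lambda>\<omega>. \<eta> \<omega> * (w \<omega> $ i * w \<omega> $ j)) else 0)" .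
  qed
  also have "(\<lambda>\<omega>. \<Sum>i\<in>UNIV. \<Sum>j\<in>UNIV. (\<eta> \<omega> * (w \<omega> $ i * w \<omega> $ j)) * ((W t \<omega> - W s \<omega>) $ i * (W t \<omega> - W s \<omega>) $ j))
     = (\<lambda>\<omega>. \<eta> \<omega> * (w \<omega> \<bullet> (W t \<omega> - W s \<omega>))\<^sup>2)"
    by (simp add: inner_vec_def power2_eq_square sum_product sum_distrib_left ac_simps)
  also have "(\<Sum>i\<in>UNIV. \<Sum>j\<in>UNIV. if i = j then (t - s) * expectation (\<lambda>\<omega>. \<eta> \<omega> * (w \<omega> $ i * w \<omega> $ j)) else 0)
      = (t - s) * (\<Sum>i\<in>UNIV. expectation (\<lambda>\<omega>. \<eta> \<omega> * (w \<omega> $ i * w \<omega> $ i)))"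
    by (simp add: sum_distrib_left)
  also have "(\<Sum>i\<in>UNIV. expectation (\<lambda>\<omega>. \<eta> \<omega> * (w \<omega> $ i * w \<omega> $ i))) = expectation (\<lambda>\<omega>. \<Sum>i\<in>UNIV. \<eta> \<omega> * (w \<omega> $ i * w \<omega> $ i))"
    using int' by (intro Bochner_Integration.integral_sum[symmetric]) auto
  also have "(\<lambda>\<omega>. \<Sum>i\<in>UNIV. \<eta> \<omega> * (w \<omega> $ i * w \<omega> $ i)) = (\<lambda>\<omega>. \<eta> \<omega> * (norm (w \<omega>))\<^sup>2)"
    unfolding power2_norm_eq_inner by (simp add: inner_vec_def sum_distrib_left)
  finally show ?thesis .
qed

lemma increment_norm_sq:
  fixes g :: "'a \<Rightarrow> real"
  assumes st: "0 \<le> s" "s \<le> t" "t \<le> T" and g: "g \<in> borel_measurable (F s)" "integrable M g"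
  shows "has_bochner_integral M (\<lambda>\<omega>. g \<omega> * (norm (W t \<omega> - W s \<omega>))\<^sup>2) (CARD('m) * ((t - s) * expectation g))"
proof -
  have "has_bochner_integral M (\<lambda>\<omega>. \<Sum>i\<in>UNIV. g \<omega> * ((W t \<omega> - W s \<omega>) $ i * (W t \<omega> - W s \<omega>) $ i)) (\<Sum>i\<in>(UNIV::'m set). (t - s) * expectation g)"
  proof (rule has_bochner_integral_sum)
    fix i
    show "has_bochner_integral M (\<lambda>\<omega>. g \<omega> * ((W t \<omega> - W s \<omega>) $ i * (W t \<omega> - W s \<omega>) $ i)) ((t - s) * expectation g)"
      using increment_2[OF st g, of i i] by (simp only: if_True simp_thms)
  qed
  also have "(\<lambda>\<omega>. \<Sum>i\<in>UNIV. g \<omega> * ((W t \<omega> - W s \<omega>) $ i * (W t \<omega> - W s \<omega>) $ i)) = (\<lambda>\<omega>. g \<omega> * (norm (W t \<omega> - W s \<omega>))\<^sup>2)"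
    unfolding power2_norm_eq_inner by (simp add: inner_vec_def sum_distrib_left)
  finally show ?thesis by simp
qed

text \<open>The constant is the one-dimensional fourth moment \<open>3 (t - s)^2\<close>, summed
  over the coordinates, times one more factor \<open>CARD('m)\<close> from Cauchy-Schwarz for the
  square of a sum.\<close>

lemma
  fixes s t :: real
  assumes st: "0 \<le> s" "s \<le> t" "t \<le> T"
  shows integrable_increment_norm_4: "integrable M (\<lambda>\<omega>. (norm (W t \<omega> - W s \<omega>)) ^ 4)"
    and increment_norm_4_le: "expectation (\<lambda>\<omega>. (norm (W t \<omega> - W s \<omega>)) ^ 4) \<le> 3 * (real CARD('m))\<^sup>2 * (t - s)\<^sup>2"
proof -
  have [measurable]: "W s \<in> borel_measurable M" "W t \<in> borel_measurable M"
    using st by (auto intro!: W_measurable)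
  have *: "has_bochner_integral M (\<lambda>\<omega>. CARD('m) * (\<Sum>i\<in>UNIV. 1 * ((W t \<omega> - W s \<omega>) $ i) ^ 4))
      (CARD('m) * (\<Sum>i\<in>(UNIV::'m set). 3 * (t - s)\<^sup>2 * expectation (\<lambda>_. 1)))"
    by (intro has_bochner_integral_mult_right has_bochner_integral_sum increment_4[OF st]) auto
  have le: "(norm x) ^ 4 \<le> CARD('m) * (\<Sum>i\<in>UNIV. 1 * (x $ i) ^ 4)" for x :: "real^'m"
  proof -
    have "(norm x)^2 = (\<Sum>i\<in>UNIV. (x $ i)\<^sup>2)"
      unfolding power2_norm_eq_inner by (simp add: inner_vec_def power2_eq_square)
    then have "(norm x) ^ 4 = (\<Sum>i\<in>UNIV. (x $ i)\<^sup>2)\<^sup>2"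
      by (simp add: power4_eq_xxxx power2_eq_square mult.assoc)
    also have "\<dots> \<le> CARD('m) * (\<Sum>i\<in>UNIV. ((x $ i)\<^sup>2)\<^sup>2)"
      using sum_squared_le_sum_of_squares[of "\<lambda>i. (x $ i)\<^sup>2" "UNIV::'m set"] by (simp add: mult.commute)
    finally show ?thesis by simp
  qed
  show int: "integrable M (\<lambda>\<omega>. (norm (W t \<omega> - W s \<omega>)) ^ 4)"
    by (rule Bochner_Integration.integrable_bound[OF integrable.intros[OF *]]) (auto intro!: order_trans[OF le])
  have "expectation (\<lambda>\<omega>. (norm (W t \<omega> - W s \<omega>)) ^ 4) \<le> expectation (\<lambda>\<omega>. CARD('m) * (\<Sum>i\<in>UNIV. 1 * ((W t \<omega> - W s \<omega>) $ i) ^ 4))"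
    by (intro integral_mono int integrable.intros[OF *] le)
  also have "\<dots> = 3 * (real CARD('m))\<^sup>2 * (t - s)\<^sup>2"
    using has_bochner_integral_integral_eq[OF *] by (simp add: power2_eq_square prob_space)
  finally show "expectation (\<lambda>\<omega>. (norm (W t \<omega> - W s \<omega>)) ^ 4) \<le> 3 * (real CARD('m))\<^sup>2 * (t - s)\<^sup>2" .
qed

end

section \<open>Discrete stochastic integrals\<close>

lemma partition_mono:
  fixes p :: "nat \<Rightarrow> real"
  assumes "\<And>k. k < n \<Longrightarrow> p k \<le> p (Suc k)" and "i \<le> j" "j \<le> n"
  shows "p i \<le> p j"
  using assms(2,3)
proof (induction j)
  case (Suc j)
  then show ?case using assms(1)[of j] by (cases "i = Suc j") auto
qed simp

text \<open>The induction step for fourth moments of martingales. The term linear in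
  \<open>z\<close> is kept exactly because its expectation will vanish; the others go into
  \<open>|x|^2 |z|^2\<close> and \<open>|z|^4\<close> by Cauchy-Schwarz and
  \<open>2 a b \<le> a^2 + b^2\<close>, with \<open>8 = 2 + 4 + 2\<close> and
  \<open>3 = 1 + 2\<close>.\<close>

lemma norm_add_power4_le:
  fixes x z :: "'b::real_inner"
  shows "norm (x + z) ^ 4 \<le> norm x ^ 4 + 4 * (norm x)\<^sup>2 * (x \<bullet> z) + 8 * (norm x)\<^sup>2 * (norm z)\<^sup>2 + 3 * norm z ^ 4"
proof -
  have "(norm (x + z))\<^sup>2 = (norm x)\<^sup>2 + 2 * (x \<bullet> z) + (norm z)\<^sup>2"
    unfolding power2_norm_eq_inner by (simp add: inner_add_left inner_add_right inner_commute)
  moreover have "norm (x + z) ^ 4 = ((norm (x + z))\<^sup>2)\<^sup>2" by simp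
  ultimately have "norm (x + z) ^ 4 = ((norm x)\<^sup>2 + 2 * (x \<bullet> z) + (norm z)\<^sup>2)\<^sup>2" by simp
  also have "\<dots> = norm x ^ 4 + 4 * (norm x)\<^sup>2 * (x \<bullet> z) + 2 * (norm x)\<^sup>2 * (norm z)\<^sup>2 + norm z ^ 4
      + 4 * (x \<bullet> z)\<^sup>2 + 4 * (x \<bullet> z) * (norm z)\<^sup>2"
    by (simp add: power2_eq_square power4_eq_xxxx algebra_simps)
  also have "(x \<bullet> z)\<^sup>2 \<le> (norm x)\<^sup>2 * (norm z)\<^sup>2"
    by (metis Cauchy_Schwarz_ineq power2_norm_eq_inner)
  also have "4 * (x \<bullet> z) * (norm z)\<^sup>2 \<le> 2 * (norm x)\<^sup>2 * (norm z)\<^sup>2 + 2 * norm z ^ 4"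
  proof -
    have "2 * (x \<bullet> z) \<le> (norm x)\<^sup>2 + (norm z)\<^sup>2"
      using norm_cauchy_schwarz[of x z] sum_squares_bound[of "norm x" "norm z"] by (simp add: mult.assoc)
    then have "2 * (norm z)\<^sup>2 * (2 * (x \<bullet> z)) \<le> 2 * (norm z)\<^sup>2 * ((norm x)\<^sup>2 + (norm z)\<^sup>2)"
      by (intro mult_left_mono) auto
    then show ?thesis
      by (simp add: power2_eq_square power4_eq_xxxx algebra_simps)
  qed
  finally show ?thesis by (simp add: algebra_simps)
qed

lemma power_le_1_add_power4: "a ^ j \<le> 1 + a ^ 4" if "0 \<le> a" "j \<le> 4" for a :: real
proof (cases "a \<le> 1")
  case True
  then show ?thesis using power_le_one[of a j] that zero_le_power[of a 4] by linarith
next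
  case False
  then show ?thesis using power_increasing[of j 4 a] that by linarith
qed

section \<open>Martingale transforms and their moments\<close>

context brownian
begin

definition transform :: "(nat \<Rightarrow> real) \<Rightarrow> (nat \<Rightarrow> 'a \<Rightarrow> real^'m^'d) \<Rightarrow> nat \<Rightarrow> 'a \<Rightarrow> real^'d" where
  "transform q \<xi> n \<omega> = (\<Sum>k<n. \<xi> k \<omega> *v (W (q (Suc k)) \<omega> - W (q k) \<omega>))"

text \<open>Predictability of \<open>\<xi>\<close> along \<open>q\<close>, with one deterministic
  bound for all steps. Steps may be degenerate and \<open>q\<close> may start late, since the
  partitions come from clamping a partition of \<open>[0,T]\<close> to a subinterval.\<close>

definition admissible :: "(nat \<Rightarrow> real) \<Rightarrow> (nat \<Rightarrow> 'a \<Rightarrow> real^'m^'d) \<Rightarrow> nat \<Rightarrow> real \<Rightarrow> bool" where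
  "admissible q \<xi> n R \<longleftrightarrow> 0 \<le> q 0 \<and> q n \<le> T \<and>
     (\<forall>k<n. q k \<le> q (Suc k) \<and> \<xi> k \<in> borel_measurable (F (q k)) \<and> (\<forall>\<omega>\<in>space M. norm (\<xi> k \<omega>) \<le> R))"

lemma transform_0 [simp]: "transform q \<xi> 0 \<omega> = 0"
  by (simp add: transform_def)

lemma transform_Suc:
  "transform q \<xi> (Suc n) \<omega> = transform q \<xi> n \<omega> + \<xi> n \<omega> *v (W (q (Suc n)) \<omega> - W (q n) \<omega>)"
  by (simp add: transform_def)

lemma admissible_mono: "admissible q \<xi> n R \<Longrightarrow> i \<le> j \<Longrightarrow> j \<le> n \<Longrightarrow> q i \<le> q j"
  by (rule partition_mono[of n q i j]) (simp_all add: admissible_def)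

lemma admissible_le: "admissible q \<xi> n R \<Longrightarrow> m \<le> n \<Longrightarrow> admissible q \<xi> m R"
  using admissible_mono[of q \<xi> n R m n] unfolding admissible_def by fastforce

lemma admissible_bounds:
  assumes "admissible q \<xi> n R" "k \<le> n"
  shows "0 \<le> q k" "q k \<le> T"
  using assms admissible_mono[OF assms(1) le0 assms(2)] admissible_mono[OF assms(1,2) order_refl]
  unfolding admissible_def by linarith+

lemma admissible_stepD:
  assumes "admissible q \<xi> n R" "k < n"
  shows "0 \<le> q k" "q k \<le> q (Suc k)" "q (Suc k) \<le> T" "\<xi> k \<in> borel_measurable (F (q k))"
    and "\<And>\<omega>. \<omega> \<in> space M \<Longrightarrow> norm (\<xi> k \<omega>) \<le> R"
  using assms admissible_bounds[OF assms(1), of k] admissible_bounds[OF assms(1), of "Suc k"]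
  unfolding admissible_def by simp_all

lemma admissible_measurable:
  assumes "admissible q \<xi> n R" "k < n" "k \<le> m" "m \<le> n"
  shows "\<xi> k \<in> borel_measurable (F (q m))"
  using measurable_F_mono[OF admissible_stepD(4,1)[OF assms(1,2)] admissible_mono[OF assms(1,3,4)]]
    admissible_bounds(2)[OF assms(1,4)] by simp

lemma transform_measurable:
  assumes "admissible q \<xi> n R"
  shows "transform q \<xi> n \<in> borel_measurable (F (q n))"
  unfolding transform_def
proof (intro borel_measurable_sum borel_measurable_matrix_vector_mult borel_measurable_diff)
  fix k assume k: "k \<in> {..<n}"
  show "\<xi> k \<in> borel_measurable (F (q n))" using admissible_measurable[OF assms] k by auto
  have *: "W (q j) \<in> borel_measurable (F (q n))" if "j \<le> n" for j
    using measurable_F_mono[OF W_adapted, of "q j" "q n"] admissible_bounds[OF assms that]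
      admissible_bounds[OF assms order_refl] admissible_mono[OF assms that order_refl] by simp
  show "W (q (Suc k)) \<in> borel_measurable (F (q n))" "W (q k) \<in> borel_measurable (F (q n))"
    using k by (auto intro!: *)
qed

lemma transform_measurable_M:
  "admissible q \<xi> n R \<Longrightarrow> transform q \<xi> n \<in> borel_measurable M"
  using measurable_F[OF transform_measurable] admissible_bounds[of q \<xi> n R n] by blast

text \<open>Integrability has to precede the exact moments, because the Bochner integral of a
  non-integrable function is 0 by convention. Here the crude bound
  \<open>|x + z|^4 \<le> 8 |x|^4 + 8 |z|^4\<close> is good enough.\<close>

lemma transform_integrable_norm_4:
  assumes "admissible q \<xi> n R"
  shows "integrable M (\<lambda>\<omega>. norm (transform q \<xi> n \<omega>) ^ 4)"
  using assms
proof (induction n)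
  case (Suc n)
  have adm: "admissible q \<xi> n R" using admissible_le[OF Suc.prems, of n] by simp
  note st = admissible_stepD[OF Suc.prems, of n, simplified]
  note [measurable] = transform_measurable_M[OF Suc.prems]
  have int: "integrable M (\<lambda>\<omega>. 8 * norm (transform q \<xi> n \<omega>) ^ 4 + 8 * (R ^ 4 * norm (W (q (Suc n)) \<omega> - W (q n) \<omega>) ^ 4))"
    by (intro Bochner_Integration.integrable_add integrable_mult_right Suc.IH adm integrable_increment_norm_4 st)
  show ?case
  proof (rule Bochner_Integration.integrable_bound[OF int _ AE_I2])
    show "(\<lambda>\<omega>. norm (transform q \<xi> (Suc n) \<omega>) ^ 4) \<in> borel_measurable M" by measurable
    fix \<omega> assume \<omega>: "\<omega> \<in> space M"
    let ?x = "transform q \<xi> n \<omega>" and ?D = "W (q (Suc n)) \<omega> - W (q n) \<omega>"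
    let ?z = "\<xi> n \<omega> *v ?D"
    have "norm ?z \<le> R * norm ?D"
      using norm_matrix_vector_mult_le[of "\<xi> n \<omega>" ?D] st(5)[OF \<omega>]
      by (meson mult_right_mono norm_ge_zero order_trans)
    then have z: "norm ?z ^ 4 \<le> (R * norm ?D) ^ 4"
      by (intro power_mono) auto
    have "norm (?x + ?z) ^ 4 \<le> (norm ?x + norm ?z) ^ 4"
      by (intro power_mono norm_triangle_ineq) auto
    also have "\<dots> = ((norm ?x + norm ?z)\<^sup>2)\<^sup>2" by simp
    also have "\<dots> \<le> (2 * (norm ?x)\<^sup>2 + 2 * (norm ?z)\<^sup>2)\<^sup>2"
      using sum_squares_bound[of "norm ?x" "norm ?z"] by (intro power_mono) (auto simp: power2_sum)
    also have "\<dots> \<le> 8 * norm ?x ^ 4 + 8 * norm ?z ^ 4"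
      using sum_squares_bound[of "(norm ?x)\<^sup>2" "(norm ?z)\<^sup>2"] by (auto simp: power2_sum power_mult_distrib)
    also have "\<dots> \<le> 8 * norm ?x ^ 4 + 8 * (R ^ 4 * norm ?D ^ 4)"
      using z by (simp add: power_mult_distrib)
    finally show "norm (norm (transform q \<xi> (Suc n) \<omega>) ^ 4) \<le> norm (8 * norm ?x ^ 4 + 8 * (R ^ 4 * norm ?D ^ 4))"
      by (simp add: transform_Suc)
  qed
qed simp

lemma transform_integrable_norm:
  assumes "admissible q \<xi> n R" "j \<le> 4"
  shows "integrable M (\<lambda>\<omega>. norm (transform q \<xi> n \<omega>) ^ j)"
proof (rule Bochner_Integration.integrable_bound[OF _ _ AE_I2])
  note [measurable] = transform_measurable_M[OF assms(1)]
  show "integrable M (\<lambda>\<omega>. 1 + norm (transform q \<xi> n \<omega>) ^ 4)"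
    using transform_integrable_norm_4[OF assms(1)] by simp
  show "(\<lambda>\<omega>. norm (transform q \<xi> n \<omega>) ^ j) \<in> borel_measurable M" by measurable
  fix \<omega>
  show "norm (norm (transform q \<xi> n \<omega>) ^ j) \<le> norm (1 + norm (transform q \<xi> n \<omega>) ^ 4)"
    using power_le_1_add_power4[of "norm (transform q \<xi> n \<omega>)" j] assms(2) by simp
qed

lemma transform_linear:
  assumes adm: "admissible q \<xi> n R" and y: "y \<in> borel_measurable (F (q 0))"
    and B: "\<And>\<omega>. \<omega> \<in> space M \<Longrightarrow> norm (y \<omega>) \<le> B"
  shows "has_bochner_integral M (\<lambda>\<omega>. y \<omega> \<bullet> transform q \<xi> n \<omega>) 0"
proof -
  have "has_bochner_integral M (\<lambda>\<omega>. \<Sum>k<n. (y \<omega> v* \<xi> k \<omega>) \<bullet> (W (q (Suc k)) \<omega> - W (q k) \<omega>)) (\<Sum>k<n. 0)"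
  proof (intro has_bochner_integral_sum increment_linear)
    fix k assume "k \<in> {..<n}"
    then have k: "k < n" by simp
    note st = admissible_stepD[OF adm k]
    show "0 \<le> q k" "q k \<le> q (Suc k)" "q (Suc k) \<le> T" by fact+
    have "y \<in> borel_measurable (F (q k))"
      using y st admissible_mono[OF adm, of 0 k] k admissible_bounds[OF adm, of 0] by (auto intro: measurable_F_mono)
    then show m: "(\<lambda>\<omega>. y \<omega> v* \<xi> k \<omega>) \<in> borel_measurable (F (q k))"
      using st by measurable
    have [measurable]: "(\<lambda>\<omega>. y \<omega> v* \<xi> k \<omega>) \<in> borel_measurable M"
      using m st by (auto intro!: measurable_F)
    show "integrable M (\<lambda>\<omega>. norm (y \<omega> v* \<xi> k \<omega>))"
    proof (rule integrable_const_bound[of _ "B * R", OF AE_I2])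
      fix \<omega> assume \<omega>: "\<omega> \<in> space M"
      have "norm (y \<omega> v* \<xi> k \<omega>) \<le> norm (y \<omega>) * norm (\<xi> k \<omega>)" by (rule norm_vector_matrix_mult_le)
      also have "\<dots> \<le> B * R" using B[OF \<omega>] st(5)[OF \<omega>] by (intro mult_mono) (auto intro: order_trans[OF norm_ge_zero])
      finally show "norm (norm (y \<omega> v* \<xi> k \<omega>)) \<le> B * R" by simp
    qed measurable
  qed
  then show ?thesis
    by (simp add: transform_def inner_sum_right inner_matrix_vector_mult)
qed

text \<open>The Ito isometry in the direction \<open>y\<close>, conditional on
  \<open>F (q 0)\<close>: the conditioning is replaced by a direction \<open>y\<close> and a weight
  \<open>\<eta>\<close> that are known at time \<open>q 0\<close>. By induction on the number of
  steps, since the mixed term of the sum so far and the new increment has mean zero.\<close>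

lemma transform_quadratic:
  assumes adm: "admissible q \<xi> n R" and y: "y \<in> borel_measurable (F (q 0))"
    and B: "\<And>\<omega>. \<omega> \<in> space M \<Longrightarrow> norm (y \<omega>) \<le> B"
    and eta: "\<eta> \<in> borel_measurable (F (q 0))" and C: "\<And>\<omega>. \<omega> \<in> space M \<Longrightarrow> \<bar>\<eta> \<omega>\<bar> \<le> C"
  shows "has_bochner_integral M (\<lambda>\<omega>. \<eta> \<omega> * (y \<omega> \<bullet> transform q \<xi> n \<omega>)\<^sup>2)
      (expectation (\<lambda>\<omega>. \<eta> \<omega> * (\<Sum>k<n. (norm (y \<omega> v* \<xi> k \<omega>))\<^sup>2 * (q (Suc k) - q k))))"
  using adm
proof (induction n)
  case 0
  then show ?case by (simp add: has_bochner_integral_zero)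
next
  case (Suc n)
  have adm: "admissible q \<xi> n R" using admissible_le[OF Suc.prems, of n] by simp
  note st = admissible_stepD[OF Suc.prems, of n, simplified]
  have q: "0 \<le> q 0" "q 0 \<le> q n" using admissible_mono[OF adm, of 0 n] adm by (auto simp: admissible_def)
  have ym: "y \<in> borel_measurable (F (q n))" and em: "\<eta> \<in> borel_measurable (F (q n))"
    using y eta st q by (auto intro: measurable_F_mono)
  let ?D = "\<lambda>\<omega>. W (q (Suc n)) \<omega> - W (q n) \<omega>" and ?S = "transform q \<xi> n"
  let ?v = "\<lambda>\<omega>. y \<omega> v* \<xi> n \<omega>"
  have "space M \<noteq> {}" using not_empty .
  then obtain \<omega>0 where \<omega>0: "\<omega>0 \<in> space M" by blast
  have BRC: "0 \<le> B" "0 \<le> R" "0 \<le> C"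
    using order_trans[OF norm_ge_zero B[OF \<omega>0]] order_trans[OF norm_ge_zero st(5)[OF \<omega>0]]
      order_trans[OF abs_ge_zero C[OF \<omega>0]] by auto
  have vm: "?v \<in> borel_measurable (F (q n))" using ym st by measurable
  have sm: "?S \<in> borel_measurable (F (q n))" using transform_measurable[OF adm] .
  have vM[measurable]: "?v \<in> borel_measurable M" using vm st by (auto intro!: measurable_F)
  have eM[measurable]: "\<eta> \<in> borel_measurable M" using em st by (auto intro!: measurable_F)
  have yM[measurable]: "y \<in> borel_measurable M" using ym st by (auto intro!: measurable_F)
  have SM[measurable]: "?S \<in> borel_measurable M" using transform_measurable_M[OF adm] .
  have xM[measurable]: "k < Suc n \<Longrightarrow> \<xi> k \<in> borel_measurable M" for k
    using admissible_stepD[OF Suc.prems, of k] by (auto intro!: measurable_F)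
  have xik: "norm (y \<omega> v* \<xi> k \<omega>) \<le> B * R" if "k < Suc n" "\<omega> \<in> space M" for k \<omega>
  proof -
    have "norm (y \<omega> v* \<xi> k \<omega>) \<le> norm (y \<omega>) * norm (\<xi> k \<omega>)" by (rule norm_vector_matrix_mult_le)
    also have "\<dots> \<le> B * R" using B that admissible_stepD(5)[OF Suc.prems, of k] BRC by (intro mult_mono) auto
    finally show ?thesis .
  qed
  have v_le: "norm (?v \<omega>) \<le> B * R" if "\<omega> \<in> space M" for \<omega>
    using xik[of n \<omega>] that by simp
  have int_v: "integrable M (\<lambda>\<omega>. \<eta> \<omega> * (norm (y \<omega> v* \<xi> k \<omega>))\<^sup>2)" if k: "k < Suc n" for k
  proof (rule integrable_const_bound[of _ "C * (B * R)\<^sup>2", OF AE_I2])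
    fix \<omega> assume "\<omega> \<in> space M"
    then show "norm (\<eta> \<omega> * (norm (y \<omega> v* \<xi> k \<omega>))\<^sup>2) \<le> C * (B * R)\<^sup>2"
      unfolding norm_mult using C xik[OF k] BRC by (intro mult_mono) (auto intro!: power_mono)
  next
    show "(\<lambda>\<omega>. \<eta> \<omega> * (norm (y \<omega> v* \<xi> k \<omega>))\<^sup>2) \<in> borel_measurable M" using xM[OF k] by measurable
  qed
  \<comment> \<open>The coefficient of the new increment is known at \<open>q n\<close> but
    unbounded through \<open>?S\<close>; its integrability suffices for mean zero.\<close>
  have A2: "has_bochner_integral M (\<lambda>\<omega>. (2 * \<eta> \<omega> * (y \<omega> \<bullet> ?S \<omega>)) *\<^sub>R ?v \<omega> \<bullet> ?D \<omega>) 0"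
  proof (rule increment_linear[OF st(1-3)])
    show "(\<lambda>\<omega>. (2 * \<eta> \<omega> * (y \<omega> \<bullet> ?S \<omega>)) *\<^sub>R ?v \<omega>) \<in> borel_measurable (F (q n))"
      using em ym sm vm by measurable
    have i: "integrable M (\<lambda>\<omega>. 2 * C * B * (B * R) * norm (?S \<omega>))"
      using transform_integrable_norm[OF adm, of 1] by simp
    show "integrable M (\<lambda>\<omega>. norm ((2 * \<eta> \<omega> * (y \<omega> \<bullet> ?S \<omega>)) *\<^sub>R ?v \<omega>))"
    proof (rule Bochner_Integration.integrable_bound[OF i _ AE_I2])
      fix \<omega> assume \<omega>: "\<omega> \<in> space M"
      have "\<bar>y \<omega> \<bullet> ?S \<omega>\<bar> \<le> norm (y \<omega>) * norm (?S \<omega>)" by (rule Cauchy_Schwarz_ineq2)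
      also have "\<dots> \<le> B * norm (?S \<omega>)" using B[OF \<omega>] by (intro mult_right_mono) auto
      finally have 1: "\<bar>y \<omega> \<bullet> ?S \<omega>\<bar> \<le> B * norm (?S \<omega>)" .
      have "2 * \<bar>\<eta> \<omega>\<bar> * \<bar>y \<omega> \<bullet> ?S \<omega>\<bar> * norm (?v \<omega>) \<le> 2 * C * (B * norm (?S \<omega>)) * (B * R)"
        using C[OF \<omega>] 1 v_le[OF \<omega>] BRC by (intro mult_mono) auto
      then show "norm (norm ((2 * \<eta> \<omega> * (y \<omega> \<bullet> ?S \<omega>)) *\<^sub>R ?v \<omega>)) \<le> norm (2 * C * B * (B * R) * norm (?S \<omega>))"
        using BRC by (simp add: abs_mult ac_simps)
    qed measurable
  qed
  have A3: "has_bochner_integral M (\<lambda>\<omega>. \<eta> \<omega> * (?v \<omega> \<bullet> ?D \<omega>)\<^sup>2) ((q (Suc n) - q n) * expectation (\<lambda>\<omega>. \<eta> \<omega> * (norm (?v \<omega>))\<^sup>2))"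
    by (rule increment_quadratic[OF st(1-3) vm em int_v]) simp
  have "has_bochner_integral M
      (\<lambda>\<omega>. \<eta> \<omega> * (y \<omega> \<bullet> ?S \<omega>)\<^sup>2 + ((2 * \<eta> \<omega> * (y \<omega> \<bullet> ?S \<omega>)) *\<^sub>R ?v \<omega> \<bullet> ?D \<omega> + \<eta> \<omega> * (?v \<omega> \<bullet> ?D \<omega>)\<^sup>2))
      (expectation (\<lambda>\<omega>. \<eta> \<omega> * (\<Sum>k<n. (norm (y \<omega> v* \<xi> k \<omega>))\<^sup>2 * (q (Suc k) - q k)))
        + (0 + (q (Suc n) - q n) * expectation (\<lambda>\<omega>. \<eta> \<omega> * (norm (?v \<omega>))\<^sup>2)))"
    by (intro has_bochner_integral_add A2 A3 Suc.IH adm)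
  also have "(\<lambda>\<omega>. \<eta> \<omega> * (y \<omega> \<bullet> ?S \<omega>)\<^sup>2 + ((2 * \<eta> \<omega> * (y \<omega> \<bullet> ?S \<omega>)) *\<^sub>R ?v \<omega> \<bullet> ?D \<omega> + \<eta> \<omega> * (?v \<omega> \<bullet> ?D \<omega>)\<^sup>2))
     = (\<lambda>\<omega>. \<eta> \<omega> * (y \<omega> \<bullet> transform q \<xi> (Suc n) \<omega>)\<^sup>2)"
  proof
    fix \<omega>
    have "\<eta> \<omega> * a\<^sup>2 + (2 * \<eta> \<omega> * a * b + \<eta> \<omega> * b\<^sup>2) = \<eta> \<omega> * (a + b)\<^sup>2" for a b :: real
      by (simp add: power2_sum algebra_simps)
    then show "\<eta> \<omega> * (y \<omega> \<bullet> ?S \<omega>)\<^sup>2 + ((2 * \<eta> \<omega> * (y \<omega> \<bullet> ?S \<omega>)) *\<^sub>R ?v \<omega> \<bullet> ?D \<omega> + \<eta> \<omega> * (?v \<omega> \<bullet> ?D \<omega>)\<^sup>2)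
      = \<eta> \<omega> * (y \<omega> \<bullet> transform q \<xi> (Suc n) \<omega>)\<^sup>2"
      unfolding transform_Suc inner_add_right inner_matrix_vector_mult inner_scaleR_left .
  qed
  also have "expectation (\<lambda>\<omega>. \<eta> \<omega> * (\<Sum>k<n. (norm (y \<omega> v* \<xi> k \<omega>))\<^sup>2 * (q (Suc k) - q k)))
        + (0 + (q (Suc n) - q n) * expectation (\<lambda>\<omega>. \<eta> \<omega> * (norm (?v \<omega>))\<^sup>2))
     = expectation (\<lambda>\<omega>. (\<Sum>k<n. \<eta> \<omega> * (norm (y \<omega> v* \<xi> k \<omega>))\<^sup>2 * (q (Suc k) - q k)) + \<eta> \<omega> * (norm (?v \<omega>))\<^sup>2 * (q (Suc n) - q n))"
  proof -
    have "expectation (\<lambda>\<omega>. (\<Sum>k<n. \<eta> \<omega> * (norm (y \<omega> v* \<xi> k \<omega>))\<^sup>2 * (q (Suc k) - q k)) + \<eta> \<omega> * (norm (?v \<omega>))\<^sup>2 * (q (Suc n) - q n))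
      = expectation (\<lambda>\<omega>. (\<Sum>k<n. \<eta> \<omega> * (norm (y \<omega> v* \<xi> k \<omega>))\<^sup>2 * (q (Suc k) - q k))) + expectation (\<lambda>\<omega>. \<eta> \<omega> * (norm (?v \<omega>))\<^sup>2 * (q (Suc n) - q n))"
      using int_v by (intro Bochner_Integration.integral_add Bochner_Integration.integrable_sum integrable_mult_left) auto
    then show ?thesis
      by (simp add: sum_distrib_left mult.assoc[symmetric])
  qed
  also have "\<dots> = expectation (\<lambda>\<omega>. \<eta> \<omega> * (\<Sum>k<Suc n. (norm (y \<omega> v* \<xi> k \<omega>))\<^sup>2 * (q (Suc k) - q k)))"
    by (simp add: sum_distrib_left algebra_simps)
  finally show ?case .
qed

text \<open>The isometry summed over the coordinate directions \<open>axis i 1\<close>.\<close>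

lemma transform_norm_sq:
  assumes adm: "admissible q \<xi> n R"
    and eta: "\<eta> \<in> borel_measurable (F (q 0))" and C: "\<And>\<omega>. \<omega> \<in> space M \<Longrightarrow> \<bar>\<eta> \<omega>\<bar> \<le> C"
  shows "has_bochner_integral M (\<lambda>\<omega>. \<eta> \<omega> * (norm (transform q \<xi> n \<omega>))\<^sup>2)
      (expectation (\<lambda>\<omega>. \<eta> \<omega> * (\<Sum>k<n. (norm (\<xi> k \<omega>))\<^sup>2 * (q (Suc k) - q k))))"
proof -
  have [measurable]: "\<eta> \<in> borel_measurable M"
    using eta admissible_bounds[OF adm, of 0] by (auto intro: measurable_F)
  have [measurable]: "k < n \<Longrightarrow> \<xi> k \<in> borel_measurable M" for k
    using admissible_stepD[OF adm, of k] by (auto intro!: measurable_F)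
  have "space M \<noteq> {}" using not_empty .
  then obtain \<omega>0 where "\<omega>0 \<in> space M" by blast
  then have C0: "0 \<le> C" using order_trans[OF abs_ge_zero C] by blast
  have int: "integrable M (\<lambda>\<omega>. \<eta> \<omega> * (\<Sum>k<n. (norm (axis i 1 v* \<xi> k \<omega>))\<^sup>2 * (q (Suc k) - q k)))" for i
  proof (rule integrable_const_bound[of _ "C * (\<Sum>k<n. R\<^sup>2 * (q (Suc k) - q k))", OF AE_I2])
    fix \<omega> assume \<omega>: "\<omega> \<in> space M"
    have "(norm (axis i 1 v* \<xi> k \<omega>))\<^sup>2 \<le> R\<^sup>2" if "k < n" for k
      using norm_vector_matrix_mult_le[of "axis i 1" "\<xi> k \<omega>"] admissible_stepD(5)[OF adm that \<omega>]
      by (intro power_mono) auto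
    then have "(\<Sum>k<n. (norm (axis i 1 v* \<xi> k \<omega>))\<^sup>2 * (q (Suc k) - q k)) \<le> (\<Sum>k<n. R\<^sup>2 * (q (Suc k) - q k))"
      using admissible_stepD(2)[OF adm] by (intro sum_mono mult_right_mono) auto
    moreover have "0 \<le> (\<Sum>k<n. (norm (axis i 1 v* \<xi> k \<omega>))\<^sup>2 * (q (Suc k) - q k))"
      using admissible_stepD(2)[OF adm] by (intro sum_nonneg) auto
    ultimately show "norm (\<eta> \<omega> * (\<Sum>k<n. (norm (axis i 1 v* \<xi> k \<omega>))\<^sup>2 * (q (Suc k) - q k))) \<le> C * (\<Sum>k<n. R\<^sup>2 * (q (Suc k) - q k))"
      using C[OF \<omega>] C0 unfolding norm_mult by (intro mult_mono) auto
  next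
    show "(\<lambda>\<omega>. \<eta> \<omega> * (\<Sum>k<n. (norm (axis i 1 v* \<xi> k \<omega>))\<^sup>2 * (q (Suc k) - q k))) \<in> borel_measurable M" by measurable
  qed
  have "has_bochner_integral M (\<lambda>\<omega>. \<Sum>i\<in>UNIV. \<eta> \<omega> * (axis i 1 \<bullet> transform q \<xi> n \<omega>)\<^sup>2)
      (\<Sum>i\<in>UNIV. expectation (\<lambda>\<omega>. \<eta> \<omega> * (\<Sum>k<n. (norm (axis i 1 v* \<xi> k \<omega>))\<^sup>2 * (q (Suc k) - q k))))"
    by (intro has_bochner_integral_sum transform_quadratic[OF adm _ _ eta C, where B=1]) auto
  also have "(\<lambda>\<omega>. \<Sum>i\<in>UNIV. \<eta> \<omega> * (axis i 1 \<bullet> transform q \<xi> n \<omega>)\<^sup>2) = (\<lambda>\<omega>. \<eta> \<omega> * (norm (transform q \<xi> n \<omega>))\<^sup>2)"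
    unfolding power2_norm_eq_inner
    by (simp add: inner_vec_def[of "transform q \<xi> n _" "transform q \<xi> n _"] inner_axis' power2_eq_square sum_distrib_left)
  also have "(\<Sum>i\<in>UNIV. expectation (\<lambda>\<omega>. \<eta> \<omega> * (\<Sum>k<n. (norm (axis i 1 v* \<xi> k \<omega>))\<^sup>2 * (q (Suc k) - q k))))
     = expectation (\<lambda>\<omega>. \<Sum>i\<in>UNIV. \<eta> \<omega> * (\<Sum>k<n. (norm (axis i 1 v* \<xi> k \<omega>))\<^sup>2 * (q (Suc k) - q k)))"
    using int by (intro Bochner_Integration.integral_sum[symmetric])
  also have "\<dots> = expectation (\<lambda>\<omega>. \<eta> \<omega> * (\<Sum>k<n. (norm (\<xi> k \<omega>))\<^sup>2 * (q (Suc k) - q k)))"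
  proof (intro Bochner_Integration.integral_cong refl)
    fix \<omega>
    show "(\<Sum>i\<in>UNIV. \<eta> \<omega> * (\<Sum>k<n. (norm (axis i 1 v* \<xi> k \<omega>))\<^sup>2 * (q (Suc k) - q k)))
       = \<eta> \<omega> * (\<Sum>k<n. (norm (\<xi> k \<omega>))\<^sup>2 * (q (Suc k) - q k))"
      unfolding norm_matrix_sq_eq_sum_rows[of "\<xi> _ \<omega>"] sum_distrib_right
      by (subst sum.swap) (simp add: sum_distrib_left)
  qed
  finally show ?thesis .
qed

lemma transform_norm_sq_le:
  assumes adm: "admissible q \<xi> n R"
    and V: "\<And>\<omega>. \<omega> \<in> space M \<Longrightarrow> (\<Sum>k<n. (norm (\<xi> k \<omega>))\<^sup>2 * (q (Suc k) - q k)) \<le> V"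
  shows "expectation (\<lambda>\<omega>. (norm (transform q \<xi> n \<omega>))\<^sup>2) \<le> V"
proof -
  have [measurable]: "k < n \<Longrightarrow> \<xi> k \<in> borel_measurable M" for k
    using admissible_stepD[OF adm, of k] by (auto intro!: measurable_F)
  have "expectation (\<lambda>\<omega>. (norm (transform q \<xi> n \<omega>))\<^sup>2) = expectation (\<lambda>\<omega>. \<Sum>k<n. (norm (\<xi> k \<omega>))\<^sup>2 * (q (Suc k) - q k))"
    using transform_norm_sq[OF adm, of "\<lambda>_. 1" 1] by (simp add: has_bochner_integral_iff)
  also have "\<dots> \<le> expectation (\<lambda>_. V)"
  proof (intro integral_mono)
    show "integrable M (\<lambda>\<omega>. \<Sum>k<n. (norm (\<xi> k \<omega>))\<^sup>2 * (q (Suc k) - q k))"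
    proof (rule integrable_const_bound[of _ V, OF AE_I2])
      fix \<omega> assume \<omega>: "\<omega> \<in> space M"
      have "0 \<le> (\<Sum>k<n. (norm (\<xi> k \<omega>))\<^sup>2 * (q (Suc k) - q k))"
        using admissible_stepD(2)[OF adm] by (intro sum_nonneg) auto
      then show "norm (\<Sum>k<n. (norm (\<xi> k \<omega>))\<^sup>2 * (q (Suc k) - q k)) \<le> V"
        using V[OF \<omega>] by simp
    qed measurable
  qed (auto simp: V)
  finally show ?thesis by (simp add: prob_space)
qed

text \<open>A bound of order \<open>(q n - q 0)^2\<close> that does not see the number of steps. The
  constant 9 is what closes the induction: with \<tau> the elapsed time and \<open>d\<close> the new
  step, \<open>9 m^2 (\<tau> + d)^2\<close> has room \<open>18 m^2 d \<tau>\<close> for the mixed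
  term \<open>8 m d \<tau>\<close> and \<open>9 m^2 d^2\<close> for the fourth moment of the new
  increment.\<close>

lemma transform_norm_4_le:
  assumes "admissible q \<xi> n R"
  shows "expectation (\<lambda>\<omega>. norm (transform q \<xi> n \<omega>) ^ 4) \<le> 9 * (real CARD('m))\<^sup>2 * R ^ 4 * (q n - q 0)\<^sup>2"
  using assms
proof (induction n)
  case (Suc n)
  have adm: "admissible q \<xi> n R" using admissible_le[OF Suc.prems, of n] by simp
  note st = admissible_stepD[OF Suc.prems, of n, simplified]
  let ?D = "\<lambda>\<omega>. W (q (Suc n)) \<omega> - W (q n) \<omega>" and ?S = "transform q \<xi> n"
  define d where "d = q (Suc n) - q n"
  define \<tau> where "\<tau> = q n - q 0"
  define m where "m = real CARD('m)"
  have m: "1 \<le> m" by (simp add: m_def Suc_le_eq)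
  have d: "0 \<le> d" and \<tau>: "0 \<le> \<tau>" using st admissible_mono[OF adm, of 0 n] by (auto simp: d_def \<tau>_def)
  have sm: "?S \<in> borel_measurable (F (q n))" using transform_measurable[OF adm] .
  note [measurable] = transform_measurable_M[OF adm]
  obtain \<omega>0 where "\<omega>0 \<in> space M" using not_empty by blast
  then have R0: "0 \<le> R" using order_trans[OF norm_ge_zero st(5)] by blast
  have [measurable]: "\<xi> n \<in> borel_measurable M" using st by (auto intro!: measurable_F)
  have A2: "has_bochner_integral M (\<lambda>\<omega>. ((norm (?S \<omega>))\<^sup>2 *\<^sub>R (?S \<omega> v* \<xi> n \<omega>)) \<bullet> ?D \<omega>) 0"
  proof (rule increment_linear[OF st(1-3)])
    show "(\<lambda>\<omega>. (norm (?S \<omega>))\<^sup>2 *\<^sub>R (?S \<omega> v* \<xi> n \<omega>)) \<in> borel_measurable (F (q n))"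
      using sm st by measurable
    show "integrable M (\<lambda>\<omega>. norm ((norm (?S \<omega>))\<^sup>2 *\<^sub>R (?S \<omega> v* \<xi> n \<omega>)))"
    proof (rule Bochner_Integration.integrable_bound[OF _ _ AE_I2])
      show "integrable M (\<lambda>\<omega>. R * norm (?S \<omega>) ^ 3)"
        using transform_integrable_norm[OF adm, of 3] by simp
      fix \<omega> assume \<omega>: "\<omega> \<in> space M"
      have "norm (?S \<omega> v* \<xi> n \<omega>) \<le> norm (?S \<omega>) * norm (\<xi> n \<omega>)" by (rule norm_vector_matrix_mult_le)
      also have "\<dots> \<le> norm (?S \<omega>) * R" using st(5)[OF \<omega>] by (intro mult_left_mono) auto
      finally show "norm (norm ((norm (?S \<omega>))\<^sup>2 *\<^sub>R (?S \<omega> v* \<xi> n \<omega>))) \<le> norm (R * norm (?S \<omega>) ^ 3)"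
        using R0 mult_left_mono[of "norm (?S \<omega> v* \<xi> n \<omega>)" "norm (?S \<omega>) * R" "(norm (?S \<omega>))\<^sup>2"]
        by (simp add: power2_eq_square power3_eq_cube ac_simps)
    qed measurable
  qed
  have A3: "has_bochner_integral M (\<lambda>\<omega>. (norm (?S \<omega>))\<^sup>2 * (norm (?D \<omega>))\<^sup>2) (m * (d * expectation (\<lambda>\<omega>. (norm (?S \<omega>))\<^sup>2)))"
    unfolding m_def d_def using sm transform_integrable_norm[OF adm, of 2]
    by (intro increment_norm_sq[OF st(1-3)]) auto
  have int4: "integrable M (\<lambda>\<omega>. norm (?D \<omega>) ^ 4)"
    by (rule integrable_increment_norm_4[OF st(1-3)])
  have pw: "norm (transform q \<xi> (Suc n) \<omega>) ^ 4 \<le> norm (?S \<omega>) ^ 4 + 4 * (((norm (?S \<omega>))\<^sup>2 *\<^sub>R (?S \<omega> v* \<xi> n \<omega>)) \<bullet> ?D \<omega>)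
      + 8 * R\<^sup>2 * ((norm (?S \<omega>))\<^sup>2 * (norm (?D \<omega>))\<^sup>2) + 3 * R ^ 4 * norm (?D \<omega>) ^ 4"
    if \<omega>: "\<omega> \<in> space M" for \<omega>
  proof -
    let ?z = "\<xi> n \<omega> *v ?D \<omega>"
    have z: "norm ?z \<le> R * norm (?D \<omega>)"
      using norm_matrix_vector_mult_le[of "\<xi> n \<omega>" "?D \<omega>"] st(5)[OF \<omega>]
      by (meson mult_right_mono norm_ge_zero order_trans)
    have z2: "(norm ?z)\<^sup>2 \<le> R\<^sup>2 * (norm (?D \<omega>))\<^sup>2" and z4: "norm ?z ^ 4 \<le> R ^ 4 * norm (?D \<omega>) ^ 4"
      using power_mono[OF z, of 2] power_mono[OF z, of 4] by (auto simp: power_mult_distrib)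
    have "norm (?S \<omega> + ?z) ^ 4 \<le> norm (?S \<omega>) ^ 4 + 4 * (norm (?S \<omega>))\<^sup>2 * (?S \<omega> \<bullet> ?z) + 8 * (norm (?S \<omega>))\<^sup>2 * (norm ?z)\<^sup>2 + 3 * norm ?z ^ 4"
      by (rule norm_add_power4_le)
    also have "\<dots> \<le> norm (?S \<omega>) ^ 4 + 4 * (norm (?S \<omega>))\<^sup>2 * (?S \<omega> \<bullet> ?z) + 8 * (norm (?S \<omega>))\<^sup>2 * (R\<^sup>2 * (norm (?D \<omega>))\<^sup>2) + 3 * (R ^ 4 * norm (?D \<omega>) ^ 4)"
      using z2 z4 by (intro add_mono mult_left_mono) auto
    finally show ?thesis
      by (simp add: transform_Suc inner_matrix_vector_mult ac_simps)
  qed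
  have "expectation (\<lambda>\<omega>. norm (transform q \<xi> (Suc n) \<omega>) ^ 4) \<le>
    expectation (\<lambda>\<omega>. norm (?S \<omega>) ^ 4 + 4 * (((norm (?S \<omega>))\<^sup>2 *\<^sub>R (?S \<omega> v* \<xi> n \<omega>)) \<bullet> ?D \<omega>)
      + 8 * R\<^sup>2 * ((norm (?S \<omega>))\<^sup>2 * (norm (?D \<omega>))\<^sup>2) + 3 * R ^ 4 * norm (?D \<omega>) ^ 4)"
    using transform_integrable_norm_4[OF adm] A2 A3 int4
    by (intro integral_mono transform_integrable_norm_4[OF Suc.prems] pw)
       (auto simp: has_bochner_integral_iff)
  also have "\<dots> = expectation (\<lambda>\<omega>. norm (?S \<omega>) ^ 4) + 4 * 0 + 8 * R\<^sup>2 * (m * (d * expectation (\<lambda>\<omega>. (norm (?S \<omega>))\<^sup>2)))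
      + 3 * R ^ 4 * expectation (\<lambda>\<omega>. norm (?D \<omega>) ^ 4)"
    using transform_integrable_norm_4[OF adm] A2 A3 int4
    by (simp add: has_bochner_integral_iff)
  also have "\<dots> \<le> 9 * m\<^sup>2 * R ^ 4 * \<tau>\<^sup>2 + 4 * 0 + 8 * R\<^sup>2 * (m * (d * (R\<^sup>2 * \<tau>))) + 3 * R ^ 4 * (3 * m\<^sup>2 * d\<^sup>2)"
  proof -
    have "(\<Sum>k<n. (norm (\<xi> k \<omega>))\<^sup>2 * (q (Suc k) - q k)) \<le> R\<^sup>2 * \<tau>" if "\<omega> \<in> space M" for \<omega>
    proof -
      have "(\<Sum>k<n. (norm (\<xi> k \<omega>))\<^sup>2 * (q (Suc k) - q k)) \<le> (\<Sum>k<n. R\<^sup>2 * (q (Suc k) - q k))"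
        using admissible_stepD(2,5)[OF adm] that by (intro sum_mono mult_right_mono power_mono) auto
      then show ?thesis by (simp add: \<tau>_def sum_distrib_left[symmetric] sum_lessThan_telescope)
    qed
    then have "expectation (\<lambda>\<omega>. (norm (?S \<omega>))\<^sup>2) \<le> R\<^sup>2 * \<tau>"
      by (rule transform_norm_sq_le[OF adm])
    then show ?thesis
      using Suc.IH[OF adm] increment_norm_4_le[OF st(1-3)] m d
      by (intro add_mono mult_left_mono) (auto simp: m_def \<tau>_def d_def)
  qed
  also have "\<dots> = R ^ 4 * (9 * m\<^sup>2 * \<tau>\<^sup>2 + 8 * m * (d * \<tau>) + 9 * m\<^sup>2 * d\<^sup>2)"
    by (simp add: power2_eq_square power4_eq_xxxx algebra_simps)
  also have "\<dots> \<le> R ^ 4 * (9 * m\<^sup>2 * \<tau>\<^sup>2 + 18 * m\<^sup>2 * (d * \<tau>) + 9 * m\<^sup>2 * d\<^sup>2)"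
  proof -
    have "m \<le> m\<^sup>2" using m by (simp add: power2_eq_square)
    then have "8 * m \<le> 18 * m\<^sup>2" using m by simp
    then show ?thesis using d \<tau> by (intro mult_left_mono add_mono mult_right_mono) auto
  qed
  also have "\<dots> = 9 * m\<^sup>2 * R ^ 4 * (\<tau> + d)\<^sup>2"
    by (simp add: power2_sum algebra_simps)
  finally show ?case by (simp add: m_def \<tau>_def d_def)
qed simp

text \<open>
  Lenglart's argument: setting \<open>\<xi> k\<close> to 0 once the quadratic variation up to and including step \<open>k\<close>
  exceeds \<open>\<delta>\<close> keeps it \<open>F (q k)\<close>-measurable and bounds the second moment by \<open>\<delta>\<close>.
\<close>
lemma transform_prob_le:
  assumes adm: "admissible q \<xi> n R" and e: "0 < e" and \<delta>: "0 < \<delta>"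
  shows "prob {\<omega> \<in> space M. norm (transform q \<xi> n \<omega>) > e}
    \<le> prob {\<omega> \<in> space M. (\<Sum>k<n. (norm (\<xi> k \<omega>))\<^sup>2 * (q (Suc k) - q k)) > \<delta>} + \<delta> / e\<^sup>2"
proof -
  define V where "V k \<omega> = (\<Sum>j<k. (norm (\<xi> j \<omega>))\<^sup>2 * (q (Suc j) - q j))" for k \<omega>
  define \<xi>' where "\<xi>' k \<omega> = (if V (Suc k) \<omega> \<le> \<delta> then \<xi> k \<omega> else 0)" for k \<omega>
  have Vm: "V (Suc k) \<in> borel_measurable (F (q k))" if "k < n" for k
    unfolding V_def
    using admissible_measurable[OF adm] that
    by (intro borel_measurable_sum borel_measurable_times borel_measurable_power borel_measurable_norm) auto
  have adm': "admissible q \<xi>' n R"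
    unfolding admissible_def
  proof (intro conjI allI impI ballI)
    fix k assume k: "k < n"
    note st = admissible_stepD[OF adm k]
    show "q k \<le> q (Suc k)" by fact
    note [measurable] = Vm[OF k] st(4)
    show "\<xi>' k \<in> borel_measurable (F (q k))" unfolding \<xi>'_def by measurable
    fix \<omega> assume "\<omega> \<in> space M"
    then show "norm (\<xi>' k \<omega>) \<le> R"
      using st(5)[of \<omega>] order_trans[OF norm_ge_zero st(5)[of \<omega>]] by (auto simp: \<xi>'_def)
  qed (use adm in \<open>auto simp: admissible_def\<close>)
  have Vmono: "V i \<omega> \<le> V j \<omega>" if "i \<le> j" "j \<le> n" for i j \<omega>
    unfolding V_def using that admissible_stepD(2)[OF adm] by (intro sum_mono2) auto
  have V': "(\<Sum>j<k. (norm (\<xi>' j \<omega>))\<^sup>2 * (q (Suc j) - q j)) \<le> \<delta>" if "k \<le> n" for k \<omega>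
    using that
  proof (induction k)
    case (Suc k)
    show ?case
    \<comment> \<open>Once \<open>V\<close> exceeds \<delta>, the new summand is 0 and the bound is
      inherited from the previous step.\<close>
    proof (cases "V (Suc k) \<omega> \<le> \<delta>")
      case True
      have "(\<Sum>j<Suc k. (norm (\<xi>' j \<omega>))\<^sup>2 * (q (Suc j) - q j)) \<le> V (Suc k) \<omega>"
        unfolding V_def
      proof (intro sum_mono mult_right_mono power_mono)
        fix j assume "j \<in> {..<Suc k}"
        then show "0 \<le> q (Suc j) - q j" using admissible_stepD(2)[OF adm, of j] Suc.prems by simp
        show "norm (\<xi>' j \<omega>) \<le> norm (\<xi> j \<omega>)" by (simp add: \<xi>'_def)
      qed simp
      with True show ?thesis by simp
    qed (use Suc in \<open>simp add: \<xi>'_def\<close>)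
  qed (use \<delta> in simp)
  note [measurable] = transform_measurable_M[OF adm] transform_measurable_M[OF adm']
  have [measurable]: "k < n \<Longrightarrow> \<xi> k \<in> borel_measurable M" for k
    using admissible_stepD[OF adm, of k] by (auto intro!: measurable_F)
  have [measurable]: "V n \<in> borel_measurable M" unfolding V_def by measurable
  \<comment> \<open>Where \<open>V n\<close> is at most \<delta>, monotonicity of \<open>V\<close>
    shows that no step was cut off, and the Markov inequality applies to the truncated
    transform.\<close>
  have "prob {\<omega> \<in> space M. norm (transform q \<xi> n \<omega>) > e}
    \<le> prob ({\<omega> \<in> space M. V n \<omega> > \<delta>} \<union> {\<omega> \<in> space M. (norm (transform q \<xi>' n \<omega>))\<^sup>2 \<ge> e\<^sup>2})"
  proof (intro finite_measure_mono subsetI)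
    fix \<omega> assume \<omega>: "\<omega> \<in> {\<omega> \<in> space M. norm (transform q \<xi> n \<omega>) > e}"
    show "\<omega> \<in> {\<omega> \<in> space M. V n \<omega> > \<delta>} \<union> {\<omega> \<in> space M. (norm (transform q \<xi>' n \<omega>))\<^sup>2 \<ge> e\<^sup>2}"
    proof (cases "V n \<omega> > \<delta>")
      case False
      then have "\<xi>' k \<omega> = \<xi> k \<omega>" if "k < n" for k
        using that Vmono[of "Suc k" n \<omega>] by (auto simp: \<xi>'_def)
      then have "transform q \<xi>' n \<omega> = transform q \<xi> n \<omega>"
        by (simp add: transform_def)
      then show ?thesis using \<omega> e by (auto intro!: power_mono)
    qed (use \<omega> in auto)
  qed measurable
  also have "\<dots> \<le> prob {\<omega> \<in> space M. V n \<omega> > \<delta>} + prob {\<omega> \<in> space M. (norm (transform q \<xi>' n \<omega>))\<^sup>2 \<ge> e\<^sup>2}"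
    by (intro measure_Un_le) measurable
  also have "prob {\<omega> \<in> space M. (norm (transform q \<xi>' n \<omega>))\<^sup>2 \<ge> e\<^sup>2} \<le> expectation (\<lambda>\<omega>. (norm (transform q \<xi>' n \<omega>))\<^sup>2) / e\<^sup>2"
    using integral_Markov_inequality_measure[where A="{}" and M=M and u="\<lambda>\<omega>. (norm (transform q \<xi>' n \<omega>))\<^sup>2" and c="e\<^sup>2"]
      transform_integrable_norm[OF adm', of 2] e by auto
  also have "\<dots> \<le> \<delta> / e\<^sup>2"
    using transform_norm_sq_le[OF adm' V'] by (intro divide_right_mono) auto
  finally show ?thesis by (simp add: V_def)
qed

end

section \<open>The bump function and uniform ellipticity\<close>

text \<open>The cube of the positive part has Lipschitz second derivatives, so a second order
  expansion with cubic remainder holds across the boundary of the ball as well; a square would not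
  do.\<close>

definition bump :: "real \<Rightarrow> 'b::real_inner \<Rightarrow> real" where
  "bump \<epsilon> y = (max 0 (\<epsilon>\<^sup>2 - (norm y)\<^sup>2)) ^ 3"

lemma bump_nonneg: "0 \<le> bump \<epsilon> y"
  by (simp add: bump_def)

lemma bump_le: "bump \<epsilon> y \<le> \<epsilon> ^ 6"
proof -
  have "bump \<epsilon> y \<le> (\<epsilon>\<^sup>2) ^ 3" unfolding bump_def by (intro power_mono) auto
  then show ?thesis by simp
qed

lemma bump_eq: "norm y \<le> \<epsilon> \<Longrightarrow> bump \<epsilon> y = (\<epsilon>\<^sup>2 - (norm y)\<^sup>2) ^ 3"
  using power_mono[of "norm y" \<epsilon> 2] by (simp add: bump_def)

lemma bump_eq_0: "0 \<le> \<epsilon> \<Longrightarrow> \<epsilon> \<le> norm y \<Longrightarrow> bump \<epsilon> y = 0"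
  using power_mono[of \<epsilon> "norm y" 2] by (simp add: bump_def max_def)

lemma bump_measurable [measurable]: "bump \<epsilon> \<in> borel_measurable (borel :: 'b::euclidean_space measure)"
  unfolding bump_def[abs_def] by measurable

text \<open>On the ball the square of the norm has Lipschitz constant \<open>2 \<epsilon>\<close>,
  and the cube on \<open>[0, \<epsilon>^2]\<close> has \<open>3 \<epsilon>^4\<close>. Points outside
  the ball are handled by clamping the norm at \<epsilon>, as \<open>pm\<close> does.\<close>

lemma bump_lipschitz:
  assumes \<epsilon>: "0 \<le> \<epsilon>"
  shows "\<bar>bump \<epsilon> a - bump \<epsilon> b\<bar> \<le> 6 * \<epsilon> ^ 5 * norm (a - b)"
proof -
  define p where "p y = max 0 (\<epsilon>\<^sup>2 - (norm y)\<^sup>2)" for y :: 'a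
  have p: "0 \<le> p y" "p y \<le> \<epsilon>\<^sup>2" for y by (auto simp: p_def)
  have pm: "p y = \<epsilon>\<^sup>2 - (min (norm y) \<epsilon>)\<^sup>2" for y
    using \<epsilon> power_mono[of "norm y" \<epsilon> 2] power_mono[of \<epsilon> "norm y" 2] by (auto simp: p_def min_def max_def)
  have "\<bar>p a - p b\<bar> = \<bar>min (norm b) \<epsilon> + min (norm a) \<epsilon>\<bar> * \<bar>min (norm b) \<epsilon> - min (norm a) \<epsilon>\<bar>"
    unfolding pm abs_mult[symmetric] by (simp add: power2_eq_square algebra_simps)
  also have "\<dots> \<le> (2 * \<epsilon>) * norm (a - b)"
  proof (intro mult_mono)
    show "\<bar>min (norm b) \<epsilon> + min (norm a) \<epsilon>\<bar> \<le> 2 * \<epsilon>"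
      using \<epsilon> norm_ge_zero[of a] norm_ge_zero[of b] by (auto simp: min_def)
    have "\<bar>min (norm b) \<epsilon> - min (norm a) \<epsilon>\<bar> \<le> \<bar>norm b - norm a\<bar>" by (auto simp: min_def)
    also have "\<dots> \<le> norm (a - b)" using norm_triangle_ineq3[of a b] by (simp add: abs_minus_commute)
    finally show "\<bar>min (norm b) \<epsilon> - min (norm a) \<epsilon>\<bar> \<le> norm (a - b)" .
  qed (use \<epsilon> in auto)
  finally have 1: "\<bar>p a - p b\<bar> \<le> 2 * \<epsilon> * norm (a - b)" .
  have "p a ^ 3 - p b ^ 3 = (p a - p b) * (p a * p a + p a * p b + p b * p b)"
    by (simp add: power3_eq_cube algebra_simps)
  then have "\<bar>bump \<epsilon> a - bump \<epsilon> b\<bar> = \<bar>p a - p b\<bar> * (p a * p a + p a * p b + p b * p b)"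
    using p by (simp add: bump_def p_def[symmetric] abs_mult)
  also have "\<dots> \<le> (2 * \<epsilon> * norm (a - b)) * (\<epsilon>\<^sup>2 * \<epsilon>\<^sup>2 + \<epsilon>\<^sup>2 * \<epsilon>\<^sup>2 + \<epsilon>\<^sup>2 * \<epsilon>\<^sup>2)"
    using p \<epsilon> 1 by (intro mult_mono add_mono) auto
  also have "\<dots> = 6 * \<epsilon> ^ 5 * norm (a - b)"
    by (simp add: power_numeral_reduce)
  finally show ?thesis .
qed

text \<open>If \<open>u + \<delta>\<close> is negative, then so is \<delta>, and the left side is
  exactly the cube of \<open>u + \<delta>\<close>, hence at most 0.\<close>

lemma max_cube_lower:
  fixes u \<delta> :: real
  assumes u: "0 \<le> u"
  shows "u ^ 3 + 3 * u\<^sup>2 * \<delta> + 3 * u * \<delta>\<^sup>2 - \<bar>\<delta>\<bar> ^ 3 \<le> (max 0 (u + \<delta>)) ^ 3"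
proof -
  have e: "(u + \<delta>) ^ 3 = u ^ 3 + 3 * u\<^sup>2 * \<delta> + 3 * u * \<delta>\<^sup>2 + \<delta> ^ 3"
    by (simp add: power2_eq_square power3_eq_cube algebra_simps)
  show ?thesis
  proof (cases "0 \<le> u + \<delta>")
    case True
    have "- (\<bar>\<delta>\<bar> ^ 3) \<le> \<delta> ^ 3"
      by (metis abs_ge_minus_self neg_le_iff_le minus_minus power_abs)
    then show ?thesis using e True by simp
  next
    case False
    then have "\<bar>\<delta>\<bar> = - \<delta>" using u by simp
    then have "\<bar>\<delta>\<bar> ^ 3 = - (\<delta> ^ 3)" by simp
    moreover have "(u + \<delta>) ^ 3 \<le> 0"
      using False by (simp add: power_le_zero_eq)
    ultimately show ?thesis using e False by simp
  qed
qed

text \<open>The left side is at most 0 here: each of its first three terms is dominated by one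
  binomial term of \<open>(1 + U)^3 \<delta>^2\<close>. The point is a remainder quadratic in
  \<delta> where \<delta> itself may be quadratic in the increment.\<close>

lemma max_cube_lower_large:
  fixes u \<delta> :: real
  assumes u: "0 \<le> u" "u \<le> U" and \<delta>: "1 \<le> \<bar>\<delta>\<bar>"
  shows "u ^ 3 + 3 * u\<^sup>2 * \<delta> + 3 * u * \<delta>\<^sup>2 - (1 + U) ^ 3 * \<delta>\<^sup>2 \<le> (max 0 (u + \<delta>)) ^ 3"
proof -
  have "\<bar>\<delta>\<bar> \<le> \<bar>\<delta>\<bar> * \<bar>\<delta>\<bar>" using mult_left_mono[OF \<delta>, of "\<bar>\<delta>\<bar>"] by simp
  then have d: "1 \<le> \<delta>\<^sup>2" "\<bar>\<delta>\<bar> \<le> \<delta>\<^sup>2" using \<delta> by (auto simp: power2_eq_square abs_mult[symmetric])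
  have "u ^ 3 \<le> U ^ 3 * \<delta>\<^sup>2"
    using order_trans[OF power_mono[OF u(2,1), of 3]] mult_left_mono[OF d(1), of "U ^ 3"] u by simp
  moreover have "3 * u\<^sup>2 * \<delta> \<le> 3 * U\<^sup>2 * \<delta>\<^sup>2"
  proof -
    have "3 * u\<^sup>2 * \<delta> \<le> 3 * u\<^sup>2 * \<delta>\<^sup>2" using d by (intro mult_left_mono) auto
    also have "\<dots> \<le> 3 * U\<^sup>2 * \<delta>\<^sup>2" using u by (intro mult_right_mono mult_left_mono power_mono) auto
    finally show ?thesis .
  qed
  moreover have "3 * u * \<delta>\<^sup>2 \<le> 3 * U * \<delta>\<^sup>2" using u by (intro mult_right_mono) auto
  moreover have "(1 + U) ^ 3 * \<delta>\<^sup>2 = \<delta>\<^sup>2 + U ^ 3 * \<delta>\<^sup>2 + 3 * U\<^sup>2 * \<delta>\<^sup>2 + 3 * U * \<delta>\<^sup>2"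
    by (simp add: power2_eq_square power3_eq_cube algebra_simps)
  moreover have "0 \<le> (max 0 (u + \<delta>)) ^ 3" by simp
  ultimately show ?thesis using d by linarith
qed

text \<open>
  Here \<open>\<beta>\<close> is a drift increment of order \<open>h\<close> and \<open>\<zeta>\<close> a martingale increment of order \<open>sqrt h\<close>. With
  \<open>|\<zeta>| = sqrt h * x\<close> every remainder term is at most \<open>h\<^sup>3\<^sup>/\<^sup>2\<close> times a polynomial in \<open>x\<close> of degree at most 4;
  for large increments this uses \<open>bump \<ge> 0\<close> instead of the expansion, so that no sixth moment is needed.
\<close>
lemma bump_taylor:
  fixes \<epsilon> K :: real
  assumes \<epsilon>: "0 < \<epsilon>" and K: "0 \<le> K"
  obtains C where "0 \<le> C"
    and "\<And>(y::'b::real_inner) \<beta> \<zeta> h. norm y \<le> \<epsilon> \<Longrightarrow> 0 < h \<Longrightarrow> h \<le> 1 \<Longrightarrow> norm \<beta> \<le> K * h \<Longrightarrow>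
      (\<epsilon>\<^sup>2 - (norm y)\<^sup>2) ^ 3 - 6 * \<epsilon> * K * h * (\<epsilon>\<^sup>2 - (norm y)\<^sup>2)\<^sup>2 - 6 * (\<epsilon>\<^sup>2 - (norm y)\<^sup>2)\<^sup>2 * (y \<bullet> \<zeta>)
      - 3 * (\<epsilon>\<^sup>2 - (norm y)\<^sup>2)\<^sup>2 * (norm \<zeta>)\<^sup>2 + 12 * (\<epsilon>\<^sup>2 - (norm y)\<^sup>2) * (y \<bullet> \<zeta>)\<^sup>2
      - C * (h * sqrt h + norm \<zeta> ^ 4 / sqrt h) \<le> bump \<epsilon> (y + \<beta> + \<zeta>)"
proof -
  define U where "U = \<epsilon>\<^sup>2"
  have U: "0 \<le> U" by (simp add: U_def)
  \<comment> \<open>\<open>E\<close> is the factor of the remainder of the cube. The three summands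
    in \<open>C\<close> are the errors from \<open>t1\<close>, \<open>t2\<close> and
    \<open>t3\<close>, and \<open>9 + 8 K^4\<close> turns \<open>1 + (K + x)^4\<close> into a
    multiple of \<open>1 + x^4\<close>.\<close>
  define E where "E = (1 + U) ^ 3 * (2 * \<epsilon> + 1) ^ 3"
  define C where "C = (9 + 8 * K ^ 4) * (3 * U\<^sup>2 + 12 * U * \<epsilon> * (1 + 2 * \<epsilon>) + 2 * E)"
  have E: "0 \<le> E" using U \<epsilon> by (simp add: E_def)
  have C: "0 \<le> C" using E U \<epsilon> K unfolding C_def
    by (intro mult_nonneg_nonneg add_nonneg_nonneg) auto
  show ?thesis
  proof (rule that[OF C])
    fix y \<beta> \<zeta> :: 'b and h :: real
    assume y: "norm y \<le> \<epsilon>" and h: "0 < h" "h \<le> 1" and \<beta>: "norm \<beta> \<le> K * h"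
    define u where "u = \<epsilon>\<^sup>2 - (norm y)\<^sup>2"
    define z where "z = \<beta> + \<zeta>"
    define r where "r = sqrt h"
    have r: "0 < r" "r \<le> 1" "r\<^sup>2 = h" using h by (auto simp: r_def)
    define x where "x = norm \<zeta> / r"
    have x: "0 \<le> x" "norm \<zeta> = r * x" using r by (auto simp: x_def)
    \<comment> \<open>As \<open>r \<le> 1\<close>, the drift increment is at most
      \<open>K r\<close>, so \<open>r * s\<close> bounds the whole increment
      \<open>z\<close>.\<close>
    define s where "s = K + x"
    have s: "0 \<le> s" "K \<le> s" "x \<le> s" using K x by (auto simp: s_def)
    have u: "0 \<le> u" "u \<le> U" using power_mono[OF y, of 2] by (auto simp: u_def U_def)
    have r32: "r ^ 3 \<le> r\<^sup>2" "r ^ 4 \<le> r ^ 3" using r power_decreasing[of 2 3 r] power_decreasing[of 3 4 r] by auto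
    have \<beta>': "norm \<beta> \<le> K * r\<^sup>2" using \<beta> r by simp
    have nz: "norm z \<le> r * s"
    proof -
      have "norm z \<le> K * r\<^sup>2 + r * x" unfolding z_def using norm_triangle_ineq[of \<beta> \<zeta>] \<beta>' x by linarith
      also have "K * r\<^sup>2 \<le> K * r" using r K by (intro mult_left_mono) (auto simp: power2_eq_square mult_left_le)
      finally show ?thesis by (simp add: s_def algebra_simps)
    qed
    \<comment> \<open>\<open>\<rho>\<close> is the part of \<delta> caused by the drift. Only
      \<open>- 2 (y \<bullet> \<beta>)\<close> is of order \<open>h\<close>; the rest is of order
      \<open>r^3\<close>.\<close>
    define \<rho> where "\<rho> = - 2 * (y \<bullet> \<beta>) - 2 * (\<beta> \<bullet> \<zeta>) - (norm \<beta>)\<^sup>2"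
    define \<delta> where "\<delta> = - 2 * (y \<bullet> \<zeta>) - (norm \<zeta>)\<^sup>2 + \<rho>"
    have \<delta>z: "\<delta> = - 2 * (y \<bullet> z) - (norm z)\<^sup>2"
      unfolding \<delta>_def \<rho>_def z_def power2_norm_eq_inner by (simp add: inner_add_left inner_add_right inner_commute)
    have bump: "bump \<epsilon> (y + \<beta> + \<zeta>) = (max 0 (u + \<delta>)) ^ 3"
    proof -
      have "\<epsilon>\<^sup>2 - (norm (y + z))\<^sup>2 = u + \<delta>"
        unfolding u_def \<delta>z power2_norm_eq_inner by (simp add: inner_add_left inner_add_right inner_commute)
      then show ?thesis by (simp add: bump_def z_def add.assoc)
    qed
    have \<delta>_le: "\<bar>\<delta>\<bar> \<le> 2 * \<epsilon> * norm z + (norm z)\<^sup>2"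
    proof -
      have "\<bar>y \<bullet> z\<bar> \<le> norm y * norm z" by (rule Cauchy_Schwarz_ineq2)
      also have "\<dots> \<le> \<epsilon> * norm z" using y by (intro mult_right_mono) auto
      finally have "\<bar>y \<bullet> z\<bar> \<le> \<epsilon> * norm z" .
      moreover have "\<bar>\<delta>\<bar> \<le> 2 * \<bar>y \<bullet> z\<bar> + (norm z)\<^sup>2"
        using zero_le_power2[of "norm z"] unfolding \<delta>z by linarith
      ultimately show ?thesis by linarith
    qed
    have P1: "1 \<le> (1 + U) ^ 3" "1 \<le> 2 * \<epsilon> + 1" using U \<epsilon> by auto
    \<comment> \<open>Three regimes. For \<open>|z| \<le> 1\<close>, \<delta> is of order
      \<open>|z|\<close> and the cubic remainder of order \<open>|z|^3\<close>. For
      \<open>|z| > 1\<close>, \<delta> is only of order \<open>|z|^2\<close>, and a remainder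
      quadratic in \<delta> gives \<open>|z|^4\<close>: it comes from
      \<open>max_cube_lower_large\<close> if \<open>|\<delta>| \<ge> 1\<close>, and from
      \<open>|\<delta>|^3 \<le> \<delta>^2\<close> otherwise.\<close>
    have main: "u ^ 3 + 3 * u\<^sup>2 * \<delta> + 3 * u * \<delta>\<^sup>2 - E * (norm z ^ 3 + norm z ^ 4) \<le> (max 0 (u + \<delta>)) ^ 3"
    proof -
      have *: "(1 + U) ^ 3 * t \<le> E * (norm z ^ 3 + norm z ^ 4)"
        if t: "t \<le> ((2 * \<epsilon> + 1) * norm z) ^ 3 \<or> t \<le> ((2 * \<epsilon> + 1) * (norm z)\<^sup>2)\<^sup>2" for t
      proof -
        have "t \<le> (2 * \<epsilon> + 1) ^ 3 * (norm z ^ 3 + norm z ^ 4)"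
          using t
        proof
          assume "t \<le> ((2 * \<epsilon> + 1) * norm z) ^ 3"
          also have "\<dots> \<le> (2 * \<epsilon> + 1) ^ 3 * (norm z ^ 3 + norm z ^ 4)"
            unfolding power_mult_distrib using \<epsilon> by (intro mult_left_mono) auto
          finally show ?thesis .
        next
          assume "t \<le> ((2 * \<epsilon> + 1) * (norm z)\<^sup>2)\<^sup>2"
          also have "\<dots> = (2 * \<epsilon> + 1)\<^sup>2 * norm z ^ 4" by (simp add: power_mult_distrib)
          also have "\<dots> \<le> (2 * \<epsilon> + 1) ^ 3 * (norm z ^ 3 + norm z ^ 4)"
            using \<epsilon> by (intro mult_mono power_increasing) auto
          finally show ?thesis .
        qed
        then show ?thesis unfolding E_def mult.assoc using U by (intro mult_left_mono) auto
      qed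
      show ?thesis
      proof (cases "norm z \<le> 1")
        case True
        then have "(norm z)\<^sup>2 \<le> norm z" by (simp add: power2_eq_square mult_left_le)
        then have "\<bar>\<delta>\<bar> \<le> (2 * \<epsilon> + 1) * norm z" using \<delta>_le by (simp add: algebra_simps)
        then have "\<bar>\<delta>\<bar> ^ 3 \<le> ((2 * \<epsilon> + 1) * norm z) ^ 3" by (intro power_mono) auto
        then have "(1 + U) ^ 3 * \<bar>\<delta>\<bar> ^ 3 \<le> E * (norm z ^ 3 + norm z ^ 4)" using * by blast
        moreover have "\<bar>\<delta>\<bar> ^ 3 \<le> (1 + U) ^ 3 * \<bar>\<delta>\<bar> ^ 3"
          using mult_right_mono[OF P1(1), of "\<bar>\<delta>\<bar> ^ 3"] by simp
        ultimately show ?thesis using max_cube_lower[OF u(1), of \<delta>] by linarith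
      next
        case False
        then have "norm z \<le> (norm z)\<^sup>2" using mult_left_mono[of 1 "norm z" "norm z"] by (simp add: power2_eq_square)
        then have "2 * \<epsilon> * norm z \<le> 2 * \<epsilon> * (norm z)\<^sup>2" using \<epsilon> by (intro mult_left_mono) auto
        then have "\<bar>\<delta>\<bar> \<le> (2 * \<epsilon> + 1) * (norm z)\<^sup>2" using \<delta>_le by (simp add: algebra_simps)
        then have "\<bar>\<delta>\<bar>\<^sup>2 \<le> ((2 * \<epsilon> + 1) * (norm z)\<^sup>2)\<^sup>2" by (intro power_mono) auto
        then have d2: "(1 + U) ^ 3 * \<delta>\<^sup>2 \<le> E * (norm z ^ 3 + norm z ^ 4)" using * by simp
        show ?thesis
        proof (cases "1 \<le> \<bar>\<delta>\<bar>")
          case True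
          then show ?thesis using max_cube_lower_large[OF u True] d2 by linarith
        next
          case False
          then have "\<bar>\<delta>\<bar> ^ 3 \<le> \<bar>\<delta>\<bar>\<^sup>2" by (intro power_decreasing) auto
          moreover have "\<delta>\<^sup>2 \<le> (1 + U) ^ 3 * \<delta>\<^sup>2"
            using mult_right_mono[OF P1(1), of "\<delta>\<^sup>2"] by simp
          ultimately show ?thesis using max_cube_lower[OF u(1), of \<delta>] d2 by simp
        qed
      qed
    qed
    have spow: "s ^ j \<le> 1 + s ^ 4" if "j \<le> 4" for j
      using power_le_1_add_power4[OF s(1) that] .
    have err3: "norm z ^ 3 + norm z ^ 4 \<le> 2 * (r ^ 3 * (1 + s ^ 4))"
    proof -
      have "norm z ^ 3 \<le> (r * s) ^ 3" using nz by (intro power_mono) auto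
      also have "\<dots> \<le> r ^ 3 * (1 + s ^ 4)" unfolding power_mult_distrib using r spow[of 3] by (intro mult_left_mono) auto
      finally have a: "norm z ^ 3 \<le> r ^ 3 * (1 + s ^ 4)" .
      have "norm z ^ 4 \<le> (r * s) ^ 4" using nz by (intro power_mono) auto
      also have "\<dots> \<le> r ^ 3 * (1 + s ^ 4)" unfolding power_mult_distrib using r32 r by (intro mult_mono) auto
      finally show ?thesis using a by simp
    qed
    have b\<zeta>: "\<bar>\<beta> \<bullet> \<zeta>\<bar> \<le> K * r\<^sup>2 * (r * x)"
      using order_trans[OF Cauchy_Schwarz_ineq2[of \<beta> \<zeta>] mult_right_mono[OF \<beta>' norm_ge_zero]] unfolding x(2) .
    have yb: "\<bar>y \<bullet> \<beta>\<bar> \<le> \<epsilon> * (K * r\<^sup>2)"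
      by (rule order_trans[OF Cauchy_Schwarz_ineq2[of y \<beta>] mult_mono[OF y \<beta>' less_imp_le[OF \<epsilon>] norm_ge_zero]])
    have bb: "(norm \<beta>)\<^sup>2 \<le> K\<^sup>2 * r ^ 4"
      using power_mono[OF \<beta>', of 2] by (simp add: power_mult_distrib)
    have y\<zeta>: "\<bar>y \<bullet> \<zeta>\<bar> \<le> \<epsilon> * (r * x)"
      using order_trans[OF Cauchy_Schwarz_ineq2[of y \<zeta>] mult_right_mono[OF y norm_ge_zero]] unfolding x(2) .
    have rho: "\<rho> \<ge> - 2 * \<epsilon> * K * h - r ^ 3 * (1 + s ^ 4)"
    proof -
      have "2 * (K * r\<^sup>2 * (r * x)) + K\<^sup>2 * r ^ 4 \<le> 2 * (K * r\<^sup>2 * (r * x)) + K\<^sup>2 * r ^ 3"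
        using r32 by (intro add_left_mono mult_left_mono) auto
      also have "\<dots> \<le> r ^ 3 * s\<^sup>2"
        using r(1) x(1) by (simp add: s_def power2_eq_square power3_eq_cube algebra_simps)
      also have "\<dots> \<le> r ^ 3 * (1 + s ^ 4)" using r spow[of 2] by (intro mult_left_mono) auto
      finally have "2 * (K * r\<^sup>2 * (r * x)) + K\<^sup>2 * r ^ 4 \<le> r ^ 3 * (1 + s ^ 4)" .
      moreover have "- 2 * (y \<bullet> \<beta>) \<ge> - 2 * \<epsilon> * K * h" using yb r by (simp add: abs_le_iff mult.assoc)
      moreover have "- 2 * (\<beta> \<bullet> \<zeta>) \<ge> - (2 * (K * r\<^sup>2 * (r * x)))" using b\<zeta> by (simp add: abs_le_iff)
      ultimately show ?thesis unfolding \<rho>_def using bb by linarith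
    qed
    define w where "w = \<rho> - (norm \<zeta>)\<^sup>2"
    have w: "\<bar>w\<bar> \<le> r\<^sup>2 * (s\<^sup>2 + 2 * \<epsilon> * K)"
    proof -
      have "\<bar>w\<bar> \<le> 2 * \<bar>y \<bullet> \<beta>\<bar> + 2 * \<bar>\<beta> \<bullet> \<zeta>\<bar> + (norm \<beta>)\<^sup>2 + (norm \<zeta>)\<^sup>2"
        using zero_le_power2[of "norm \<zeta>"] zero_le_power2[of "norm \<beta>"] unfolding w_def \<rho>_def by linarith
      also have "\<dots> \<le> 2 * (\<epsilon> * (K * r\<^sup>2)) + 2 * (K * r\<^sup>2 * (r * x)) + K\<^sup>2 * r ^ 4 + (r * x)\<^sup>2"
        using yb b\<zeta> bb x by (intro add_mono) auto
      also have "\<dots> \<le> 2 * (\<epsilon> * (K * r\<^sup>2)) + 2 * (K * r\<^sup>2 * x) + K\<^sup>2 * r\<^sup>2 + r\<^sup>2 * x\<^sup>2"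
        using r r32 x K \<epsilon> by (intro add_mono mult_left_mono) (auto simp: power_mult_distrib mult_left_le_one_le)
      also have "\<dots> = r\<^sup>2 * (s\<^sup>2 + 2 * \<epsilon> * K)"
        by (simp add: s_def power2_eq_square algebra_simps)
      finally show ?thesis .
    qed
    have sq: "\<delta>\<^sup>2 \<ge> 4 * (y \<bullet> \<zeta>)\<^sup>2 - 4 * \<epsilon> * (1 + 2 * \<epsilon>) * (r ^ 3 * (1 + s ^ 4))"
    proof -
      have "\<bar>y \<bullet> \<zeta>\<bar> * \<bar>w\<bar> \<le> (\<epsilon> * (r * s)) * (r\<^sup>2 * (s\<^sup>2 + 2 * \<epsilon> * s))"
      proof (intro mult_mono)
        show "\<bar>y \<bullet> \<zeta>\<bar> \<le> \<epsilon> * (r * s)"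
          using \<epsilon> r s by (intro order_trans[OF y\<zeta>] mult_left_mono) auto
        have "r\<^sup>2 * (s\<^sup>2 + 2 * \<epsilon> * K) \<le> r\<^sup>2 * (s\<^sup>2 + 2 * \<epsilon> * s)" using s \<epsilon> by (intro mult_left_mono) auto
        then show "\<bar>w\<bar> \<le> r\<^sup>2 * (s\<^sup>2 + 2 * \<epsilon> * s)" using w by linarith
      qed (use \<epsilon> r s in auto)
      also have "\<dots> = \<epsilon> * (r ^ 3 * (s ^ 3 + 2 * \<epsilon> * s\<^sup>2))"
        by (simp add: power2_eq_square power3_eq_cube algebra_simps)
      also have "\<dots> \<le> \<epsilon> * (r ^ 3 * ((1 + s ^ 4) + 2 * \<epsilon> * (1 + s ^ 4)))"
        using \<epsilon> r spow[of 3] spow[of 2] by (intro mult_left_mono add_mono) auto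
      also have "\<dots> = \<epsilon> * (1 + 2 * \<epsilon>) * (r ^ 3 * (1 + s ^ 4))"
        by (simp add: algebra_simps)
      finally have "\<bar>y \<bullet> \<zeta>\<bar> * \<bar>w\<bar> \<le> \<epsilon> * (1 + 2 * \<epsilon>) * (r ^ 3 * (1 + s ^ 4))" .
      moreover have "(y \<bullet> \<zeta>) * w \<le> \<bar>y \<bullet> \<zeta>\<bar> * \<bar>w\<bar>" by (simp add: abs_mult[symmetric])
      moreover have "\<delta>\<^sup>2 = 4 * (y \<bullet> \<zeta>)\<^sup>2 - 4 * ((y \<bullet> \<zeta>) * w) + w\<^sup>2"
      proof -
        have d: "\<delta> = - 2 * (y \<bullet> \<zeta>) + w" by (simp add: \<delta>_def w_def)
        show ?thesis unfolding d by (simp add: power2_eq_square algebra_simps)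
      qed
      moreover have "0 \<le> w\<^sup>2" by simp
      moreover have "4 * \<epsilon> * (1 + 2 * \<epsilon>) * (r ^ 3 * (1 + s ^ 4)) = 4 * (\<epsilon> * (1 + 2 * \<epsilon>) * (r ^ 3 * (1 + s ^ 4)))" by simp
      ultimately show ?thesis by linarith
    qed
    define Q where "Q = r ^ 3 * (1 + s ^ 4)"
    have Q: "0 \<le> Q" using r s by (simp add: Q_def)
    have t1: "3 * u\<^sup>2 * \<delta> \<ge> - 6 * u\<^sup>2 * (y \<bullet> \<zeta>) - 3 * u\<^sup>2 * (norm \<zeta>)\<^sup>2 - 6 * \<epsilon> * K * h * u\<^sup>2 - 3 * U\<^sup>2 * Q"
    proof -
      have "3 * u\<^sup>2 * \<rho> \<ge> 3 * u\<^sup>2 * (- 2 * \<epsilon> * K * h - Q)"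
        using rho by (intro mult_left_mono) (auto simp: Q_def)
      moreover have "3 * u\<^sup>2 * Q \<le> 3 * U\<^sup>2 * Q" using u Q by (intro mult_right_mono mult_left_mono power_mono) auto
      ultimately show ?thesis unfolding \<delta>_def by (simp add: algebra_simps)
    qed
    have t2: "3 * u * \<delta>\<^sup>2 \<ge> 12 * u * (y \<bullet> \<zeta>)\<^sup>2 - 12 * U * \<epsilon> * (1 + 2 * \<epsilon>) * Q"
    proof -
      have "3 * u * \<delta>\<^sup>2 \<ge> 3 * u * (4 * (y \<bullet> \<zeta>)\<^sup>2 - 4 * \<epsilon> * (1 + 2 * \<epsilon>) * Q)"
        using sq u by (intro mult_left_mono) (auto simp: Q_def)
      moreover have "u * (12 * \<epsilon> * (1 + 2 * \<epsilon>) * Q) \<le> U * (12 * \<epsilon> * (1 + 2 * \<epsilon>) * Q)"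
        using u Q \<epsilon> by (intro mult_right_mono) auto
      ultimately show ?thesis by (simp add: algebra_simps)
    qed
    have t3: "E * (norm z ^ 3 + norm z ^ 4) \<le> 2 * E * Q"
      using mult_left_mono[OF err3 E] by (simp add: Q_def algebra_simps)
    have QC: "(3 * U\<^sup>2 + 12 * U * \<epsilon> * (1 + 2 * \<epsilon>) + 2 * E) * Q \<le> C * (h * sqrt h + norm \<zeta> ^ 4 / sqrt h)"
    proof -
      have "s ^ 4 \<le> 8 * (K ^ 4 + x ^ 4)"
      proof -
        have "s ^ 4 = ((K + x)\<^sup>2)\<^sup>2" by (simp add: s_def)
        also have "\<dots> \<le> (2 * K\<^sup>2 + 2 * x\<^sup>2)\<^sup>2"
          using sum_squares_bound[of K x] K x(1) by (intro power_mono) (auto simp: power2_sum)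
        also have "\<dots> \<le> 8 * (K ^ 4 + x ^ 4)"
          using sum_squares_bound[of "K\<^sup>2" "x\<^sup>2"] by (auto simp: power2_sum power_mult_distrib)
        finally show ?thesis .
      qed
      then have "1 + s ^ 4 \<le> 1 + 8 * K ^ 4 + 8 * x ^ 4" by simp
      also have "\<dots> \<le> (9 + 8 * K ^ 4) * (1 + x ^ 4)"
        using K x by (simp add: algebra_simps)
      finally have "Q \<le> r ^ 3 * ((9 + 8 * K ^ 4) * (1 + x ^ 4))"
        unfolding Q_def using r by (intro mult_left_mono) auto
      also have "\<dots> = (9 + 8 * K ^ 4) * (r ^ 3 + r ^ 3 * x ^ 4)" by (simp add: algebra_simps)
      also have "r ^ 3 = h * sqrt h" using r by (simp add: r_def[symmetric] power3_eq_cube power2_eq_square)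
      also have "h * sqrt h * x ^ 4 = norm \<zeta> ^ 4 / sqrt h"
      proof -
        have "norm \<zeta> ^ 4 / sqrt h = (r * x) ^ 4 / r" by (simp add: x r_def)
        also have "\<dots> = r ^ 3 * x ^ 4" using r by (simp add: power_numeral_reduce)
        also have "r ^ 3 = h * sqrt h" using r by (simp add: r_def[symmetric] power3_eq_cube power2_eq_square)
        finally show ?thesis by simp
      qed
      finally have "Q \<le> (9 + 8 * K ^ 4) * (h * sqrt h + norm \<zeta> ^ 4 / sqrt h)" .
      then have "(3 * U\<^sup>2 + 12 * U * \<epsilon> * (1 + 2 * \<epsilon>) + 2 * E) * Q
        \<le> (3 * U\<^sup>2 + 12 * U * \<epsilon> * (1 + 2 * \<epsilon>) + 2 * E) * ((9 + 8 * K ^ 4) * (h * sqrt h + norm \<zeta> ^ 4 / sqrt h))"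
        using U \<epsilon> E by (intro mult_left_mono add_nonneg_nonneg mult_nonneg_nonneg) auto
      then show ?thesis by (simp add: C_def ac_simps)
    qed
    show "(\<epsilon>\<^sup>2 - (norm y)\<^sup>2) ^ 3 - 6 * \<epsilon> * K * h * (\<epsilon>\<^sup>2 - (norm y)\<^sup>2)\<^sup>2 - 6 * (\<epsilon>\<^sup>2 - (norm y)\<^sup>2)\<^sup>2 * (y \<bullet> \<zeta>)
      - 3 * (\<epsilon>\<^sup>2 - (norm y)\<^sup>2)\<^sup>2 * (norm \<zeta>)\<^sup>2 + 12 * (\<epsilon>\<^sup>2 - (norm y)\<^sup>2) * (y \<bullet> \<zeta>)\<^sup>2
      - C * (h * sqrt h + norm \<zeta> ^ 4 / sqrt h) \<le> bump \<epsilon> (y + \<beta> + \<zeta>)"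
      unfolding bump u_def[symmetric] using main t1 t2 t3 QC by (simp add: distrib_right)
  qed
qed

text \<open>No spectral theory: let \<open>a\<close> be the product of \<open>A\<close> with its
  transpose and \<open>y = a x\<close>. Then
  \<open>|x v* A|^2 = x \<bullet> y \<le> K |y|^2\<close>, and Cauchy-Schwarz for
  \<open>|y|^2 = (y v* A) \<bullet> (x v* A)\<close> gives the claim after cancelling
  \<open>|y|^2\<close>.\<close>

lemma matrix_elliptic:
  fixes A :: "real^'m^'d"
  assumes inv: "invertible (A ** transpose A)" and K: "norm (matrix_inv (A ** transpose A)) \<le> K"
  shows "(norm y)\<^sup>2 \<le> K * (norm (y v* A))\<^sup>2"
proof (cases "y = 0")
  case False
  define x where "x = matrix_inv (A ** transpose A) *v y"
  have y: "y = A *v (x v* A)"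
  proof -
    have "A ** transpose A ** matrix_inv (A ** transpose A) = mat 1"
      using someI_ex[OF inv[unfolded invertible_def]] unfolding matrix_inv_def by blast
    then have "y = (A ** transpose A) *v x"
      unfolding x_def by (simp add: matrix_vector_mul_assoc)
    then show ?thesis by (simp add: matrix_vector_mul_assoc[symmetric] transpose_matrix_vector)
  qed
  have "(norm (x v* A))\<^sup>2 = x \<bullet> y"
    unfolding power2_norm_eq_inner by (subst y) (simp add: inner_matrix_vector_mult)
  also have "\<dots> \<le> norm x * norm y" by (rule norm_cauchy_schwarz)
  also have "norm x \<le> K * norm y"
    unfolding x_def using norm_matrix_vector_mult_le[of "matrix_inv (A ** transpose A)" y] K
    by (meson mult_right_mono norm_ge_zero order_trans)
  finally have 1: "(norm (x v* A))\<^sup>2 \<le> K * (norm y)\<^sup>2"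
    by (simp add: mult_right_mono power2_eq_square mult.assoc)
  have "(norm y)\<^sup>2 = (y v* A) \<bullet> (x v* A)"
    unfolding power2_norm_eq_inner by (subst (2) y) (simp add: inner_matrix_vector_mult)
  also have "\<dots> \<le> norm (y v* A) * norm (x v* A)" by (rule norm_cauchy_schwarz)
  finally have "((norm y)\<^sup>2)\<^sup>2 \<le> (norm (y v* A) * norm (x v* A))\<^sup>2" by (intro power_mono) auto
  also have "\<dots> = (norm (y v* A))\<^sup>2 * (norm (x v* A))\<^sup>2" by (simp add: power_mult_distrib)
  also have "\<dots> \<le> (norm (y v* A))\<^sup>2 * (K * (norm y)\<^sup>2)" using 1 by (intro mult_left_mono) auto
  finally have "(norm y)\<^sup>2 * (norm y)\<^sup>2 \<le> (K * (norm (y v* A))\<^sup>2) * (norm y)\<^sup>2"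
    by (simp add: power2_eq_square ac_simps)
  then show ?thesis using False by (intro mult_right_le_imp_le[of "(norm y)\<^sup>2" "(norm y)\<^sup>2"]) simp_all
qed simp

text \<open>The squared Frobenius norm of \<open>A\<close> is the trace of
  \<open>A ** transpose A\<close>, and each diagonal entry is at most the norm of that
  matrix.\<close>

lemma matrix_norm_sq_le:
  fixes A :: "real^'m^'d" and K :: real
  assumes K: "norm (A ** transpose A) \<le> K"
  shows "(norm A)\<^sup>2 \<le> CARD('d) * K"
proof -
  have "(norm A)\<^sup>2 = (\<Sum>i\<in>UNIV. (norm (A $ i))\<^sup>2)"
    by (simp add: norm_vec_def[of A] L2_set_def sum_nonneg)
  also have "\<dots> = (\<Sum>i\<in>UNIV. (A ** transpose A) $ i $ i)"
    unfolding power2_norm_eq_inner by (simp add: inner_vec_def matrix_matrix_mult_def transpose_def)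
  also have "\<dots> \<le> (\<Sum>i\<in>(UNIV::'d set). K :: real)"
  proof (rule sum_mono)
    fix i
    have "(A ** transpose A) $ i $ i \<le> norm ((A ** transpose A) $ i $ i)" by simp
    also have "\<dots> \<le> norm ((A ** transpose A) $ i)" by (rule Finite_Cartesian_Product.norm_nth_le)
    also have "\<dots> \<le> norm (A ** transpose A)" by (rule Finite_Cartesian_Product.norm_nth_le)
    finally show "(A ** transpose A) $ i $ i \<le> K" using K by simp
  qed
  finally show ?thesis by simp
qed

section \<open>Countable covers of open sets of paths\<close>

text \<open>Codes \<open>(n, xs, k)\<close> stand for step functions of mesh \<open>1 / n\<close>
  with values in a countable dense set, with accuracy \<open>rad k\<close>. A code met by a path of
  \<open>G\<close> whose \<open>20 * rad k\<close> ball stays in \<open>G\<close> is given such a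
  path as centre and a polynomial within \<open>rad k\<close> of the centre. The factor 3 is path to
  code, code to centre, centre to polynomial; \<open>8 + 1 < 20\<close> keeps the wider tube inside
  \<open>G\<close>. Polynomials are taken because the tube estimate needs a Lipschitz path.\<close>

lemma uniformly_open_cover:
  fixes G :: "(real \<Rightarrow> 'b::euclidean_space) set"
  assumes G: "uniformly_open T G" and T: "0 \<le> T"
  obtains \<F> :: "((real \<Rightarrow> 'b) \<times> real) set" where "countable \<F>"
    and "\<And>f \<delta>. (f, \<delta>) \<in> \<F> \<Longrightarrow> polynomial_function f \<and> 0 < \<delta>"
    and "\<And>f \<delta> h. (f, \<delta>) \<in> \<F> \<Longrightarrow> h \<in> cpath_space T \<Longrightarrow> \<forall>s\<in>{0..T}. dist (h s) (f s) \<le> 8 * \<delta> \<Longrightarrow> h \<in> G"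
    and "\<And>g. g \<in> G \<Longrightarrow> \<exists>(f, \<delta>)\<in>\<F>. \<forall>s\<in>{0..T}. dist (g s) (f s) \<le> 3 * \<delta>"
proof -
  obtain D :: "'b set" where D: "countable D" "\<And>X. open X \<Longrightarrow> X \<noteq> {} \<Longrightarrow> \<exists>d\<in>D. d \<in> X"
    using countable_dense_exists by blast
  define rad where "rad k = 1 / real (Suc k)" for k :: nat
  have rad: "0 < rad k" for k by (simp add: rad_def)
  \<comment> \<open>An index beyond the length of \<open>xs\<close> gives an unspecified but fixed
    value, so two paths with the same code are within \<open>2 * rad k\<close> in any case.\<close>
  define close where "close = (\<lambda>(n::nat, xs::'b list, k::nat) g. \<forall>s\<in>{0..T}. dist (g s) (xs ! nat \<lfloor>s * n\<rfloor>) \<le> rad k)"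
  define P where "P = (\<lambda>(n, xs, k) g. g \<in> G \<and> close (n, xs, k) g \<and>
     (\<forall>h\<in>cpath_space T. (SUP t\<in>{0..T}. dist (h t) (g t)) < 20 * rad k \<longrightarrow> h \<in> G))"
  define I where "I = {i \<in> UNIV \<times> lists D \<times> UNIV. \<exists>g. P i g}"
  define centre where "centre i = (SOME g. P i g)" for i
  have centre: "P i (centre i)" if "i \<in> I" for i
    using that someI_ex[of "P i"] by (auto simp: I_def centre_def)
  define approx where "approx i = (SOME f. polynomial_function f \<and> (\<forall>s\<in>{0..T}. norm (centre i s - f s) < rad (snd (snd i))))" for i
  have cont: "continuous_on {0..T} g" if "g \<in> G" for g
    using that G by (auto simp: uniformly_open_def cpath_space_def)
  have approx: "polynomial_function (approx i)" "\<And>s. s \<in> {0..T} \<Longrightarrow> norm (centre i s - approx i s) < rad (snd (snd i))"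
    if "i \<in> I" for i
  proof -
    have "centre i \<in> G" using centre[OF that] by (auto simp: P_def split: prod.splits)
    then have "\<exists>f. polynomial_function f \<and> (\<forall>s\<in>{0..T}. norm (centre i s - f s) < rad (snd (snd i)))"
      using Stone_Weierstrass_polynomial_function[OF compact_Icc cont rad] by metis
    from someI_ex[OF this] show "polynomial_function (approx i)" "\<And>s. s \<in> {0..T} \<Longrightarrow> norm (centre i s - approx i s) < rad (snd (snd i))"
      unfolding approx_def by auto
  qed
  show ?thesis
  proof (rule that[of "(\<lambda>i. (approx i, rad (snd (snd i)))) ` I"])
    have "I \<subseteq> UNIV \<times> lists D \<times> UNIV" by (auto simp: I_def)
    then have "countable I"
      by (rule countable_subset) (intro countable_SIGMA countable_lists D countableI_type)
    then show "countable ((\<lambda>i. (approx i, rad (snd (snd i)))) ` I)" by (rule countable_image)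
  next
    fix f \<delta> assume "(f, \<delta>) \<in> (\<lambda>i. (approx i, rad (snd (snd i)))) ` I"
    then show "polynomial_function f \<and> 0 < \<delta>" using approx rad by auto
  next
    fix f \<delta> h assume "(f, \<delta>) \<in> (\<lambda>i. (approx i, rad (snd (snd i)))) ` I"
      and h: "h \<in> cpath_space T" and le: "\<forall>s\<in>{0..T}. dist (h s) (f s) \<le> 8 * \<delta>"
    then obtain i where i: "i \<in> I" "f = approx i" "\<delta> = rad (snd (snd i))" by auto
    have "dist (h s) (centre i s) \<le> 9 * \<delta>" if "s \<in> {0..T}" for s
    proof -
      have "dist (h s) (centre i s) \<le> dist (h s) (f s) + dist (centre i s) (f s)" by (rule dist_triangle2)
      also have "\<dots> \<le> 8 * \<delta> + \<delta>" using bspec[OF le that] approx(2)[OF i(1) that] i by (simp add: dist_norm)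
      finally show ?thesis by simp
    qed
    then have "(SUP t\<in>{0..T}. dist (h t) (centre i t)) \<le> 9 * \<delta>"
      using T by (intro cSUP_least) auto
    also have "\<dots> < 20 * \<delta>" using rad i by simp
    finally show "h \<in> G" using centre[OF i(1)] h i by (auto simp: P_def split: prod.splits)
  next
    fix g assume g: "g \<in> G"
    then obtain e where e: "0 < e" "\<And>h. h \<in> cpath_space T \<Longrightarrow> (SUP t\<in>{0..T}. dist (h t) (g t)) < e \<Longrightarrow> h \<in> G"
      using G unfolding uniformly_open_def by metis
    obtain k where k: "1 / real (Suc k) < e / 20" using nat_approx_posE[of "e / 20"] e by auto
    have "uniformly_continuous_on {0..T} g"
      by (rule compact_uniformly_continuous[OF cont[OF g] compact_Icc])
    then obtain \<eta> where \<eta>: "0 < \<eta>" "\<And>s t. s \<in> {0..T} \<Longrightarrow> t \<in> {0..T} \<Longrightarrow> dist t s < \<eta> \<Longrightarrow> dist (g t) (g s) < rad k / 2"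
      unfolding uniformly_continuous_on_def using rad[of k] by (metis half_gt_zero)
    obtain n0 where n0: "1 / real (Suc n0) < \<eta>" using nat_approx_posE[OF \<eta>(1)] by auto
    define n where "n = Suc n0"
    have n: "0 < real n" "1 / real n < \<eta>" using n0 by (auto simp: n_def)
    define pt where "pt i = (SOME d. d \<in> D \<and> dist (g (real i / n)) d < rad k / 2)" for i
    have pt: "pt i \<in> D" "dist (g (real i / n)) (pt i) < rad k / 2" for i
    proof -
      have "\<exists>d. d \<in> D \<and> dist (g (real i / n)) d < rad k / 2"
        using D(2)[of "ball (g (real i / n)) (rad k / 2)"] rad[of k] by auto
      from someI_ex[OF this] show "pt i \<in> D" "dist (g (real i / n)) (pt i) < rad k / 2"
        unfolding pt_def by auto
    qed
    \<comment> \<open>One entry more than the floor of \<open>T * n\<close>, so that the index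
      belonging to \<open>s = T\<close> exists.\<close>
    define xs where "xs = map pt [0..<Suc (nat \<lfloor>T * n\<rfloor>)]"
    have near: "dist (g s) (xs ! nat \<lfloor>s * n\<rfloor>) \<le> rad k" if s: "s \<in> {0..T}" for s
    proof -
      define j where "j = nat \<lfloor>s * n\<rfloor>"
      have j: "real j \<le> s * n" "s * n < real j + 1" using s n unfolding j_def by (auto simp: of_nat_nat)
      have "\<lfloor>s * n\<rfloor> \<le> \<lfloor>T * n\<rfloor>" using s n by (intro floor_mono mult_right_mono) auto
      then have "j < Suc (nat \<lfloor>T * n\<rfloor>)" unfolding j_def by (simp add: less_Suc_eq_le nat_mono)
      then have xsj: "xs ! j = pt j" unfolding xs_def by (simp del: upt_Suc)
      have jn: "real j / n \<le> s" "s < real j / n + 1 / n" using j n by (auto simp: field_simps)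
      then have "dist s (real j / n) < \<eta>" using n by (simp add: dist_real_def)
      moreover have "real j / n \<in> {0..T}" using jn s by auto
      ultimately have "dist (g s) (g (real j / n)) < rad k / 2" using \<eta>(2)[of "real j / n" s] s by simp
      then have "dist (g s) (pt j) \<le> rad k" using pt(2)[of j] dist_triangle[of "g s" "pt j" "g (real j / n)"] by simp
      then show ?thesis using xsj by (simp add: j_def)
    qed
    have Pg: "P (n, xs, k) g"
      unfolding P_def close_def using g near e k by (auto simp: rad_def)
    have i: "(n, xs, k) \<in> I"
      unfolding I_def using Pg pt(1) by (auto simp: xs_def in_lists_conv_set)
    have "dist (g s) (approx (n, xs, k) s) \<le> 3 * rad k" if s: "s \<in> {0..T}" for s
    proof -
      have "dist (centre (n, xs, k) s) (xs ! nat \<lfloor>s * n\<rfloor>) \<le> rad k"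
        using centre[OF i] s by (auto simp: P_def close_def)
      moreover have "dist (centre (n, xs, k) s) (approx (n, xs, k) s) < rad k"
        using approx(2)[OF i s] by (simp add: dist_norm)
      ultimately show ?thesis
        using near[OF s] dist_triangle2[of "g s" "centre (n, xs, k) s" "xs ! nat \<lfloor>s * n\<rfloor>"]
          dist_triangle[of "g s" "approx (n, xs, k) s" "centre (n, xs, k) s"] by simp
    qed
    then show "\<exists>(f, \<delta>)\<in>(\<lambda>i. (approx i, rad (snd (snd i)))) ` I. \<forall>s\<in>{0..T}. dist (g s) (f s) \<le> 3 * \<delta>"
      using i by (intro bexI[of _ "(approx (n, xs, k), rad k)"]) (auto intro!: image_eqI[of _ _ "(n, xs, k)"])
  qed
qed

section \<open>Approximation of Ito integrals\<close>

lemma le_on_Icc_if_le_on_Rats: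
  fixes g :: "real \<Rightarrow> real"
  assumes g: "continuous_on {0..b} g" and le: "\<And>r. r \<in> \<rat> \<Longrightarrow> r \<in> {0..b} \<Longrightarrow> g r \<le> e" and t: "t \<in> {0..b}"
  shows "g t \<le> e"
proof (rule ccontr)
  assume n: "\<not> g t \<le> e"
  have "b \<noteq> 0" using le[of 0] t n by auto
  then have b: "0 < b" using t by auto
  obtain d where d: "0 < d" "\<And>x. x \<in> {0..b} \<Longrightarrow> dist x t < d \<Longrightarrow> dist (g x) (g t) < g t - e"
    using g t n unfolding continuous_on_iff by (metis diff_gt_0_iff_gt not_le)
  have "max 0 (t - d) < min b (t + d)" using d b t by auto
  then obtain r where r: "r \<in> \<rat>" "max 0 (t - d) < r" "r < min b (t + d)"
    using Rats_dense_in_real by blast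
  then have "dist (g r) (g t) < g t - e" by (intro d) (auto simp: dist_real_def)
  then show False using le[OF r(1)] r by (auto simp: dist_real_def)
qed

lemma partition_cover:
  fixes p :: "nat \<Rightarrow> real"
  assumes "p 0 < r" "r \<le> p n"
  shows "\<exists>k<n. r \<in> {p k<..p (Suc k)}"
  using assms(2)
proof (induction n)
  case (Suc n)
  show ?case
  proof (cases "r \<le> p n")
    case True
    then show ?thesis using Suc.IH by (auto intro: less_SucI)
  next
    case False
    then show ?thesis using Suc.prems by (intro exI[of _ n]) auto
  qed
qed (use assms(1) in auto)

text \<open>Turns time integrals of the approximation error into sums along a partition. It is used
  for the quadratic variation of the cut-off part and, with negative \<open>v\<close>, for the lower
  bound from ellipticity. The half-open intervals are those on which simple integrands are
  constant.\<close>

lemma partition_sum_le_integral: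
  fixes q v :: "nat \<Rightarrow> real" and f :: "real \<Rightarrow> real"
  assumes f: "integrable (restrict_space lborel {0..T}) f"
    and q0: "0 \<le> q 0" and qn: "q n \<le> T" and mono: "\<And>k. k < n \<Longrightarrow> q k \<le> q (Suc k)"
    and le: "\<And>k r. k < n \<Longrightarrow> r \<in> {q k<..q (Suc k)} \<Longrightarrow> v k \<le> f r"
  shows "(\<Sum>k<n. v k * (q (Suc k) - q k)) \<le> (LINT r|restrict_space lborel {0..T}. indicator {q 0<..q n} r * f r)"
  using qn mono le
proof (induction n)
  case (Suc n)
  let ?N = "restrict_space lborel {0..T}"
  have "q 0 \<le> q n" by (rule partition_mono[of n q 0 n]) (simp_all add: Suc.prems(2))
  then have q: "0 \<le> q n" "q n \<le> q (Suc n)" "q (Suc n) \<le> T" "q 0 \<le> q n" "q n \<le> T"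
    using q0 Suc.prems(1) Suc.prems(2)[OF lessI] by linarith+
  have meas: "{a<..b} \<in> sets ?N" if "0 \<le> a" "b \<le> T" for a b
    using that by (subst sets_restrict_space) (auto intro!: image_eqI[of _ _ "{a<..b}"])
  have int: "integrable ?N (\<lambda>r. indicator {a<..b} r * f r)" if "0 \<le> a" "b \<le> T" for a b
    using integrable_real_mult_indicator[OF meas[OF that] f] by (simp add: mult.commute)
  have fin: "emeasure ?N {a<..b} = ennreal (b - a)" if "0 \<le> a" "a \<le> b" "b \<le> T" for a b
    using that by (subst emeasure_restrict_space) auto
  have "v n * (q (Suc n) - q n) = (LINT r|?N. indicator {q n<..q (Suc n)} r * v n)"
    using fin[OF q(1-3)] q(2) meas[OF q(1,3)] sets.sets_into_space[OF meas[OF q(1,3)]]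
    by (simp add: measure_def Int_absorb2 mult.commute)
  also have "\<dots> \<le> (LINT r|?N. indicator {q n<..q (Suc n)} r * f r)"
  proof (rule integral_mono)
    show "integrable ?N (\<lambda>r. indicator {q n<..q (Suc n)} r * v n)"
      by (intro integrable_mult_left integrable_real_indicator meas[OF q(1,3)]) (simp add: fin[OF q(1-3)])
    show "integrable ?N (\<lambda>r. indicator {q n<..q (Suc n)} r * f r)" by (rule int[OF q(1,3)])
    show "indicator {q n<..q (Suc n)} r * v n \<le> indicator {q n<..q (Suc n)} r * f r" for r
      using Suc.prems(3)[OF lessI, of r] by (simp add: indicator_def)
  qed
  finally have "(\<Sum>k<Suc n. v k * (q (Suc k) - q k))
     \<le> (LINT r|?N. indicator {q 0<..q n} r * f r) + (LINT r|?N. indicator {q n<..q (Suc n)} r * f r)"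
    using Suc.IH[OF q(5) Suc.prems(2,3)] by simp
  also have "\<dots> = (LINT r|?N. indicator {q 0<..q n} r * f r + indicator {q n<..q (Suc n)} r * f r)"
    using int q q0 by (intro Bochner_Integration.integral_add[symmetric]) auto
  also have "\<dots> = (LINT r|?N. indicator {q 0<..q (Suc n)} r * f r)"
    using q by (intro Bochner_Integration.integral_cong refl) (auto simp: indicator_def)
  finally show ?case .
qed simp

lemma bdd_above_norm_image:
  fixes f :: "real \<Rightarrow> 'b::real_normed_vector"
  assumes "continuous_on {0..T} f"
  shows "bdd_above ((\<lambda>t. norm (f t)) ` {0..T})"
  by (intro bounded_imp_bdd_above compact_imp_bounded compact_continuous_image continuous_on_norm assms compact_Icc)

lemma norm_le_Sup_norm:
  fixes f :: "real \<Rightarrow> 'b::real_normed_vector"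
  assumes "continuous_on {0..T} f" "t \<in> {0..T}"
  shows "norm (f t) \<le> \<bar>Sup ((\<lambda>t. norm (f t)) ` {0..T})\<bar>"
  using cSUP_upper[OF assms(2) bdd_above_norm_image[OF assms(1)]] by simp

lemma finite_measure_restrict_lborel: "finite_measure (restrict_space lborel {0..T::real})"
  by (rule finite_measureI) (auto simp: emeasure_restrict_space space_restrict_space emeasure_lborel_Icc_eq)

text \<open>For \<open>p 0 = 0\<close> this agrees with a simple integrand on \<open>(0,T]\<close>
  and is 0 at time 0, which makes it jointly measurable in time and \<omega>.\<close>

definition step_integrand :: "nat \<Rightarrow> (nat \<Rightarrow> real) \<Rightarrow> (nat \<Rightarrow> 'a \<Rightarrow> 'b::real_vector) \<Rightarrow> real \<Rightarrow> 'a \<Rightarrow> 'b" where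
  "step_integrand n p \<xi> r \<omega> = (\<Sum>k<n. indicator {p k<..p (Suc k)} r *\<^sub>R \<xi> k \<omega>)"

lemma step_integrand_eq:
  assumes mono: "\<And>k. k < n \<Longrightarrow> p k \<le> p (Suc k)" and k: "k < n" "r \<in> {p k<..p (Suc k)}"
  shows "step_integrand n p \<xi> r \<omega> = \<xi> k \<omega>"
proof -
  have "step_integrand n p \<xi> r \<omega> = (\<Sum>j<n. if j = k then \<xi> k \<omega> else 0)"
    unfolding step_integrand_def
  proof (intro sum.cong refl)
    fix j assume j: "j \<in> {..<n}"
    consider "j = k" | "j < k" | "k < j" by linarith
    then show "indicator {p j<..p (Suc j)} r *\<^sub>R \<xi> j \<omega> = (if j = k then \<xi> k \<omega> else 0)"
    proof cases
      case 2
      have "p (Suc j) \<le> p k" by (rule partition_mono[of n p, OF mono]) (use k 2 in auto)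
      then show ?thesis using k 2 by auto
    next
      case 3
      have "p (Suc k) \<le> p j" by (rule partition_mono[of n p, OF mono]) (use j 3 in auto)
      then show ?thesis using k 3 by auto
    qed (use k in auto)
  qed
  then show ?thesis using k by simp
qed

section \<open>Measurability of the error events\<close>

context brownian
begin

text \<open>By continuity of paths the supremum exceeds \<open>e\<close> iff some rational time
  does. The lemma is indispensable because \<open>measure\<close> is 0 on non-measurable sets:
  \<open>tendsto_zero_in_prob\<close> says something only about events known to be
  measurable.\<close>

lemma Sup_norm_measurable:
  fixes J I :: "real \<Rightarrow> 'a \<Rightarrow> 'b::euclidean_space"
  assumes T: "0 \<le> T" and e: "0 < e"
    and cont: "\<And>\<omega>. \<omega> \<in> space M \<Longrightarrow> continuous_on {0..T} (\<lambda>t. J t \<omega> - I t \<omega>)"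
    and meas: "\<And>t. t \<in> {0..T} \<Longrightarrow> (\<lambda>\<omega>. J t \<omega> - I t \<omega>) \<in> borel_measurable M"
  shows "{\<omega> \<in> space M. \<bar>Sup ((\<lambda>t. norm (J t \<omega> - I t \<omega>)) ` {0..T})\<bar> > e} \<in> sets M"
proof -
  have bdd: "bdd_above ((\<lambda>t. norm (J t \<omega> - I t \<omega>)) ` {0..T})" if "\<omega> \<in> space M" for \<omega>
    by (rule bdd_above_norm_image[OF cont[OF that]])
  have le: "norm (J t \<omega> - I t \<omega>) \<le> \<bar>Sup ((\<lambda>t. norm (J t \<omega> - I t \<omega>)) ` {0..T})\<bar>"
    if "\<omega> \<in> space M" "t \<in> {0..T}" for \<omega> t
    by (rule norm_le_Sup_norm[OF cont[OF that(1)] that(2)])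
  have "{\<omega> \<in> space M. \<bar>Sup ((\<lambda>t. norm (J t \<omega> - I t \<omega>)) ` {0..T})\<bar> > e}
      = (\<Union>r\<in>\<rat> \<inter> {0..T}. {\<omega> \<in> space M. norm (J r \<omega> - I r \<omega>) > e})"
  proof (intro set_eqI iffI)
    fix \<omega> assume "\<omega> \<in> {\<omega> \<in> space M. \<bar>Sup ((\<lambda>t. norm (J t \<omega> - I t \<omega>)) ` {0..T})\<bar> > e}"
    then have \<omega>: "\<omega> \<in> space M" and gt: "\<bar>Sup ((\<lambda>t. norm (J t \<omega> - I t \<omega>)) ` {0..T})\<bar> > e" by auto
    show "\<omega> \<in> (\<Union>r\<in>\<rat> \<inter> {0..T}. {\<omega> \<in> space M. norm (J r \<omega> - I r \<omega>) > e})"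
    proof (rule ccontr)
      assume "\<not> ?thesis"
      then have "norm (J r \<omega> - I r \<omega>) \<le> e" if "r \<in> \<rat>" "r \<in> {0..T}" for r using that \<omega> by force
      then have "norm (J t \<omega> - I t \<omega>) \<le> e" if "t \<in> {0..T}" for t
        by (rule le_on_Icc_if_le_on_Rats[OF continuous_on_norm[OF cont[OF \<omega>]] _ that])
      then have "Sup ((\<lambda>t. norm (J t \<omega> - I t \<omega>)) ` {0..T}) \<le> e" using T by (intro cSUP_least) auto
      moreover have "0 \<le> Sup ((\<lambda>t. norm (J t \<omega> - I t \<omega>)) ` {0..T})"
        using cSUP_upper[OF _ bdd[OF \<omega>], of 0] T by (auto intro: order_trans[OF norm_ge_zero])
      ultimately show False using gt by simp
    qed
  next
    fix \<omega> assume "\<omega> \<in> (\<Union>r\<in>\<rat> \<inter> {0..T}. {\<omega> \<in> space M. norm (J r \<omega> - I r \<omega>) > e})"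
    then obtain r where "r \<in> {0..T}" "\<omega> \<in> space M" "norm (J r \<omega> - I r \<omega>) > e" by auto
    then show "\<omega> \<in> {\<omega> \<in> space M. \<bar>Sup ((\<lambda>t. norm (J t \<omega> - I t \<omega>)) ` {0..T})\<bar> > e}"
      using le[of \<omega> r] by auto
  qed
  also have "\<dots> \<in> sets M"
  proof (rule sets.countable_UN'')
    show "countable (\<rat> \<inter> {0..T})" by (auto intro: countable_subset[OF _ countable_rat])
    fix r assume "r \<in> \<rat> \<inter> {0..T}"
    then have [measurable]: "(\<lambda>\<omega>. J r \<omega> - I r \<omega>) \<in> borel_measurable M" by (intro meas) auto
    show "{\<omega> \<in> space M. norm (J r \<omega> - I r \<omega>) > e} \<in> sets M" by measurable
  qed
  finally show "{\<omega> \<in> space M. \<bar>Sup ((\<lambda>t. norm (J t \<omega> - I t \<omega>)) ` {0..T})\<bar> > e} \<in> sets M" .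
qed

lemma progressive_measurable_pair:
  assumes "progressive_on T F X" and t: "0 \<le> t" "t \<le> T"
  shows "(\<lambda>(\<omega>, s). X s \<omega>) \<in> borel_measurable (F t \<Otimes>\<^sub>M restrict_space lborel {0..t})"
proof -
  have [measurable]: "(\<lambda>(s, \<omega>). X s \<omega>) \<in> borel_measurable (restrict_space borel {0..t} \<Otimes>\<^sub>M F t)"
    using assms by (auto simp: progressive_on_def)
  have "(\<lambda>(\<omega>, s). X s \<omega>) \<in> borel_measurable (F t \<Otimes>\<^sub>M restrict_space borel {0..t})"
    by (rule measurable_pair_swap[of "\<lambda>(s, \<omega>). X s \<omega>", simplified]) measurable
  moreover have "sets (F t \<Otimes>\<^sub>M restrict_space lborel {0..t}) = sets (F t \<Otimes>\<^sub>M restrict_space borel {0..t})"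
    by (intro sets_pair_measure_cong sets_restrict_space_cong) auto
  ultimately show ?thesis
    using measurable_cong_sets by blast
qed

lemma measurable_pair_F_M:
  assumes "f \<in> measurable (F t \<Otimes>\<^sub>M N) L" and t: "0 \<le> t" "t \<le> T"
  shows "f \<in> measurable (M \<Otimes>\<^sub>M N) L"
proof -
  have "id \<in> measurable M (F t)"
    using subalgebra_F[OF t] sets.sets_into_space by (intro measurableI) (auto simp: subalgebra_def)
  then have "(\<lambda>x. (id (fst x), snd x)) \<in> measurable (M \<Otimes>\<^sub>M N) (F t \<Otimes>\<^sub>M N)"
    by (intro measurable_Pair measurable_compose[OF measurable_fst] measurable_snd)
  from measurable_compose[OF this assms(1)] show ?thesis by simp
qed

end

text \<open>Applied with \<open>z\<close> a value of \<open>\<sigma>\<close>, which lies in the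
  ball: the second bound controls the part cut off by the projection, the third the distance of the
  projected integrand from \<open>\<sigma>\<close>.\<close>

lemma closest_point_cball:
  fixes x z :: "'b::euclidean_space"
  assumes "norm z \<le> R"
  shows "norm (closest_point (cball 0 R) x) \<le> R"
    and "norm (x - closest_point (cball 0 R) x) \<le> norm (x - z)"
    and "norm (closest_point (cball 0 R) x - z) \<le> norm (x - z)"
proof -
  have z: "z \<in> cball 0 R" using assms by simp
  then have ne: "cball 0 R \<noteq> ({} :: 'b set)" by blast
  have "closest_point (cball 0 R) x \<in> cball 0 R" by (rule closest_point_in_set[OF closed_cball ne])
  then show "norm (closest_point (cball 0 R) x) \<le> R" by simp
  show "norm (x - closest_point (cball 0 R) x) \<le> norm (x - z)"
    using closest_point_le[OF closed_cball z, of x] by (simp add: dist_norm)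
  have "dist (closest_point (cball 0 R) x) (closest_point (cball 0 R) z) \<le> dist x z"
    by (rule closest_point_lipschitz[OF convex_cball closed_cball ne])
  then show "norm (closest_point (cball 0 R) x - z) \<le> norm (x - z)"
    using closest_point_self[OF z] by (simp add: dist_norm)
qed

lemma closest_point_cball_measurable:
  "0 \<le> R \<Longrightarrow> closest_point (cball (0::'b::euclidean_space) R) \<in> borel_measurable borel"
  by (intro borel_measurable_continuous_onI continuous_on_closest_point) auto

context brownian
begin

text \<open>
  A simple integrand is unconstrained at time 0, not even measurable in \<open>\<omega>\<close>; a single point does not
  affect the integral.
\<close>
lemma simple_error:
  fixes \<sigma> H :: "real \<Rightarrow> 'a \<Rightarrow> real^'m^'d"
  assumes T: "0 \<le> T" and p: "p 0 = 0" "p n = T" "\<And>k. k < n \<Longrightarrow> p k < p (Suc k)"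
    and \<xi>m: "\<And>k. k < n \<Longrightarrow> \<xi> k \<in> borel_measurable M"
    and \<xi>b: "\<And>k \<omega>. k < n \<Longrightarrow> \<omega> \<in> space M \<Longrightarrow> norm (\<xi> k \<omega>) \<le> B k"
    and H: "\<And>k r \<omega>. k < n \<Longrightarrow> r \<in> {p k<..p (Suc k)} \<Longrightarrow> \<omega> \<in> space M \<Longrightarrow> H r \<omega> = \<xi> k \<omega>"
    and prog: "progressive_on T F \<sigma>"
    and R: "\<And>r \<omega>. r \<in> {0..T} \<Longrightarrow> \<omega> \<in> space M \<Longrightarrow> norm (\<sigma> r \<omega>) \<le> R"
  shows "\<And>\<omega>. \<omega> \<in> space M \<Longrightarrow> integrable (restrict_space lborel {0..T}) (\<lambda>r. (norm (H r \<omega> - \<sigma> r \<omega>))\<^sup>2)"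
    and "(\<lambda>\<omega>. LINT r|restrict_space lborel {0..T}. (norm (H r \<omega> - \<sigma> r \<omega>))\<^sup>2) \<in> borel_measurable M"
proof -
  let ?N = "restrict_space lborel {0..T}"
  interpret N: finite_measure ?N by (rule finite_measure_restrict_lborel)
  define Hs where "Hs = step_integrand n p \<xi>"
  have mono: "p k \<le> p (Suc k)" if "k < n" for k using p(3)[OF that] by simp
  have HHs: "H r \<omega> = Hs r \<omega>" if r: "r \<in> {0..T}" "r \<noteq> 0" and \<omega>: "\<omega> \<in> space M" for r \<omega>
  proof -
    obtain k where k: "k < n" "r \<in> {p k<..p (Suc k)}" using partition_cover[of p r n] r p by auto
    then show ?thesis using H[OF k \<omega>] step_integrand_eq[of n p k r \<xi> \<omega>, OF mono k] by (simp add: Hs_def)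
  qed
  note [measurable] = \<xi>m
  have [measurable]: "(\<lambda>(\<omega>, r). \<sigma> r \<omega>) \<in> borel_measurable (M \<Otimes>\<^sub>M ?N)"
    using measurable_pair_F_M[OF progressive_measurable_pair[OF prog]] T by auto
  have snd_m[measurable]: "snd \<in> measurable (M \<Otimes>\<^sub>M ?N) borel"
    by (rule measurable_compose[OF measurable_snd]) (auto intro: measurable_restrict_space1)
  have [measurable]: "(\<lambda>x. Hs (snd x) (fst x)) \<in> borel_measurable (M \<Otimes>\<^sub>M ?N)"
    unfolding Hs_def step_integrand_def
  proof (intro borel_measurable_sum borel_measurable_scaleR)
    fix k assume k: "k \<in> {..<n}"
    show "(\<lambda>x. indicat_real {p k<..p (Suc k)} (snd x)) \<in> borel_measurable (M \<Otimes>\<^sub>M ?N)"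
      by (rule measurable_compose[OF snd_m]) measurable
    show "(\<lambda>x. \<xi> k (fst x)) \<in> borel_measurable (M \<Otimes>\<^sub>M ?N)"
      using k by (intro measurable_compose[OF measurable_fst] \<xi>m) auto
  qed
  have fs: "(\<lambda>(\<omega>, r). (norm (Hs r \<omega> - \<sigma> r \<omega>))\<^sup>2) \<in> borel_measurable (M \<Otimes>\<^sub>M ?N)"
    by (simp add: split_beta')
  have fs\<omega>: "(\<lambda>r. (norm (Hs r \<omega> - \<sigma> r \<omega>))\<^sup>2) \<in> borel_measurable ?N" if "\<omega> \<in> space M" for \<omega>
    using measurable_compose[OF measurable_Pair1'[OF that] fs] by simp
  have f\<omega>: "(\<lambda>r. (norm (H r \<omega> - \<sigma> r \<omega>))\<^sup>2) \<in> borel_measurable ?N" if \<omega>: "\<omega> \<in> space M" for \<omega>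
  proof -
    have [measurable]: "(\<lambda>r. r) \<in> borel_measurable ?N" by (auto intro: measurable_restrict_space1)
    note [measurable] = fs\<omega>[OF \<omega>]
    have "(\<lambda>r. if r = 0 then (norm (H 0 \<omega> - \<sigma> 0 \<omega>))\<^sup>2 else (norm (Hs r \<omega> - \<sigma> r \<omega>))\<^sup>2) \<in> borel_measurable ?N"
      by measurable
    then show ?thesis
      by (rule measurable_cong[THEN iffD1, rotated]) (use HHs[OF _ _ \<omega>] in \<open>auto simp: space_restrict_space\<close>)
  qed
  have AE: "AE r in ?N. (norm (H r \<omega> - \<sigma> r \<omega>))\<^sup>2 = (norm (Hs r \<omega> - \<sigma> r \<omega>))\<^sup>2" if \<omega>: "\<omega> \<in> space M" for \<omega>
    using AE_lborel_singleton[of "0::real"] HHs[OF _ _ \<omega>]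
    by (subst AE_restrict_space_iff) auto
  have int_s: "integrable ?N (\<lambda>r. (norm (Hs r \<omega> - \<sigma> r \<omega>))\<^sup>2)" if \<omega>: "\<omega> \<in> space M" for \<omega>
  proof (rule N.integrable_const_bound[OF AE_I2 fs\<omega>[OF \<omega>]])
    fix r assume r: "r \<in> space ?N"
    have "norm (Hs r \<omega>) \<le> (\<Sum>k<n. norm (indicator {p k<..p (Suc k)} r *\<^sub>R \<xi> k \<omega>))"
      unfolding Hs_def step_integrand_def by (rule norm_sum)
    also have "\<dots> \<le> (\<Sum>k<n. norm (\<xi> k \<omega>))" by (intro sum_mono) (auto simp: indicator_def)
    also have "\<dots> \<le> (\<Sum>k<n. B k)" using \<xi>b[OF _ \<omega>] by (intro sum_mono) auto
    finally have "norm (Hs r \<omega> - \<sigma> r \<omega>) \<le> (\<Sum>k<n. B k) + R"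
      using norm_triangle_ineq4[of "Hs r \<omega>" "\<sigma> r \<omega>"] R[OF _ \<omega>, of r] r by (simp add: space_restrict_space)
    then have "(norm (Hs r \<omega> - \<sigma> r \<omega>))\<^sup>2 \<le> ((\<Sum>k<n. B k) + R)\<^sup>2" by (intro power_mono) auto
    then show "norm ((norm (Hs r \<omega> - \<sigma> r \<omega>))\<^sup>2) \<le> ((\<Sum>k<n. B k) + R)\<^sup>2" by simp
  qed
  show "integrable ?N (\<lambda>r. (norm (H r \<omega> - \<sigma> r \<omega>))\<^sup>2)" if \<omega>: "\<omega> \<in> space M" for \<omega>
    using int_s[OF \<omega>] integrable_cong_AE[OF f\<omega>[OF \<omega>] fs\<omega>[OF \<omega>] AE[OF \<omega>]] by simp
  have "(\<lambda>\<omega>. LINT r|?N. (norm (Hs r \<omega> - \<sigma> r \<omega>))\<^sup>2) \<in> borel_measurable M"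
    using N.borel_measurable_lebesgue_integral[OF fs] by simp
  then show "(\<lambda>\<omega>. LINT r|?N. (norm (H r \<omega> - \<sigma> r \<omega>))\<^sup>2) \<in> borel_measurable M"
    by (rule measurable_cong[THEN iffD1, rotated])
       (rule integral_cong_AE[OF f\<omega> fs\<omega> AE, symmetric])
qed

text \<open>
  The partition is clamped to \<open>[s,t]\<close> and the integrand projected to the ball of radius \<open>R\<close>, which
  contains \<open>\<sigma>\<close>: the projection moves the integrand closer to \<open>\<sigma>\<close>, by at most its distance from \<open>\<sigma>\<close>.
\<close>
lemma simple_integral_truncate:
  fixes \<sigma> H :: "real \<Rightarrow> 'a \<Rightarrow> real^'m^'d"
  assumes p: "p 0 = 0" "p n = T" "\<And>k. k < n \<Longrightarrow> p k < p (Suc k)"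
    and \<xi>m: "\<And>k. k < n \<Longrightarrow> \<xi> k \<in> borel_measurable (F (p k))"
    and \<xi>b: "\<And>k \<omega>. k < n \<Longrightarrow> \<omega> \<in> space M \<Longrightarrow> norm (\<xi> k \<omega>) \<le> B k"
    and H: "\<And>k r \<omega>. k < n \<Longrightarrow> r \<in> {p k<..p (Suc k)} \<Longrightarrow> \<omega> \<in> space M \<Longrightarrow> H r \<omega> = \<xi> k \<omega>"
    and J: "\<And>t \<omega>. t \<in> {0..T} \<Longrightarrow> \<omega> \<in> space M \<Longrightarrow>
       J t \<omega> = (\<Sum>k<n. \<xi> k \<omega> *v (W (min t (p (Suc k))) \<omega> - W (min t (p k)) \<omega>))"
    and prog: "progressive_on T F \<sigma>"
    and R: "\<And>r \<omega>. r \<in> {0..T} \<Longrightarrow> \<omega> \<in> space M \<Longrightarrow> norm (\<sigma> r \<omega>) \<le> R"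
    and ell: "\<And>r \<omega> y. r \<in> {0..T} \<Longrightarrow> \<omega> \<in> space M \<Longrightarrow> c * (norm y)\<^sup>2 \<le> (norm (y v* \<sigma> r \<omega>))\<^sup>2"
    and st: "0 \<le> s" "s \<le> t" "t \<le> T"
  defines "Z \<equiv> \<lambda>\<omega>. LINT r|restrict_space lborel {0..T}. (norm (H r \<omega> - \<sigma> r \<omega>))\<^sup>2"
  obtains q \<xi>' D R' where "admissible q \<xi>' n R" "q 0 = s" "q n = t" "admissible q D n R'"
    and "\<And>\<omega>. \<omega> \<in> space M \<Longrightarrow> J t \<omega> - J s \<omega> = transform q \<xi>' n \<omega> + transform q D n \<omega>"
    and "\<And>\<omega>. \<omega> \<in> space M \<Longrightarrow> (\<Sum>k<n. (norm (D k \<omega>))\<^sup>2 * (q (Suc k) - q k)) \<le> Z \<omega>"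
    and "\<And>\<omega> y \<theta>. \<omega> \<in> space M \<Longrightarrow> 0 < \<theta> \<Longrightarrow>
       (c * (t - s) - 2 * R * \<theta> * (t - s) - 2 * R / \<theta> * Z \<omega>) * (norm y)\<^sup>2
         \<le> (\<Sum>k<n. (norm (y v* \<xi>' k \<omega>))\<^sup>2 * (q (Suc k) - q k))"
proof -
  let ?N = "restrict_space lborel {0..T}"
  have T: "0 \<le> T" using st by simp
  have mono: "p k \<le> p (Suc k)" if "k < n" for k using p(3)[OF that] by simp
  have p_bounds: "0 \<le> p k" "p k \<le> T" if "k \<le> n" for k
    using partition_mono[of n p 0 k, OF mono] partition_mono[of n p k n, OF mono] p that by auto
  obtain \<omega>0 where \<omega>0: "\<omega>0 \<in> space M" using not_empty by blast
  have R0: "0 \<le> R" using R[of 0 \<omega>0] \<omega>0 T order_trans[OF norm_ge_zero] by auto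
  define q where "q k = min t (max s (p k))" for k
  \<comment> \<open>A step that starts after \<open>t\<close> is clamped to the point
    \<open>t\<close>, where \<open>\<xi> k\<close> need not be measurable yet. Its increment is 0,
    so the value may be set to 0.\<close>
  define \<xi>1 where "\<xi>1 k \<omega> = (if p k \<le> t then \<xi> k \<omega> else 0)" for k \<omega>
  define \<xi>' where "\<xi>' k \<omega> = closest_point (cball 0 R) (\<xi>1 k \<omega>)" for k \<omega>
  define D where "D k \<omega> = \<xi>1 k \<omega> - \<xi>' k \<omega>" for k \<omega>
  define R' where "R' = (\<Sum>k<n. \<bar>B k\<bar>) + R"
  have q: "q 0 = s" "q n = t" using p st by (auto simp: q_def)
  have qmono: "q k \<le> q (Suc k)" if "k < n" for k using mono[OF that] by (auto simp: q_def)
  have qb: "0 \<le> q k" "q k \<le> T" for k using st by (auto simp: q_def)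
  have \<xi>1m: "\<xi>1 k \<in> borel_measurable (F (q k))" if k: "k < n" for k
  proof (cases "p k \<le> t")
    case True
    then have "p k \<le> q k" by (auto simp: q_def)
    then show ?thesis
      using measurable_F_mono[OF \<xi>m[OF k] _ _ qb(2)] p_bounds[of k] k True by (simp add: \<xi>1_def[abs_def])
  qed (simp add: \<xi>1_def[abs_def])
  have \<xi>'m: "\<xi>' k \<in> borel_measurable (F (q k))" if k: "k < n" for k
    unfolding \<xi>'_def by (rule measurable_compose[OF \<xi>1m[OF k] closest_point_cball_measurable[OF R0]])
  have \<xi>'b: "norm (\<xi>' k \<omega>) \<le> R" for k \<omega>
    unfolding \<xi>'_def using closest_point_cball(1)[of 0 R] R0 by simp
  have adm: "admissible q \<xi>' n R"
    unfolding admissible_def using qb qmono \<xi>'m \<xi>'b by simp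
  have \<xi>1b: "norm (\<xi>1 k \<omega>) \<le> (\<Sum>k<n. \<bar>B k\<bar>)" if k: "k < n" and \<omega>: "\<omega> \<in> space M" for k \<omega>
  proof -
    have "norm (\<xi>1 k \<omega>) \<le> \<bar>B k\<bar>" using \<xi>b[OF k \<omega>] by (auto simp: \<xi>1_def)
    also have "\<dots> \<le> (\<Sum>k<n. \<bar>B k\<bar>)" using k by (intro member_le_sum) auto
    finally show ?thesis .
  qed
  have admD: "admissible q D n R'"
    unfolding admissible_def
  proof (intro conjI allI impI ballI)
    fix k assume k: "k < n"
    show "D k \<in> borel_measurable (F (q k))" unfolding D_def by (intro borel_measurable_diff \<xi>1m \<xi>'m k)
    fix \<omega> assume "\<omega> \<in> space M"
    then show "norm (D k \<omega>) \<le> R'"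
      unfolding D_def R'_def using norm_triangle_ineq4[of "\<xi>1 k \<omega>" "\<xi>' k \<omega>"] \<xi>1b[OF k, of \<omega>] \<xi>'b[of k \<omega>] by linarith
  qed (use qb qmono in auto)
  have Jeq: "J t \<omega> - J s \<omega> = transform q \<xi>' n \<omega> + transform q D n \<omega>" if \<omega>: "\<omega> \<in> space M" for \<omega>
  proof -
    have "J t \<omega> - J s \<omega> = (\<Sum>k<n. \<xi> k \<omega> *v (W (min t (p (Suc k))) \<omega> - W (min t (p k)) \<omega>)
        - \<xi> k \<omega> *v (W (min s (p (Suc k))) \<omega> - W (min s (p k)) \<omega>))"
      using J[of t \<omega>] J[of s \<omega>] \<omega> st by (simp add: sum_subtractf)
    also have "\<dots> = (\<Sum>k<n. \<xi>' k \<omega> *v (W (q (Suc k)) \<omega> - W (q k) \<omega>) + D k \<omega> *v (W (q (Suc k)) \<omega> - W (q k) \<omega>))"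
    proof (intro sum.cong refl)
      fix k assume k: "k \<in> {..<n}"
      \<comment> \<open>The summand \<open>W s \<omega>\<close> is common to both ends of a step and
        cancels, leaving the increment over the clamped step.\<close>
      have clamp: "W (min t x) \<omega> - W (min s x) \<omega> = W (min t (max s x)) \<omega> - W s \<omega>" for x
        using st by (auto simp: min_def max_def)
      have "\<xi> k \<omega> *v (W (min t (p (Suc k))) \<omega> - W (min t (p k)) \<omega>)
        - \<xi> k \<omega> *v (W (min s (p (Suc k))) \<omega> - W (min s (p k)) \<omega>)
        = \<xi> k \<omega> *v ((W (min t (p (Suc k))) \<omega> - W (min s (p (Suc k))) \<omega>) - (W (min t (p k)) \<omega> - W (min s (p k)) \<omega>))"
        by (simp add: matrix_vector_mult_diff_distrib)
      also have "\<dots> = \<xi> k \<omega> *v (W (q (Suc k)) \<omega> - W (q k) \<omega>)"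
        unfolding clamp q_def by simp
      also have "\<dots> = \<xi>1 k \<omega> *v (W (q (Suc k)) \<omega> - W (q k) \<omega>)"
      proof (cases "p k \<le> t")
        case False
        then have "q (Suc k) = q k" using mono[of k] k st by (auto simp: q_def)
        then show ?thesis by simp
      qed (simp add: \<xi>1_def)
      also have "\<xi>1 k \<omega> = \<xi>' k \<omega> + D k \<omega>" by (simp add: D_def)
      finally show "\<xi> k \<omega> *v (W (min t (p (Suc k))) \<omega> - W (min t (p k)) \<omega>)
        - \<xi> k \<omega> *v (W (min s (p (Suc k))) \<omega> - W (min s (p k)) \<omega>)
        = \<xi>' k \<omega> *v (W (q (Suc k)) \<omega> - W (q k) \<omega>) + D k \<omega> *v (W (q (Suc k)) \<omega> - W (q k) \<omega>)"
        by (simp add: matrix_vector_mult_add_rdistrib)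
    qed
    finally show ?thesis by (simp add: transform_def sum.distrib)
  qed
  have in_p: "r \<in> {p k<..p (Suc k)} \<and> p k \<le> t \<and> r \<in> {0..T}" if "k < n" "r \<in> {q k<..q (Suc k)}" for k r
    using that st by (auto simp: q_def min_def max_def split: if_splits)
  have \<xi>1H: "\<xi>1 k \<omega> = H r \<omega>" if "k < n" "r \<in> {q k<..q (Suc k)}" "\<omega> \<in> space M" for k r \<omega>
    using in_p[OF that(1,2)] H[of k r \<omega>] that by (simp add: \<xi>1_def)
  note int = simple_error(1)[OF T p measurable_F[OF \<xi>m] \<xi>b H prog R]
  have int_d: "integrable ?N (\<lambda>r. (norm (H r \<omega> - \<sigma> r \<omega>))\<^sup>2)" if "\<omega> \<in> space M" for \<omega>
    using that p_bounds by (intro int) auto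
  interpret N: finite_measure ?N by (rule finite_measure_restrict_lborel)
  have st_sets: "{s<..t} \<in> sets ?N"
    using st by (subst sets_restrict_space) (auto intro!: image_eqI[of _ _ "{s<..t}"])
  have meas_st: "measure ?N {s<..t} = t - s"
    using st by (subst measure_restrict_space) (auto simp: measure_def)
  have ind_le: "(LINT r|?N. indicator {s<..t} r * (norm (H r \<omega> - \<sigma> r \<omega>))\<^sup>2) \<le> Z \<omega>"
    and ind_int: "integrable ?N (\<lambda>r. indicator {s<..t} r * (norm (H r \<omega> - \<sigma> r \<omega>))\<^sup>2)"
    if \<omega>: "\<omega> \<in> space M" for \<omega>
  proof -
    show i: "integrable ?N (\<lambda>r. indicator {s<..t} r * (norm (H r \<omega> - \<sigma> r \<omega>))\<^sup>2)"
      using integrable_real_mult_indicator[OF st_sets int_d[OF \<omega>]] by (simp add: mult.commute)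
    show "(LINT r|?N. indicator {s<..t} r * (norm (H r \<omega> - \<sigma> r \<omega>))\<^sup>2) \<le> Z \<omega>"
      unfolding Z_def by (rule integral_mono[OF i int_d[OF \<omega>]]) (auto simp: indicator_def)
  qed
  show ?thesis
  proof (rule that[OF adm q admD Jeq])
    fix \<omega> assume \<omega>: "\<omega> \<in> space M"
    have "(\<Sum>k<n. (norm (D k \<omega>))\<^sup>2 * (q (Suc k) - q k)) \<le> (LINT r|?N. indicator {q 0<..q n} r * (norm (H r \<omega> - \<sigma> r \<omega>))\<^sup>2)"
    proof (rule partition_sum_le_integral[where q=q and n=n and T=T, OF int_d[OF \<omega>] qb(1) qb(2) qmono])
      fix k r assume k: "k < n" and r: "r \<in> {q k<..q (Suc k)}"
      have "norm (\<sigma> r \<omega>) \<le> R" using in_p[OF k r] R \<omega> by blast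
      from closest_point_cball(2)[OF this, of "\<xi>1 k \<omega>"]
      show "(norm (D k \<omega>))\<^sup>2 \<le> (norm (H r \<omega> - \<sigma> r \<omega>))\<^sup>2"
        unfolding D_def \<xi>'_def using \<xi>1H[OF k r \<omega>] by (intro power_mono) auto
    qed
    then show "(\<Sum>k<n. (norm (D k \<omega>))\<^sup>2 * (q (Suc k) - q k)) \<le> Z \<omega>"
      using ind_le[OF \<omega>] unfolding q by linarith
  next
    fix \<omega> and y :: "real^'d" and \<theta> :: real assume \<omega>: "\<omega> \<in> space M" and \<theta>: "0 < \<theta>"
    \<comment> \<open>The bound is proved for the negated sum. On each step
      \<open>|y v* \<xi>'|^2\<close> falls short of \<open>|y v* \<sigma>|^2\<close> by at most
      \<open>2 R |y|^2 x\<close>, where \<open>x\<close> is the distance of \<open>H\<close> from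
      \<open>\<sigma>\<close>. Only the mean square of \<open>x\<close> is controlled, hence
      \<open>x \<le> \<theta> + x^2 / \<theta>\<close>.\<close>
    define a where "a = - c * (norm y)\<^sup>2 + 2 * R * (norm y)\<^sup>2 * \<theta>"
    define b where "b = 2 * R * (norm y)\<^sup>2 / \<theta>"
    have b: "0 \<le> b" using R0 \<theta> by (simp add: b_def)
    have "(\<Sum>k<n. - (norm (y v* \<xi>' k \<omega>))\<^sup>2 * (q (Suc k) - q k))
      \<le> (LINT r|?N. indicator {q 0<..q n} r * (a + b * (norm (H r \<omega> - \<sigma> r \<omega>))\<^sup>2))"
    proof (rule partition_sum_le_integral[where q=q and n=n and T=T, OF _ qb(1) qb(2) qmono])
      show "integrable ?N (\<lambda>r. a + b * (norm (H r \<omega> - \<sigma> r \<omega>))\<^sup>2)"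
        using int_d[OF \<omega>] by simp
      fix k r assume k: "k < n" and r: "r \<in> {q k<..q (Suc k)}"
      have rT: "r \<in> {0..T}" using in_p[OF k r] by blast
      have \<sigma>R: "norm (\<sigma> r \<omega>) \<le> R" using rT R \<omega> by blast
      define x where "x = norm (H r \<omega> - \<sigma> r \<omega>)"
      have d: "norm (\<xi>' k \<omega> - \<sigma> r \<omega>) \<le> x"
        unfolding \<xi>'_def x_def using closest_point_cball(3)[OF \<sigma>R, of "\<xi>1 k \<omega>"] \<xi>1H[OF k r \<omega>] by simp
      define u where "u = norm (y v* \<sigma> r \<omega>)"
      define v where "v = norm (y v* \<xi>' k \<omega>)"
      have uv: "u - v \<le> norm y * x"
      proof -
        have "u - v \<le> norm (y v* \<sigma> r \<omega> - y v* \<xi>' k \<omega>)" unfolding u_def v_def by (rule norm_triangle_ineq2)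
        also have "y v* \<sigma> r \<omega> - y v* \<xi>' k \<omega> = y v* (\<sigma> r \<omega> - \<xi>' k \<omega>)"
          by (rule bounded_bilinear.diff_right[OF bounded_bilinear_vector_matrix_mult, symmetric])
        also have "norm \<dots> \<le> norm y * norm (\<sigma> r \<omega> - \<xi>' k \<omega>)" by (rule norm_vector_matrix_mult_le)
        also have "\<dots> \<le> norm y * x" using d by (intro mult_left_mono) (auto simp: norm_minus_commute)
        finally show ?thesis .
      qed
      have uR: "0 \<le> u" "u \<le> norm y * R" and vR: "0 \<le> v" "v \<le> norm y * R"
        using norm_vector_matrix_mult_le[of y "\<sigma> r \<omega>"] norm_vector_matrix_mult_le[of y "\<xi>' k \<omega>"]
          mult_left_mono[OF \<sigma>R, of "norm y"] mult_left_mono[OF \<xi>'b[of k \<omega>], of "norm y"]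
        unfolding u_def v_def by auto
      have x0: "0 \<le> x" by (simp add: x_def)
      have "u\<^sup>2 - v\<^sup>2 = (u - v) * (u + v)" by (simp add: power2_eq_square algebra_simps)
      also have "\<dots> \<le> (norm y * x) * (2 * (norm y * R))"
        using uv uR vR x0 R0 by (intro mult_mono) auto
      also have "\<dots> = 2 * R * (norm y)\<^sup>2 * x" by (simp add: power2_eq_square)
      also have "\<dots> \<le> 2 * R * (norm y)\<^sup>2 * (\<theta> + x\<^sup>2 / \<theta>)"
      proof (intro mult_left_mono)
        show "x \<le> \<theta> + x\<^sup>2 / \<theta>"
        proof (cases "x \<le> \<theta>")
          case False
          then have "x * \<theta> \<le> x\<^sup>2" using x0 by (simp add: power2_eq_square mult_left_mono)
          then have "x \<le> x\<^sup>2 / \<theta>" using \<theta> by (simp add: field_simps)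
          then show ?thesis using \<theta> by simp
        qed (use \<theta> in \<open>simp add: add_increasing2\<close>)
      qed (use R0 in auto)
      finally have "u\<^sup>2 - v\<^sup>2 \<le> 2 * R * (norm y)\<^sup>2 * \<theta> + b * x\<^sup>2"
        by (simp add: b_def algebra_simps)
      moreover have "c * (norm y)\<^sup>2 \<le> u\<^sup>2" unfolding u_def by (rule ell[OF rT \<omega>])
      ultimately show "- (norm (y v* \<xi>' k \<omega>))\<^sup>2 \<le> a + b * (norm (H r \<omega> - \<sigma> r \<omega>))\<^sup>2"
        by (simp add: a_def v_def x_def)
    qed
    also have "\<dots> = (LINT r|?N. indicator {s<..t} r * a + b * (indicator {s<..t} r * (norm (H r \<omega> - \<sigma> r \<omega>))\<^sup>2))"
      unfolding q by (intro Bochner_Integration.integral_cong refl) (simp add: algebra_simps)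
    also have "\<dots> = (LINT r|?N. indicator {s<..t} r * a) + (LINT r|?N. b * (indicator {s<..t} r * (norm (H r \<omega> - \<sigma> r \<omega>))\<^sup>2))"
      using ind_int[OF \<omega>] st_sets
      by (intro Bochner_Integration.integral_add integrable_mult_left integrable_mult_right)
         (auto intro!: integrable_real_indicator simp: N.emeasure_finite less_top[symmetric])
    also have "\<dots> = (t - s) * a + b * (LINT r|?N. indicator {s<..t} r * (norm (H r \<omega> - \<sigma> r \<omega>))\<^sup>2)"
      using meas_st sets.sets_into_space[OF st_sets] by (simp add: Int_absorb2)
    also have "\<dots> \<le> (t - s) * a + b * Z \<omega>"
      using ind_le[OF \<omega>] b by (intro add_left_mono mult_left_mono) auto
    finally have "- (\<Sum>k<n. (norm (y v* \<xi>' k \<omega>))\<^sup>2 * (q (Suc k) - q k)) \<le> (t - s) * a + b * Z \<omega>"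
      by (simp add: sum_negf)
    moreover have "(t - s) * a + b * Z \<omega> = - ((c * (t - s) - 2 * R * \<theta> * (t - s) - 2 * R / \<theta> * Z \<omega>) * (norm y)\<^sup>2)"
      by (simp add: a_def b_def algebra_simps)
    ultimately show "(c * (t - s) - 2 * R * \<theta> * (t - s) - 2 * R / \<theta> * Z \<omega>) * (norm y)\<^sup>2
         \<le> (\<Sum>k<n. (norm (y v* \<xi>' k \<omega>))\<^sup>2 * (q (Suc k) - q k))" by linarith
  qed
qed

text \<open>The only passage from the Ito integral to discrete ones. The approximating integrals
  supplied by the definition have bounds that may grow along the sequence; after truncation the
  bound is \<open>R\<close>, so the moment estimates do not depend on \<open>\<kappa>\<close>, and
  ellipticity survives up to \<open>\<kappa>\<close>.\<close>

lemma ito_integral_approx: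
  fixes \<sigma> :: "real \<Rightarrow> 'a \<Rightarrow> real^'m^'d"
  assumes ito: "ito_integral M T F \<sigma> W I" and prog: "progressive_on T F \<sigma>"
    and R: "\<And>r \<omega>. r \<in> {0..T} \<Longrightarrow> \<omega> \<in> space M \<Longrightarrow> norm (\<sigma> r \<omega>) \<le> R"
    and ell: "\<And>r \<omega> y. r \<in> {0..T} \<Longrightarrow> \<omega> \<in> space M \<Longrightarrow> c * (norm y)\<^sup>2 \<le> (norm (y v* \<sigma> r \<omega>))\<^sup>2"
    and st: "0 \<le> s" "s \<le> t" "t \<le> T" and \<kappa>: "0 < \<kappa>"
  obtains n q \<xi> \<Gamma> where "admissible q \<xi> n R" "q 0 = s" "q n = t" "\<Gamma> \<in> sets M" "prob (space M - \<Gamma>) \<le> \<kappa>"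
    and "\<And>\<omega>. \<omega> \<in> \<Gamma> \<Longrightarrow> norm (transform q \<xi> n \<omega> - (I t \<omega> - I s \<omega>)) \<le> \<kappa>"
    and "\<And>\<omega> y. \<omega> \<in> \<Gamma> \<Longrightarrow> (c * (t - s) - \<kappa>) * (norm y)\<^sup>2 \<le> (\<Sum>k<n. (norm (y v* \<xi> k \<omega>))\<^sup>2 * (q (Suc k) - q k))"
proof -
  let ?N = "restrict_space lborel {0..T}"
  have T: "0 \<le> T" using st by simp
  obtain \<omega>0 where \<omega>0: "\<omega>0 \<in> space M" using not_empty by blast
  have R0: "0 \<le> R" using R[of 0 \<omega>0] \<omega>0 T order_trans[OF norm_ge_zero] by auto
  obtain HH JJ where simple: "\<And>N. simple_integrand M T F (HH N) W (JJ N)"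
    and Hlim: "tendsto_zero_in_prob M (\<lambda>N \<omega>. LINT r|?N. (norm (HH N r \<omega> - \<sigma> r \<omega>))\<^sup>2)"
    and Jlim: "tendsto_zero_in_prob M (\<lambda>N \<omega>. Sup ((\<lambda>t. norm (JJ N t \<omega> - I t \<omega>)) ` {0..T}))"
    using ito unfolding ito_integral_def by blast
  have Icont: "\<And>\<omega>. \<omega> \<in> space M \<Longrightarrow> continuous_on {0..T} (\<lambda>t. I t \<omega>)"
    and IF: "\<And>t. t \<in> {0..T} \<Longrightarrow> I t \<in> borel_measurable (F t)"
    using ito by (auto simp: ito_integral_def continuous_paths_def adapted_on_def)
  have Im: "I t \<in> borel_measurable M" if "t \<in> {0..T}" for t
    using measurable_F[OF IF[OF that]] that by simp
  \<comment> \<open>\<open>\<theta>\<close> makes \<open>2 R \<theta> (t - s)\<close> at most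
    \<open>\<kappa> / 2\<close>. The two entries of \<delta> keep
    \<open>\<delta> / (\<kappa> / 2)^2\<close> at most \<open>\<kappa> / 4\<close> and
    \<open>2 R \<delta> / \<theta>\<close> at most \<open>\<kappa> / 2\<close>. \<open>R + 1\<close>
    and \<open>T + 1\<close> avoid a division by 0.\<close>
  define \<theta> where "\<theta> = \<kappa> / (4 * (R + 1) * (T + 1))"
  have \<theta>: "0 < \<theta>" using \<kappa> R0 T by (simp add: \<theta>_def)
  define \<delta> where "\<delta> = min (\<kappa> ^ 3 / 16) (\<kappa> * \<theta> / (4 * (R + 1)))"
  have \<delta>: "0 < \<delta>" using \<kappa> R0 \<theta> by (simp add: \<delta>_def)
  have L1: "(\<lambda>N. prob {\<omega> \<in> space M. \<bar>LINT r|?N. (norm (HH N r \<omega> - \<sigma> r \<omega>))\<^sup>2\<bar> > \<delta>}) \<longlonglongrightarrow> 0"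
    and L2: "(\<lambda>N. prob {\<omega> \<in> space M. \<bar>Sup ((\<lambda>t. norm (JJ N t \<omega> - I t \<omega>)) ` {0..T})\<bar> > \<kappa> / 4}) \<longlonglongrightarrow> 0"
    using Hlim[unfolded tendsto_zero_in_prob_def, rule_format, of \<delta>]
      Jlim[unfolded tendsto_zero_in_prob_def, rule_format, of "\<kappa> / 4"] \<delta> \<kappa> by simp_all
  have "eventually (\<lambda>N. prob {\<omega> \<in> space M. \<bar>LINT r|?N. (norm (HH N r \<omega> - \<sigma> r \<omega>))\<^sup>2\<bar> > \<delta>} < \<kappa> / 4) sequentially"
    and "eventually (\<lambda>N. prob {\<omega> \<in> space M. \<bar>Sup ((\<lambda>t. norm (JJ N t \<omega> - I t \<omega>)) ` {0..T})\<bar> > \<kappa> / 4} < \<kappa> / 4) sequentially"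
    by (rule order_tendstoD(2)[OF L1], use \<kappa> in simp) (rule order_tendstoD(2)[OF L2], use \<kappa> in simp)
  then obtain N where NH: "prob {\<omega> \<in> space M. \<bar>LINT r|?N. (norm (HH N r \<omega> - \<sigma> r \<omega>))\<^sup>2\<bar> > \<delta>} < \<kappa> / 4"
    and NJ: "prob {\<omega> \<in> space M. \<bar>Sup ((\<lambda>t. norm (JJ N t \<omega> - I t \<omega>)) ` {0..T})\<bar> > \<kappa> / 4} < \<kappa> / 4"
    using eventually_happens[OF eventually_conj] sequentially_bot by blast
  define H where "H = HH N"
  define J where "J = JJ N"
  define Z where "Z \<omega> = (LINT r|?N. (norm (H r \<omega> - \<sigma> r \<omega>))\<^sup>2)" for \<omega>
  obtain n p \<xi> where p0: "p 0 = 0" "p n = T" "\<forall>k<n. p k < p (Suc k)"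
    and \<xi>0: "\<forall>k<n. \<xi> k \<in> borel_measurable (F (p k)) \<and> (\<exists>C. \<forall>\<omega>\<in>space M. norm (\<xi> k \<omega>) \<le> C)"
    and H0: "\<forall>k<n. \<forall>s\<in>{p k<..p (Suc k)}. \<forall>\<omega>\<in>space M. H s \<omega> = \<xi> k \<omega>"
    and J0: "\<forall>t\<in>{0..T}. \<forall>\<omega>\<in>space M.
       J t \<omega> = (\<Sum>k<n. \<xi> k \<omega> *v (W (min t (p (Suc k))) \<omega> - W (min t (p k)) \<omega>))"
    using simple[of N] unfolding simple_integrand_def H_def[symmetric] J_def[symmetric]
    by (elim exE conjE) (rule that; assumption)
  have p: "p 0 = 0" "p n = T" "\<And>k. k < n \<Longrightarrow> p k < p (Suc k)" using p0 by auto
  have \<xi>m: "\<xi> k \<in> borel_measurable (F (p k))" and \<xi>ex: "\<exists>C. \<forall>\<omega>\<in>space M. norm (\<xi> k \<omega>) \<le> C" if "k < n" for k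
    using \<xi>0 that by blast+
  have Heq: "H r \<omega> = \<xi> k \<omega>" if "k < n" "r \<in> {p k<..p (Suc k)}" "\<omega> \<in> space M" for k r \<omega>
    using H0 that by blast
  have Jeq: "J t \<omega> = (\<Sum>k<n. \<xi> k \<omega> *v (W (min t (p (Suc k))) \<omega> - W (min t (p k)) \<omega>))"
    if "t \<in> {0..T}" "\<omega> \<in> space M" for t \<omega>
    using J0 that by blast
  define B where "B k = (SOME C. \<forall>\<omega>\<in>space M. norm (\<xi> k \<omega>) \<le> C)" for k
  have \<xi>b: "norm (\<xi> k \<omega>) \<le> B k" if "k < n" "\<omega> \<in> space M" for k \<omega>
    using someI_ex[OF \<xi>ex[OF that(1)]] that(2) by (simp add: B_def)
  have mono: "p k \<le> p (Suc k)" if "k < n" for k using p(3)[OF that] by simp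
  have p_bounds: "0 \<le> p k" "p k \<le> T" if "k \<le> n" for k
    using partition_mono[of n p 0 k, OF mono] partition_mono[of n p k n, OF mono] p that by auto
  have \<xi>M: "\<xi> k \<in> borel_measurable M" if "k < n" for k
    using measurable_F[OF \<xi>m[OF that]] p_bounds[of k] that by simp
  have Zm[measurable]: "Z \<in> borel_measurable M"
    using simple_error(2)[OF T p \<xi>M \<xi>b Heq prog R] by (simp add: Z_def[abs_def])
  have Z0: "0 \<le> Z \<omega>" for \<omega> by (simp add: Z_def)
  have W_cont: "continuous_on {0..T} (\<lambda>t. W t \<omega>)" if "\<omega> \<in> space M" for \<omega>
    using brownian_motion that by (auto simp: brownian_motion_on_def continuous_paths_def)
  have Jcont: "continuous_on {0..T} (\<lambda>t. J t \<omega>)" if \<omega>: "\<omega> \<in> space M" for \<omega>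
  proof -
    have "continuous_on {0..T} (\<lambda>t. W (min t x) \<omega>)" if "0 \<le> x" for x
      using that T by (intro continuous_on_compose2[OF W_cont[OF \<omega>]] continuous_intros) auto
    then have "continuous_on {0..T} (\<lambda>t. \<Sum>k<n. \<xi> k \<omega> *v (W (min t (p (Suc k))) \<omega> - W (min t (p k)) \<omega>))"
      using p_bounds
      by (intro continuous_on_sum bounded_linear.continuous_on[OF matrix_vector_mul_bounded_linear] continuous_on_diff) auto
    then show ?thesis
      by (rule continuous_on_cong[THEN iffD2, OF refl, rotated]) (rule Jeq[OF _ \<omega>])
  qed
  have Jm: "J t \<in> borel_measurable M" if t: "t \<in> {0..T}" for t
  proof -
    have "(\<lambda>\<omega>. \<Sum>k<n. \<xi> k \<omega> *v (W (min t (p (Suc k))) \<omega> - W (min t (p k)) \<omega>)) \<in> borel_measurable M"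
      using t p_bounds
      by (intro borel_measurable_sum borel_measurable_matrix_vector_mult borel_measurable_diff W_measurable \<xi>M) auto
    then show ?thesis by (rule measurable_cong[THEN iffD2, rotated]) (rule Jeq[OF t])
  qed
  \<comment> \<open>The budget: probabilities \<open>\<kappa> / 4\<close>,
    \<open>\<kappa> / 4\<close>, \<open>\<kappa> / 2\<close> for \<open>E1\<close>,
    \<open>E2\<close>, \<open>E3\<close>, and distances \<open>\<kappa> / 4\<close> at each of
    \<open>s\<close> and \<open>t\<close> and \<open>\<kappa> / 2\<close> for the cut-off part
    \<open>D\<close>.\<close>
  define E1 where "E1 = {\<omega> \<in> space M. \<bar>Sup ((\<lambda>t. norm (J t \<omega> - I t \<omega>)) ` {0..T})\<bar> > \<kappa> / 4}"
  define E2 where "E2 = {\<omega> \<in> space M. Z \<omega> > \<delta>}"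
  have E1: "E1 \<in> sets M" "prob E1 \<le> \<kappa> / 4"
  proof -
    show "E1 \<in> sets M"
      unfolding E1_def using \<kappa>
      by (intro Sup_norm_measurable T continuous_on_diff Jcont Icont borel_measurable_diff Jm Im) auto
    show "prob E1 \<le> \<kappa> / 4" unfolding E1_def J_def by (rule less_imp_le[OF NJ])
  qed
  have E2: "E2 \<in> sets M" "prob E2 \<le> \<kappa> / 4"
  proof -
    show "E2 \<in> sets M" unfolding E2_def by measurable
    have "E2 = {\<omega> \<in> space M. \<bar>LINT r|?N. (norm (HH N r \<omega> - \<sigma> r \<omega>))\<^sup>2\<bar> > \<delta>}"
      unfolding E2_def Z_def H_def by simp
    then show "prob E2 \<le> \<kappa> / 4" using NH by simp
  qed
  obtain q \<xi>' D R' where adm: "admissible q \<xi>' n R" and q: "q 0 = s" "q n = t" and admD: "admissible q D n R'"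
    and Jinc: "\<And>\<omega>. \<omega> \<in> space M \<Longrightarrow> J t \<omega> - J s \<omega> = transform q \<xi>' n \<omega> + transform q D n \<omega>"
    and DZ: "\<And>\<omega>. \<omega> \<in> space M \<Longrightarrow> (\<Sum>k<n. (norm (D k \<omega>))\<^sup>2 * (q (Suc k) - q k)) \<le> Z \<omega>"
    and lower: "\<And>\<omega> y \<theta>. \<omega> \<in> space M \<Longrightarrow> 0 < \<theta> \<Longrightarrow>
       (c * (t - s) - 2 * R * \<theta> * (t - s) - 2 * R / \<theta> * Z \<omega>) * (norm y)\<^sup>2
         \<le> (\<Sum>k<n. (norm (y v* \<xi>' k \<omega>))\<^sup>2 * (q (Suc k) - q k))"
    unfolding Z_def
  proof (rule simple_integral_truncate[where p=p and n=n and \<xi>=\<xi> and B=B and H=H and J=J and \<sigma>=\<sigma> and R=R and c=c and s=s and t=t])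
    show "p 0 = 0" "p n = T" "progressive_on T F \<sigma>" "0 \<le> s" "s \<le> t" "t \<le> T" by fact+
  qed (use p(3) \<xi>m \<xi>b Heq Jeq R ell in blast)+
  note [measurable] = transform_measurable_M[OF admD]
  define E3 where "E3 = {\<omega> \<in> space M. norm (transform q D n \<omega>) > \<kappa> / 2}"
  have E3s: "E3 \<in> sets M" unfolding E3_def by measurable
  have E3: "prob E3 \<le> \<kappa> / 2"
  proof -
    \<comment> \<open>The quadratic variation of \<open>D\<close> is at most \<open>Z\<close>, so
      the exceptional event in Lenglart's inequality lies in \<open>E2\<close>.\<close>
    have "prob E3 \<le> prob {\<omega> \<in> space M. (\<Sum>k<n. (norm (D k \<omega>))\<^sup>2 * (q (Suc k) - q k)) > \<delta>} + \<delta> / (\<kappa> / 2)\<^sup>2"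
      unfolding E3_def using \<kappa> \<delta> by (intro transform_prob_le[OF admD]) auto
    also have "\<dots> \<le> prob E2 + \<kappa> / 4"
    proof (intro add_mono finite_measure_mono)
      show "{\<omega> \<in> space M. (\<Sum>k<n. (norm (D k \<omega>))\<^sup>2 * (q (Suc k) - q k)) > \<delta>} \<subseteq> E2"
        unfolding E2_def using DZ by (auto intro: less_le_trans)
      have "\<delta> / (\<kappa> / 2)\<^sup>2 \<le> (\<kappa> ^ 3 / 16) / (\<kappa> / 2)\<^sup>2"
        unfolding \<delta>_def by (intro divide_right_mono min.cobounded1) simp
      also have "\<dots> = \<kappa> / 4" using \<kappa> by (simp add: power2_eq_square power3_eq_cube field_simps)
      finally show "\<delta> / (\<kappa> / 2)\<^sup>2 \<le> \<kappa> / 4" .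
    qed (rule E2(1))
    finally show ?thesis using E2(2) by simp
  qed
  show ?thesis
  proof (rule that[OF adm q, of "space M - (E1 \<union> E2 \<union> E3)"])
    show "space M - (E1 \<union> E2 \<union> E3) \<in> sets M" using E1 E2 E3s by auto
    have sub: "E1 \<union> E2 \<union> E3 \<subseteq> space M" by (auto simp: E1_def E2_def E3_def)
    have "prob (E1 \<union> E2 \<union> E3) \<le> prob E1 + prob E2 + prob E3"
      using measure_Un_le[of "E1 \<union> E2" M E3] measure_Un_le[of E1 M E2] E1(1) E2(1) E3s by auto
    also have "\<dots> \<le> \<kappa>" using E1(2) E2(2) E3 by simp
    finally show "prob (space M - (space M - (E1 \<union> E2 \<union> E3))) \<le> \<kappa>"
      using sub by (simp add: double_diff)
    fix \<omega> assume "\<omega> \<in> space M - (E1 \<union> E2 \<union> E3)"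
    then have \<omega>: "\<omega> \<in> space M" and n1: "\<bar>Sup ((\<lambda>t. norm (J t \<omega> - I t \<omega>)) ` {0..T})\<bar> \<le> \<kappa> / 4"
      and n2: "Z \<omega> \<le> \<delta>" and n3: "norm (transform q D n \<omega>) \<le> \<kappa> / 2"
      by (auto simp: E1_def E2_def E3_def)
    have near: "norm (J r \<omega> - I r \<omega>) \<le> \<kappa> / 4" if "r \<in> {0..T}" for r
      using norm_le_Sup_norm[of T "\<lambda>t. J t \<omega> - I t \<omega>" r] continuous_on_diff[OF Jcont[OF \<omega>] Icont[OF \<omega>]] that n1 by linarith
    have "transform q \<xi>' n \<omega> - (I t \<omega> - I s \<omega>) = (J t \<omega> - I t \<omega>) - (J s \<omega> - I s \<omega>) - transform q D n \<omega>"
      using Jinc[OF \<omega>] by (simp add: algebra_simps)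
    also have "norm \<dots> \<le> norm (J t \<omega> - I t \<omega>) + norm (J s \<omega> - I s \<omega>) + norm (transform q D n \<omega>)"
      by (meson norm_triangle_ineq4 order_trans add_right_mono)
    also have "\<dots> \<le> \<kappa>" using near[of t] near[of s] n3 st by simp
    finally show "norm (transform q \<xi>' n \<omega> - (I t \<omega> - I s \<omega>)) \<le> \<kappa>" .
    fix y :: "real^'d"
    have "2 * R * \<theta> * (t - s) \<le> \<kappa> / 2"
    proof -
      have "2 * R * \<theta> * (t - s) \<le> 2 * (R + 1) * \<theta> * (T + 1)"
        using R0 \<theta> st by (intro mult_mono) auto
      also have "\<dots> = \<kappa> / 2"
      proof -
        have "2 * A * (\<kappa> / (4 * A * B)) * B = \<kappa> / 2" if "0 < A" "0 < B" for A B
          using that by (simp add: field_simps)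
        from this[of "R + 1" "T + 1"] show ?thesis unfolding \<theta>_def using R0 T by linarith
      qed
      finally show ?thesis .
    qed
    moreover have "2 * R / \<theta> * Z \<omega> \<le> \<kappa> / 2"
    proof -
      have "2 * R / \<theta> * Z \<omega> \<le> 2 * (R + 1) / \<theta> * (\<kappa> * \<theta> / (4 * (R + 1)))"
        using R0 \<theta> Z0 order_trans[OF n2[unfolded \<delta>_def] min.cobounded2] by (intro mult_mono divide_right_mono) auto
      also have "\<dots> = \<kappa> / 2"
      proof -
        have "2 * A / \<theta> * (\<kappa> * \<theta> / (4 * A)) = \<kappa> / 2" if "0 < A" for A
          using that \<theta> by (simp add: field_simps)
        from this[of "R + 1"] show ?thesis using R0 by linarith
      qed
      finally show ?thesis .
    qed
    ultimately have "(c * (t - s) - \<kappa>) * (norm y)\<^sup>2 \<le> (c * (t - s) - 2 * R * \<theta> * (t - s) - 2 * R / \<theta> * Z \<omega>) * (norm y)\<^sup>2"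
      by (intro mult_right_mono) auto
    also have "\<dots> \<le> (\<Sum>k<n. (norm (y v* \<xi>' k \<omega>))\<^sup>2 * (q (Suc k) - q k))"
      by (rule lower[OF \<omega> \<theta>])
    finally show "(c * (t - s) - \<kappa>) * (norm y)\<^sup>2 \<le> (\<Sum>k<n. (norm (y v* \<xi>' k \<omega>))\<^sup>2 * (q (Suc k) - q k))" .
  qed
qed

end

section \<open>Staying in a tube with positive conditional probability\<close>

text \<open>The inequality \<open>L \<phi> \<ge> - l \<phi>\<close> divided by \<open>u\<close>: the
  expression is a complete square over \<open>48 c \<epsilon>^2\<close>.\<close>

lemma quadratic_drift_bound:
  fixes u \<epsilon> :: real
  assumes "0 < \<epsilon>" "0 < c"
  shows "0 \<le> 12 * c * \<epsilon>\<^sup>2 - b * u + b\<^sup>2 / (48 * c * \<epsilon>\<^sup>2) * u\<^sup>2"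
proof -
  define a where "a = 12 * c * \<epsilon>\<^sup>2"
  have a: "0 < a" using assms by (simp add: a_def)
  have a4: "48 * c * \<epsilon>\<^sup>2 = 4 * a" by (simp add: a_def)
  have "a - b * u + b\<^sup>2 / (4 * a) * u\<^sup>2 = (2 * a - b * u)\<^sup>2 / (4 * a)"
    using a by (simp add: power2_eq_square field_simps)
  also have "\<dots> \<ge> 0" using a by simp
  finally show ?thesis unfolding a4 by (simp add: a_def)
qed

text \<open>The process \<open>X\<close> does not occur: the tube estimate applies to every adapted
  process whose increments differ from those of \<open>I\<close> by a Lipschitz drift.\<close>

locale elliptic_integral = brownian M T F W
  for M :: "'a measure" and T F and W :: "real \<Rightarrow> 'a \<Rightarrow> real^'m" +
  fixes \<sigma> :: "real \<Rightarrow> 'a \<Rightarrow> real^'m^'d" and I :: "real \<Rightarrow> 'a \<Rightarrow> real^'d" and R c :: real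
  assumes ito: "ito_integral M T F \<sigma> W I" and progressive: "progressive_on T F \<sigma>"
    and norm_\<sigma>_le: "\<And>r \<omega>. r \<in> {0..T} \<Longrightarrow> \<omega> \<in> space M \<Longrightarrow> norm (\<sigma> r \<omega>) \<le> R"
    and c_pos: "0 < c"
    and elliptic: "\<And>r \<omega> y. r \<in> {0..T} \<Longrightarrow> \<omega> \<in> space M \<Longrightarrow> c * (norm y)\<^sup>2 \<le> (norm (y v* \<sigma> r \<omega>))\<^sup>2"
begin

lemma I_adapted: "0 \<le> t \<Longrightarrow> t \<le> T \<Longrightarrow> I t \<in> borel_measurable (F t)"
  using ito by (auto simp: ito_integral_def adapted_on_def)

lemma I_measurable: "0 \<le> t \<Longrightarrow> t \<le> T \<Longrightarrow> I t \<in> borel_measurable M"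
  using measurable_F[OF I_adapted] by blast

text \<open>One step with the approximation error \<open>\<kappa>\<close> still visible. Its factor
  collects the Lipschitz constant \<open>6 \<epsilon>^5\<close> on the good event, the bound
  \<open>\<epsilon>^6\<close> of the bump off it, and the loss in the elliptic term. The event
  \<open>A\<close> of \<open>F s\<close> replaces conditioning on \<open>F s\<close> and carries the
  killing.\<close>

lemma bump_step_approx:
  fixes y \<beta> :: "'a \<Rightarrow> real^'d"
  assumes \<epsilon>: "0 < \<epsilon>" and K: "0 \<le> K"
    and C: "0 \<le> C"
    and taylor: "\<And>(y::real^'d) \<beta> \<zeta>. norm y \<le> \<epsilon> \<Longrightarrow> norm \<beta> \<le> K * h \<Longrightarrow>
      (\<epsilon>\<^sup>2 - (norm y)\<^sup>2) ^ 3 - 6 * \<epsilon> * K * h * (\<epsilon>\<^sup>2 - (norm y)\<^sup>2)\<^sup>2 - 6 * (\<epsilon>\<^sup>2 - (norm y)\<^sup>2)\<^sup>2 * (y \<bullet> \<zeta>)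
      - 3 * (\<epsilon>\<^sup>2 - (norm y)\<^sup>2)\<^sup>2 * (norm \<zeta>)\<^sup>2 + 12 * (\<epsilon>\<^sup>2 - (norm y)\<^sup>2) * (y \<bullet> \<zeta>)\<^sup>2
      - C * (h * sqrt h + norm \<zeta> ^ 4 / sqrt h) \<le> bump \<epsilon> (y + \<beta> + \<zeta>)"
    and s: "0 \<le> s" and h: "0 < h" "h \<le> 1" "s + h \<le> T"
    and y: "y \<in> borel_measurable (F s)" and \<beta>: "\<beta> \<in> borel_measurable M"
    and \<beta>K: "\<And>\<omega>. \<omega> \<in> space M \<Longrightarrow> norm (\<beta> \<omega>) \<le> K * h"
    and A: "A \<in> sets (F s)" and yA: "\<And>\<omega>. \<omega> \<in> A \<Longrightarrow> norm (y \<omega>) < \<epsilon>"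
    and \<kappa>: "0 < \<kappa>"
  shows "(1 - (6 * \<epsilon> * K + 3 * R\<^sup>2 + 12 * c)\<^sup>2 / (48 * c * \<epsilon>\<^sup>2) * h) * expectation (\<lambda>\<omega>. indicator A \<omega> * bump \<epsilon> (y \<omega>))
      - C * (1 + 9 * (real CARD('m))\<^sup>2 * R ^ 4) * (h * sqrt h) - \<kappa> * (6 * \<epsilon> ^ 5 + \<epsilon> ^ 6 + 12 * \<epsilon> ^ 4 * (1 + c))
    \<le> expectation (\<lambda>\<omega>. indicator A \<omega> * bump \<epsilon> (y \<omega> + \<beta> \<omega> + (I (s + h) \<omega> - I s \<omega>)))"
proof -
  have sT: "s \<le> T" "s \<le> s + h" using h by auto
  obtain n q \<xi> \<Gamma> where adm: "admissible q \<xi> n R" and q: "q 0 = s" "q n = s + h"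
    and \<Gamma>: "\<Gamma> \<in> sets M" "prob (space M - \<Gamma>) \<le> \<kappa>"
    and near: "\<And>\<omega>. \<omega> \<in> \<Gamma> \<Longrightarrow> norm (transform q \<xi> n \<omega> - (I (s + h) \<omega> - I s \<omega>)) \<le> \<kappa>"
    and low: "\<And>\<omega> y. \<omega> \<in> \<Gamma> \<Longrightarrow> (c * (s + h - s) - \<kappa>) * (norm y)\<^sup>2 \<le> (\<Sum>k<n. (norm (y v* \<xi> k \<omega>))\<^sup>2 * (q (Suc k) - q k))"
  proof (rule ito_integral_approx[where \<sigma>=\<sigma> and I=I and R=R and c=c and s=s and t="s + h" and \<kappa>=\<kappa>])
    show "ito_integral M T F \<sigma> W I" "progressive_on T F \<sigma>" "0 \<le> s" "s \<le> s + h" "s + h \<le> T" "0 < \<kappa>" by (rule ito progressive s sT h \<kappa>)+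
  qed (use norm_\<sigma>_le elliptic in blast)+
  define S where "S = transform q \<xi> n"
  define Q where "Q y \<omega> = (\<Sum>k<n. (norm (y v* \<xi> k \<omega>))\<^sup>2 * (q (Suc k) - q k))" for y \<omega>
  \<comment> \<open>\<open>y\<close> is controlled on \<open>A\<close> only. Cut off by the
    indicator, \<open>y'\<close> and \<open>u\<close> are bounded everywhere, as the moment lemmas
    require.\<close>
  define y' where "y' \<omega> = indicator A \<omega> *\<^sub>R y \<omega>" for \<omega>
  define u where "u \<omega> = indicator A \<omega> * (\<epsilon>\<^sup>2 - (norm (y \<omega>))\<^sup>2)" for \<omega>
  have AM: "A \<in> sets M" using sets_F[OF A s sT(1)] .
  have AF: "indicat_real A \<in> borel_measurable (F s)" using A by measurable
  have y'F: "y' \<in> borel_measurable (F s)" unfolding y'_def using AF y by measurable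
  have uF: "u \<in> borel_measurable (F s)" unfolding u_def using AF y by measurable
  have [measurable]: "y \<in> borel_measurable M" "y' \<in> borel_measurable M" "u \<in> borel_measurable M"
    using measurable_F[OF y s sT(1)] measurable_F[OF y'F s sT(1)] measurable_F[OF uF s sT(1)] by auto
  note [measurable] = \<beta> AM \<Gamma>(1)
  have [measurable]: "S \<in> borel_measurable M" unfolding S_def by (rule transform_measurable_M[OF adm])
  have [measurable]: "I (s + h) \<in> borel_measurable M" "I s \<in> borel_measurable M"
    using s h by (auto intro: I_measurable)
  have \<xi>M[measurable]: "\<xi> k \<in> borel_measurable M" if "k < n" for k
    by (rule measurable_F[OF admissible_stepD(4,1)[OF adm that] admissible_bounds(2)[OF adm less_imp_le[OF that]]])
  have u_bound: "0 \<le> u \<omega>" "u \<omega> \<le> \<epsilon>\<^sup>2" and y'_bound: "norm (y' \<omega>) \<le> \<epsilon>" for \<omega>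
  proof -
    have "(norm (y \<omega>))\<^sup>2 \<le> \<epsilon>\<^sup>2" if "\<omega> \<in> A"
      using power_mono[OF less_imp_le[OF yA[OF that]], of 2] by simp
    then show "0 \<le> u \<omega>" "u \<omega> \<le> \<epsilon>\<^sup>2" by (auto simp: u_def indicator_def)
    show "norm (y' \<omega>) \<le> \<epsilon>" using yA[of \<omega>] \<epsilon> by (auto simp: y'_def indicator_def)
  qed
  obtain \<omega>0 where \<omega>0: "\<omega>0 \<in> space M" using not_empty by blast
  have R0: "0 \<le> R" using norm_\<sigma>_le[of s \<omega>0] \<omega>0 s sT order_trans[OF norm_ge_zero] by auto
  have Q_nonneg: "0 \<le> Q z \<omega>" for z \<omega>
    unfolding Q_def using admissible_stepD(2)[OF adm] by (intro sum_nonneg mult_nonneg_nonneg) auto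
  have Q_le: "Q z \<omega> \<le> (norm z)\<^sup>2 * (R\<^sup>2 * h)" if \<omega>: "\<omega> \<in> space M" for z \<omega>
  proof -
    have "Q z \<omega> \<le> (\<Sum>k<n. (norm z * R)\<^sup>2 * (q (Suc k) - q k))"
      unfolding Q_def
    proof (intro sum_mono mult_right_mono power_mono)
      fix k assume "k \<in> {..<n}"
      then have k: "k < n" by simp
      show "norm (z v* \<xi> k \<omega>) \<le> norm z * R"
        using norm_vector_matrix_mult_le[of z "\<xi> k \<omega>"] mult_left_mono[OF admissible_stepD(5)[OF adm k \<omega>], of "norm z"] by simp
      show "0 \<le> q (Suc k) - q k" using admissible_stepD(2)[OF adm k] by simp
    qed simp
    also have "\<dots> = (norm z)\<^sup>2 * (R\<^sup>2 * h)"
      by (simp add: sum_distrib_left[symmetric] sum_lessThan_telescope q power_mult_distrib)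
    finally show ?thesis .
  qed
  have QM: "(\<lambda>\<omega>. Q (y' \<omega>) \<omega>) \<in> borel_measurable M" unfolding Q_def by measurable
  have u2F: "(\<lambda>\<omega>. (u \<omega>)\<^sup>2) \<in> borel_measurable (F s)" using uF by measurable
  have u2b: "\<bar>(u \<omega>)\<^sup>2\<bar> \<le> \<epsilon> ^ 4" for \<omega>
    using power_mono[OF u_bound(2)[of \<omega>] u_bound(1)[of \<omega>], of 2] by simp

  \<comment> \<open>The expectations of the terms in the Taylor bound: the linear one vanishes, and
    the quadratic ones become sums of squares of the integrand.\<close>
  have b1: "has_bochner_integral M (\<lambda>\<omega>. ((u \<omega>)\<^sup>2 *\<^sub>R y' \<omega>) \<bullet> S \<omega>) 0"
    unfolding S_def
  proof (rule transform_linear[OF adm])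
    show "(\<lambda>\<omega>. (u \<omega>)\<^sup>2 *\<^sub>R y' \<omega>) \<in> borel_measurable (F (q 0))" unfolding q using uF y'F by measurable
    show "norm ((u \<omega>)\<^sup>2 *\<^sub>R y' \<omega>) \<le> \<epsilon> ^ 4 * \<epsilon>" for \<omega>
      unfolding norm_scaleR using u2b[of \<omega>] y'_bound[of \<omega>] \<epsilon> by (intro mult_mono) auto
  qed
  have b2: "has_bochner_integral M (\<lambda>\<omega>. (u \<omega>)\<^sup>2 * (norm (S \<omega>))\<^sup>2)
      (expectation (\<lambda>\<omega>. (u \<omega>)\<^sup>2 * (\<Sum>k<n. (norm (\<xi> k \<omega>))\<^sup>2 * (q (Suc k) - q k))))"
    unfolding S_def by (rule transform_norm_sq[OF adm]) (use u2F u2b q in auto)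
  have b3: "has_bochner_integral M (\<lambda>\<omega>. u \<omega> * (y' \<omega> \<bullet> S \<omega>)\<^sup>2) (expectation (\<lambda>\<omega>. u \<omega> * Q (y' \<omega>) \<omega>))"
    unfolding S_def Q_def
    by (rule transform_quadratic[OF adm, where B=\<epsilon> and C="\<epsilon>\<^sup>2"]) (use y'F uF q y'_bound u_bound in auto)
  have b4: "integrable M (\<lambda>\<omega>. norm (S \<omega>) ^ 4)" "expectation (\<lambda>\<omega>. norm (S \<omega>) ^ 4) \<le> 9 * (real CARD('m))\<^sup>2 * R ^ 4 * h\<^sup>2"
    unfolding S_def using transform_integrable_norm_4[OF adm] transform_norm_4_le[OF adm] q by auto
  have upow: "integrable M (\<lambda>\<omega>. u \<omega> ^ j)" for j
  proof (rule integrable_const_bound[of _ "(\<epsilon>\<^sup>2) ^ j", OF AE_I2])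
    show "norm (u \<omega> ^ j) \<le> (\<epsilon>\<^sup>2) ^ j" for \<omega>
      using power_mono[OF u_bound(2)[of \<omega>] u_bound(1)[of \<omega>], of j] u_bound(1)[of \<omega>] by simp
  qed measurable
  have bump_int: "integrable M (\<lambda>\<omega>. indicator A \<omega> * bump \<epsilon> (z \<omega>))" if [measurable]: "z \<in> borel_measurable M" for z :: "'a \<Rightarrow> real^'d"
  proof (rule integrable_const_bound[of _ "\<epsilon> ^ 6", OF AE_I2])
    show "norm (indicator A \<omega> * bump \<epsilon> (z \<omega>)) \<le> \<epsilon> ^ 6" for \<omega>
      using bump_le[of \<epsilon> "z \<omega>"] bump_nonneg[of \<epsilon> "z \<omega>"] \<epsilon> by (auto simp: indicator_def)
  qed measurable

  have step1: "expectation (\<lambda>\<omega>. indicator A \<omega> * bump \<epsilon> (y \<omega> + \<beta> \<omega> + S \<omega>)) - 6 * \<epsilon> ^ 5 * \<kappa> - \<epsilon> ^ 6 * \<kappa>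
     \<le> expectation (\<lambda>\<omega>. indicator A \<omega> * bump \<epsilon> (y \<omega> + \<beta> \<omega> + (I (s + h) \<omega> - I s \<omega>)))"
  proof -
    have "expectation (\<lambda>\<omega>. indicator A \<omega> * bump \<epsilon> (y \<omega> + \<beta> \<omega> + S \<omega>))
      \<le> expectation (\<lambda>\<omega>. indicator A \<omega> * bump \<epsilon> (y \<omega> + \<beta> \<omega> + (I (s + h) \<omega> - I s \<omega>)) + (6 * \<epsilon> ^ 5 * \<kappa> + \<epsilon> ^ 6 * indicator (space M - \<Gamma>) \<omega>))"
    proof (rule integral_mono)
      show "integrable M (\<lambda>\<omega>. indicator A \<omega> * bump \<epsilon> (y \<omega> + \<beta> \<omega> + S \<omega>))" by (rule bump_int) measurable
      show "integrable M (\<lambda>\<omega>. indicator A \<omega> * bump \<epsilon> (y \<omega> + \<beta> \<omega> + (I (s + h) \<omega> - I s \<omega>)) + (6 * \<epsilon> ^ 5 * \<kappa> + \<epsilon> ^ 6 * indicator (space M - \<Gamma>) \<omega>))"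
        by (intro Bochner_Integration.integrable_add bump_int integrable_mult_right integrable_const integrable_real_indicator) (auto simp: less_top[symmetric])
      fix \<omega> assume \<omega>: "\<omega> \<in> space M"
      let ?a = "y \<omega> + \<beta> \<omega> + S \<omega>" and ?b = "y \<omega> + \<beta> \<omega> + (I (s + h) \<omega> - I s \<omega>)"
      have "bump \<epsilon> ?a \<le> bump \<epsilon> ?b + (6 * \<epsilon> ^ 5 * \<kappa> + \<epsilon> ^ 6 * indicator (space M - \<Gamma>) \<omega>)"
      proof (cases "\<omega> \<in> \<Gamma>")
        case True
        have "bump \<epsilon> ?a - bump \<epsilon> ?b \<le> 6 * \<epsilon> ^ 5 * norm (?a - ?b)"
          using bump_lipschitz[of \<epsilon> ?a ?b] \<epsilon> by simp
        also have "norm (?a - ?b) \<le> \<kappa>" using near[OF True] by (simp add: S_def algebra_simps)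
        finally show ?thesis using True \<epsilon> by (simp add: mult_left_mono)
      next
        case False
        then show ?thesis using bump_le[of \<epsilon> ?a] bump_nonneg[of \<epsilon> ?b] \<epsilon> \<kappa> \<omega> by (simp add: add_increasing)
      qed
      moreover have "0 \<le> 6 * \<epsilon> ^ 5 * \<kappa> + \<epsilon> ^ 6 * indicator (space M - \<Gamma>) \<omega>" using \<epsilon> \<kappa> by simp
      ultimately show "indicator A \<omega> * bump \<epsilon> ?a \<le> indicator A \<omega> * bump \<epsilon> ?b + (6 * \<epsilon> ^ 5 * \<kappa> + \<epsilon> ^ 6 * indicator (space M - \<Gamma>) \<omega>)"
        by (cases "\<omega> \<in> A") auto
    qed
    also have "\<dots> = expectation (\<lambda>\<omega>. indicator A \<omega> * bump \<epsilon> (y \<omega> + \<beta> \<omega> + (I (s + h) \<omega> - I s \<omega>))) + (6 * \<epsilon> ^ 5 * \<kappa> + \<epsilon> ^ 6 * prob (space M - \<Gamma>))"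
    proof -
      have "expectation (\<lambda>\<omega>. 6 * \<epsilon> ^ 5 * \<kappa> + \<epsilon> ^ 6 * indicator (space M - \<Gamma>) \<omega>) = 6 * \<epsilon> ^ 5 * \<kappa> + \<epsilon> ^ 6 * prob (space M - \<Gamma>)"
        by (subst Bochner_Integration.integral_add) (auto simp: prob_space less_top[symmetric] Int_absorb2)
      then show ?thesis
        by (subst Bochner_Integration.integral_add)
           (auto intro!: bump_int Bochner_Integration.integrable_add integrable_mult_right integrable_real_indicator simp: less_top[symmetric])
    qed
    also have "\<dots> \<le> expectation (\<lambda>\<omega>. indicator A \<omega> * bump \<epsilon> (y \<omega> + \<beta> \<omega> + (I (s + h) \<omega> - I s \<omega>))) + (6 * \<epsilon> ^ 5 * \<kappa> + \<epsilon> ^ 6 * \<kappa>)"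
      using \<Gamma>(2) \<epsilon> by (intro add_left_mono mult_left_mono) auto
    finally show ?thesis by simp
  qed

  \<comment> \<open>The Taylor bound is used on \<open>A\<close>; off \<open>A\<close> both
    \<open>u\<close> and \<open>y'\<close> are 0 and the left integrand is at most 0.\<close>
  have step2: "expectation (\<lambda>\<omega>. u \<omega> ^ 3) - 6 * \<epsilon> * K * h * expectation (\<lambda>\<omega>. (u \<omega>)\<^sup>2)
      - 3 * expectation (\<lambda>\<omega>. (u \<omega>)\<^sup>2 * (norm (S \<omega>))\<^sup>2) + 12 * expectation (\<lambda>\<omega>. u \<omega> * (y' \<omega> \<bullet> S \<omega>)\<^sup>2)
      - C * (h * sqrt h + expectation (\<lambda>\<omega>. norm (S \<omega>) ^ 4) / sqrt h)
     \<le> expectation (\<lambda>\<omega>. indicator A \<omega> * bump \<epsilon> (y \<omega> + \<beta> \<omega> + S \<omega>))"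
  proof -
    let ?L = "\<lambda>\<omega>. u \<omega> ^ 3 - 6 * \<epsilon> * K * h * (u \<omega>)\<^sup>2 - 6 * (((u \<omega>)\<^sup>2 *\<^sub>R y' \<omega>) \<bullet> S \<omega>)
      - 3 * ((u \<omega>)\<^sup>2 * (norm (S \<omega>))\<^sup>2) + 12 * (u \<omega> * (y' \<omega> \<bullet> S \<omega>)\<^sup>2) - C * (h * sqrt h + norm (S \<omega>) ^ 4 / sqrt h)"
    have i2: "integrable M (\<lambda>\<omega>. (u \<omega>)\<^sup>2 * (norm (S \<omega>))\<^sup>2)" and i3: "integrable M (\<lambda>\<omega>. u \<omega> * (y' \<omega> \<bullet> S \<omega>)\<^sup>2)"
      using b2 b3 by (simp_all only: has_bochner_integral_iff)
    have hb: "has_bochner_integral M ?L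
       (expectation (\<lambda>\<omega>. u \<omega> ^ 3) - 6 * \<epsilon> * K * h * expectation (\<lambda>\<omega>. (u \<omega>)\<^sup>2) - 6 * 0
        - 3 * expectation (\<lambda>\<omega>. (u \<omega>)\<^sup>2 * (norm (S \<omega>))\<^sup>2) + 12 * expectation (\<lambda>\<omega>. u \<omega> * (y' \<omega> \<bullet> S \<omega>)\<^sup>2)
        - C * (h * sqrt h + expectation (\<lambda>\<omega>. norm (S \<omega>) ^ 4) / sqrt h))"
    proof (intro has_bochner_integral_diff has_bochner_integral_add has_bochner_integral_mult_right b1)
      have *: "has_bochner_integral M f (expectation f)" if "integrable M f" for f :: "'a \<Rightarrow> real"
        using that by (rule has_bochner_integral_integrable)
      show "has_bochner_integral M (\<lambda>\<omega>. u \<omega> ^ 3) (expectation (\<lambda>\<omega>. u \<omega> ^ 3))" by (rule *[OF upow])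
      show "has_bochner_integral M (\<lambda>\<omega>. (u \<omega>)\<^sup>2) (expectation (\<lambda>\<omega>. (u \<omega>)\<^sup>2))" by (rule *[OF upow])
      show "has_bochner_integral M (\<lambda>\<omega>. (u \<omega>)\<^sup>2 * (norm (S \<omega>))\<^sup>2) (expectation (\<lambda>\<omega>. (u \<omega>)\<^sup>2 * (norm (S \<omega>))\<^sup>2))" by (rule *[OF i2])
      show "has_bochner_integral M (\<lambda>\<omega>. u \<omega> * (y' \<omega> \<bullet> S \<omega>)\<^sup>2) (expectation (\<lambda>\<omega>. u \<omega> * (y' \<omega> \<bullet> S \<omega>)\<^sup>2))" by (rule *[OF i3])
      show "has_bochner_integral M (\<lambda>\<omega>. sqrt h) (sqrt h)"
        using *[of "\<lambda>\<omega>. sqrt h"] by (simp add: prob_space)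
      show "has_bochner_integral M (\<lambda>\<omega>. norm (S \<omega>) ^ 4 / sqrt h) (expectation (\<lambda>\<omega>. norm (S \<omega>) ^ 4) / sqrt h)"
        by (rule has_bochner_integral_divide_zero[OF *[OF b4(1)]])
    qed
    have "integral\<^sup>L M ?L \<le> expectation (\<lambda>\<omega>. indicator A \<omega> * bump \<epsilon> (y \<omega> + \<beta> \<omega> + S \<omega>))"
    proof (rule integral_mono)
      show "integrable M ?L" by (rule integrable.intros[OF hb])
      show "integrable M (\<lambda>\<omega>. indicator A \<omega> * bump \<epsilon> (y \<omega> + \<beta> \<omega> + S \<omega>))" by (rule bump_int) measurable
      fix \<omega> assume \<omega>: "\<omega> \<in> space M"
      have Cn: "0 \<le> C * (h * sqrt h + norm (S \<omega>) ^ 4 / sqrt h)" using C h by simp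
      show "?L \<omega> \<le> indicator A \<omega> * bump \<epsilon> (y \<omega> + \<beta> \<omega> + S \<omega>)"
      proof (cases "\<omega> \<in> A")
        case True
        then have u\<omega>: "u \<omega> = \<epsilon>\<^sup>2 - (norm (y \<omega>))\<^sup>2" and y\<omega>: "y' \<omega> = y \<omega>" by (auto simp: u_def y'_def)
        show ?thesis
          using taylor[OF less_imp_le[OF yA[OF True]] \<beta>K[OF \<omega>], of "S \<omega>"] True
          unfolding u\<omega>[symmetric] by (simp add: y\<omega> mult.assoc)
      next
        case False
        then show ?thesis using Cn by (simp add: u_def y'_def)
      qed
    qed
    then show ?thesis using has_bochner_integral_integral_eq[OF hb] by simp
  qed

  have step3: "expectation (\<lambda>\<omega>. (u \<omega>)\<^sup>2 * (norm (S \<omega>))\<^sup>2) \<le> R\<^sup>2 * h * expectation (\<lambda>\<omega>. (u \<omega>)\<^sup>2)"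
  proof -
    have "expectation (\<lambda>\<omega>. (u \<omega>)\<^sup>2 * (norm (S \<omega>))\<^sup>2) = expectation (\<lambda>\<omega>. (u \<omega>)\<^sup>2 * (\<Sum>k<n. (norm (\<xi> k \<omega>))\<^sup>2 * (q (Suc k) - q k)))"
      using b2 by (rule has_bochner_integral_integral_eq)
    also have "\<dots> \<le> expectation (\<lambda>\<omega>. R\<^sup>2 * h * (u \<omega>)\<^sup>2)"
    proof (rule integral_mono')
      show "integrable M (\<lambda>\<omega>. R\<^sup>2 * h * (u \<omega>)\<^sup>2)" by (intro integrable_mult_right upow)
      fix \<omega> assume \<omega>: "\<omega> \<in> space M"
      have "(\<Sum>k<n. (norm (\<xi> k \<omega>))\<^sup>2 * (q (Suc k) - q k)) \<le> (\<Sum>k<n. R\<^sup>2 * (q (Suc k) - q k))"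
        using admissible_stepD(2,5)[OF adm] \<omega> by (intro sum_mono mult_right_mono power_mono) auto
      also have "\<dots> = R\<^sup>2 * h" by (simp add: sum_distrib_left[symmetric] sum_lessThan_telescope q)
      finally show "(u \<omega>)\<^sup>2 * (\<Sum>k<n. (norm (\<xi> k \<omega>))\<^sup>2 * (q (Suc k) - q k)) \<le> R\<^sup>2 * h * (u \<omega>)\<^sup>2"
        by (simp add: mult.commute mult_left_mono)
      show "0 \<le> R\<^sup>2 * h * (u \<omega>)\<^sup>2" using h by simp
    qed
    finally show ?thesis by simp
  qed

  have uy_int: "integrable M (\<lambda>\<omega>. u \<omega> * (norm (y' \<omega>))\<^sup>2)"
  proof (rule integrable_const_bound[of _ "\<epsilon>\<^sup>2 * \<epsilon>\<^sup>2", OF AE_I2])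
    show "norm (u \<omega> * (norm (y' \<omega>))\<^sup>2) \<le> \<epsilon>\<^sup>2 * \<epsilon>\<^sup>2" for \<omega>
      unfolding norm_mult using u_bound[of \<omega>] power_mono[OF y'_bound[of \<omega>], of 2] by (intro mult_mono) auto
  qed measurable
  \<comment> \<open>Ellipticity is available on \<open>\<Gamma>\<close> only. Off
    \<open>\<Gamma>\<close> the sum is merely nonnegative, and the claimed lower bound exceeds it by
    at most \<open>c * \<epsilon> ^ 4\<close>, since \<open>h \<le> 1\<close>.\<close>
  have step4: "c * h * expectation (\<lambda>\<omega>. u \<omega> * (norm (y' \<omega>))\<^sup>2) - \<epsilon> ^ 4 * (1 + c) * \<kappa>
      \<le> expectation (\<lambda>\<omega>. u \<omega> * (y' \<omega> \<bullet> S \<omega>)\<^sup>2)"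
  proof -
    have "expectation (\<lambda>\<omega>. c * h * (u \<omega> * (norm (y' \<omega>))\<^sup>2) - \<epsilon> ^ 4 * \<kappa> - \<epsilon> ^ 4 * c * indicator (space M - \<Gamma>) \<omega>)
       \<le> expectation (\<lambda>\<omega>. u \<omega> * Q (y' \<omega>) \<omega>)"
    proof (rule integral_mono)
      show "integrable M (\<lambda>\<omega>. c * h * (u \<omega> * (norm (y' \<omega>))\<^sup>2) - \<epsilon> ^ 4 * \<kappa> - \<epsilon> ^ 4 * c * indicator (space M - \<Gamma>) \<omega>)"
        by (intro Bochner_Integration.integrable_diff integrable_mult_right uy_int integrable_const integrable_real_indicator)
           (auto simp: less_top[symmetric])
      show "integrable M (\<lambda>\<omega>. u \<omega> * Q (y' \<omega>) \<omega>)"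
      proof (rule integrable_const_bound[of _ "\<epsilon>\<^sup>2 * (\<epsilon>\<^sup>2 * (R\<^sup>2 * h))", OF AE_I2])
        fix \<omega> assume \<omega>: "\<omega> \<in> space M"
        have "(norm (y' \<omega>))\<^sup>2 * (R\<^sup>2 * h) \<le> \<epsilon>\<^sup>2 * (R\<^sup>2 * h)"
          using power_mono[OF y'_bound[of \<omega>], of 2] h by (intro mult_right_mono) auto
        then have "Q (y' \<omega>) \<omega> \<le> \<epsilon>\<^sup>2 * (R\<^sup>2 * h)" using Q_le[OF \<omega>, of "y' \<omega>"] by linarith
        then show "norm (u \<omega> * Q (y' \<omega>) \<omega>) \<le> \<epsilon>\<^sup>2 * (\<epsilon>\<^sup>2 * (R\<^sup>2 * h))"
          unfolding norm_mult using u_bound[of \<omega>] Q_nonneg[of "y' \<omega>" \<omega>] by (intro mult_mono) auto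
      qed (use QM in measurable)
      fix \<omega> assume \<omega>: "\<omega> \<in> space M"
      have uy: "0 \<le> u \<omega> * (norm (y' \<omega>))\<^sup>2" "u \<omega> * (norm (y' \<omega>))\<^sup>2 \<le> \<epsilon> ^ 4"
      proof -
        have "u \<omega> * (norm (y' \<omega>))\<^sup>2 \<le> \<epsilon>\<^sup>2 * \<epsilon>\<^sup>2"
          using u_bound[of \<omega>] power_mono[OF y'_bound[of \<omega>], of 2] by (intro mult_mono) auto
        then show "u \<omega> * (norm (y' \<omega>))\<^sup>2 \<le> \<epsilon> ^ 4" by (simp add: power2_eq_square power4_eq_xxxx mult.assoc)
      qed (use u_bound[of \<omega>] in auto)
      show "c * h * (u \<omega> * (norm (y' \<omega>))\<^sup>2) - \<epsilon> ^ 4 * \<kappa> - \<epsilon> ^ 4 * c * indicator (space M - \<Gamma>) \<omega> \<le> u \<omega> * Q (y' \<omega>) \<omega>"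
      proof (cases "\<omega> \<in> \<Gamma>")
        case True
        have "u \<omega> * ((c * h - \<kappa>) * (norm (y' \<omega>))\<^sup>2) \<le> u \<omega> * Q (y' \<omega>) \<omega>"
          using low[OF True, of "y' \<omega>"] u_bound[of \<omega>] by (intro mult_left_mono) (auto simp: Q_def)
        moreover have "(u \<omega> * (norm (y' \<omega>))\<^sup>2) * \<kappa> \<le> \<epsilon> ^ 4 * \<kappa>" using uy \<kappa> by (intro mult_right_mono) auto
        ultimately show ?thesis using True by (simp add: algebra_simps)
      next
        case False
        have "c * h * (u \<omega> * (norm (y' \<omega>))\<^sup>2) \<le> c * 1 * \<epsilon> ^ 4"
          using uy h c_pos by (intro mult_mono) auto
        moreover have "0 \<le> u \<omega> * Q (y' \<omega>) \<omega>" using u_bound[of \<omega>] Q_nonneg[of "y' \<omega>" \<omega>] by simp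
        moreover have "0 \<le> \<epsilon> ^ 4 * \<kappa>" using \<kappa> by simp
        ultimately show ?thesis using False \<omega> by (simp add: mult.commute)
      qed
    qed
    also have "\<dots> = expectation (\<lambda>\<omega>. u \<omega> * (y' \<omega> \<bullet> S \<omega>)\<^sup>2)"
      using b3 by (rule has_bochner_integral_integral_eq[symmetric])
    also have "expectation (\<lambda>\<omega>. c * h * (u \<omega> * (norm (y' \<omega>))\<^sup>2) - \<epsilon> ^ 4 * \<kappa> - \<epsilon> ^ 4 * c * indicator (space M - \<Gamma>) \<omega>)
       = c * h * expectation (\<lambda>\<omega>. u \<omega> * (norm (y' \<omega>))\<^sup>2) - \<epsilon> ^ 4 * \<kappa> - \<epsilon> ^ 4 * c * prob (space M - \<Gamma>)"
    proof -
      have "has_bochner_integral M (\<lambda>\<omega>. c * h * (u \<omega> * (norm (y' \<omega>))\<^sup>2) - \<epsilon> ^ 4 * \<kappa> - \<epsilon> ^ 4 * c * indicator (space M - \<Gamma>) \<omega>)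
        (c * h * expectation (\<lambda>\<omega>. u \<omega> * (norm (y' \<omega>))\<^sup>2) - \<epsilon> ^ 4 * \<kappa> - \<epsilon> ^ 4 * c * prob (space M - \<Gamma>))"
      proof (intro has_bochner_integral_diff has_bochner_integral_mult_right)
        show "has_bochner_integral M (\<lambda>\<omega>. u \<omega> * (norm (y' \<omega>))\<^sup>2) (expectation (\<lambda>\<omega>. u \<omega> * (norm (y' \<omega>))\<^sup>2))"
          by (rule has_bochner_integral_integrable[OF uy_int])
        show "has_bochner_integral M (\<lambda>\<omega>. \<kappa>) \<kappa>" by (simp add: has_bochner_integral_iff prob_space)
        show "has_bochner_integral M (indicator (space M - \<Gamma>)) (prob (space M - \<Gamma>))"
          by (rule has_bochner_integral_real_indicator) (auto simp: less_top[symmetric])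
      qed
      then show ?thesis by (rule has_bochner_integral_integral_eq)
    qed
    finally have "c * h * expectation (\<lambda>\<omega>. u \<omega> * (norm (y' \<omega>))\<^sup>2) - \<epsilon> ^ 4 * \<kappa> - \<epsilon> ^ 4 * c * prob (space M - \<Gamma>)
       \<le> expectation (\<lambda>\<omega>. u \<omega> * (y' \<omega> \<bullet> S \<omega>)\<^sup>2)" .
    moreover have "\<epsilon> ^ 4 * c * prob (space M - \<Gamma>) \<le> \<epsilon> ^ 4 * c * \<kappa>"
      using \<Gamma>(2) c_pos by (intro mult_left_mono) auto
    ultimately show ?thesis by (simp add: algebra_simps)
  qed

  \<comment> \<open>On \<open>A\<close> the squared norm of \<open>y'\<close> equals
    \<open>\<epsilon>^2 - u\<close>, which makes the whole bound a polynomial in \<open>u\<close>;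
    \<open>b\<close> is the coefficient of \<open>- h u^2\<close>.\<close>
  define b where "b = 6 * \<epsilon> * K + 3 * R\<^sup>2 + 12 * c"
  have step5: "(1 - b\<^sup>2 / (48 * c * \<epsilon>\<^sup>2) * h) * expectation (\<lambda>\<omega>. u \<omega> ^ 3)
      \<le> expectation (\<lambda>\<omega>. u \<omega> ^ 3) - 6 * \<epsilon> * K * h * expectation (\<lambda>\<omega>. (u \<omega>)\<^sup>2)
        - 3 * (R\<^sup>2 * h * expectation (\<lambda>\<omega>. (u \<omega>)\<^sup>2)) + 12 * (c * h * expectation (\<lambda>\<omega>. u \<omega> * (norm (y' \<omega>))\<^sup>2))"
  proof -
    let ?P = "\<lambda>\<omega>. u \<omega> ^ 3 - 6 * \<epsilon> * K * h * (u \<omega>)\<^sup>2 - 3 * (R\<^sup>2 * h * (u \<omega>)\<^sup>2) + 12 * (c * h * (u \<omega> * (norm (y' \<omega>))\<^sup>2))"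
    have "expectation (\<lambda>\<omega>. (1 - b\<^sup>2 / (48 * c * \<epsilon>\<^sup>2) * h) * u \<omega> ^ 3) \<le> integral\<^sup>L M ?P"
    proof (rule integral_mono)
      show "integrable M (\<lambda>\<omega>. (1 - b\<^sup>2 / (48 * c * \<epsilon>\<^sup>2) * h) * u \<omega> ^ 3)" by (intro integrable_mult_right upow)
      show "integrable M ?P"
        by (intro Bochner_Integration.integrable_add Bochner_Integration.integrable_diff integrable_mult_right upow uy_int)
      fix \<omega> assume "\<omega> \<in> space M"
      show "(1 - b\<^sup>2 / (48 * c * \<epsilon>\<^sup>2) * h) * u \<omega> ^ 3 \<le> ?P \<omega>"
      proof (cases "\<omega> \<in> A")
        case True
        then have yy: "(norm (y' \<omega>))\<^sup>2 = \<epsilon>\<^sup>2 - u \<omega>" by (simp add: y'_def u_def)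
        have "0 \<le> h * u \<omega> * (12 * c * \<epsilon>\<^sup>2 - b * u \<omega> + b\<^sup>2 / (48 * c * \<epsilon>\<^sup>2) * (u \<omega>)\<^sup>2)"
          using quadratic_drift_bound[OF \<epsilon> c_pos, of b "u \<omega>"] h u_bound[of \<omega>] by (intro mult_nonneg_nonneg) auto
        also have "\<dots> = ?P \<omega> - (1 - b\<^sup>2 / (48 * c * \<epsilon>\<^sup>2) * h) * u \<omega> ^ 3"
        proof -
          define l where "l = b\<^sup>2 / (48 * c * \<epsilon>\<^sup>2)"
          show ?thesis unfolding yy l_def[symmetric] b_def by (simp add: power2_eq_square power3_eq_cube algebra_simps)
        qed
        finally show ?thesis by simp
      qed (simp add: u_def)
    qed
    also have "integral\<^sup>L M ?P = expectation (\<lambda>\<omega>. u \<omega> ^ 3) - 6 * \<epsilon> * K * h * expectation (\<lambda>\<omega>. (u \<omega>)\<^sup>2)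
        - 3 * (R\<^sup>2 * h * expectation (\<lambda>\<omega>. (u \<omega>)\<^sup>2)) + 12 * (c * h * expectation (\<lambda>\<omega>. u \<omega> * (norm (y' \<omega>))\<^sup>2))"
      by (intro has_bochner_integral_integral_eq has_bochner_integral_add has_bochner_integral_diff has_bochner_integral_mult_right
          has_bochner_integral_integrable upow uy_int)
    finally show ?thesis by simp
  qed

  have u3: "expectation (\<lambda>\<omega>. u \<omega> ^ 3) = expectation (\<lambda>\<omega>. indicator A \<omega> * bump \<epsilon> (y \<omega>))"
  proof (intro Bochner_Integration.integral_cong refl)
    fix \<omega>
    show "u \<omega> ^ 3 = indicator A \<omega> * bump \<epsilon> (y \<omega>)"
      using bump_eq[OF less_imp_le[OF yA[of \<omega>]]] by (cases "\<omega> \<in> A") (auto simp: u_def)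
  qed
  have err: "C * (h * sqrt h + expectation (\<lambda>\<omega>. norm (S \<omega>) ^ 4) / sqrt h) \<le> C * (1 + 9 * (real CARD('m))\<^sup>2 * R ^ 4) * (h * sqrt h)"
  proof -
    have "expectation (\<lambda>\<omega>. norm (S \<omega>) ^ 4) / sqrt h \<le> 9 * (real CARD('m))\<^sup>2 * R ^ 4 * h\<^sup>2 / sqrt h"
      using b4(2) h by (intro divide_right_mono) auto
    also have "\<dots> = 9 * (real CARD('m))\<^sup>2 * R ^ 4 * (h * sqrt h)"
    proof -
      have "h\<^sup>2 / sqrt h = h * sqrt h"
        using h by (simp add: power2_eq_square real_div_sqrt flip: times_divide_eq_right)
      then show ?thesis by (metis times_divide_eq_right)
    qed
    finally have "h * sqrt h + expectation (\<lambda>\<omega>. norm (S \<omega>) ^ 4) / sqrt h \<le> (1 + 9 * (real CARD('m))\<^sup>2 * R ^ 4) * (h * sqrt h)"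
      by (simp add: distrib_right)
    then show ?thesis using C by (simp add: mult.assoc mult_left_mono)
  qed
  have "\<kappa> * (6 * \<epsilon> ^ 5 + \<epsilon> ^ 6 + 12 * \<epsilon> ^ 4 * (1 + c)) = 6 * \<epsilon> ^ 5 * \<kappa> + \<epsilon> ^ 6 * \<kappa> + 12 * (\<epsilon> ^ 4 * (1 + c) * \<kappa>)"
    by (simp add: algebra_simps)
  then show ?thesis
    using step1 step2 step3 step4 step5 err unfolding u3 b_def by linarith
qed

text \<open>The constants \<open>l\<close> and \<open>C\<close> stand outside the quantifiers over
  times, step sizes, processes and events, which is what allows the estimate to be iterated.\<close>

definition step_bound :: "real \<Rightarrow> real \<Rightarrow> real \<Rightarrow> real \<Rightarrow> bool" where
  "step_bound \<epsilon> K l C \<longleftrightarrow> (\<forall>s h. \<forall>y \<beta> :: 'a \<Rightarrow> real^'d. \<forall>A\<in>sets (F s). 0 \<le> s \<longrightarrow> 0 < h \<longrightarrow> h \<le> 1 \<longrightarrow> s + h \<le> T \<longrightarrow>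
     y \<in> borel_measurable (F s) \<longrightarrow> \<beta> \<in> borel_measurable M \<longrightarrow> (\<forall>\<omega>\<in>space M. norm (\<beta> \<omega>) \<le> K * h) \<longrightarrow>
     (\<forall>\<omega>\<in>A. norm (y \<omega>) < \<epsilon>) \<longrightarrow>
     (1 - l * h) * expectation (\<lambda>\<omega>. indicator A \<omega> * bump \<epsilon> (y \<omega>)) - C * (h * sqrt h)
       \<le> expectation (\<lambda>\<omega>. indicator A \<omega> * bump \<epsilon> (y \<omega> + \<beta> \<omega> + (I (s + h) \<omega> - I s \<omega>))))"

text \<open>Neither \<open>l\<close> nor \<open>C\<close> involves the quality
  \<open>\<kappa>\<close> of the discrete approximation, so \<open>\<kappa>\<close> can tend to 0
  with \<open>h\<close> fixed, before any iteration.\<close>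

lemma bump_step:
  assumes \<epsilon>: "0 < \<epsilon>" and K: "0 \<le> K"
  obtains l C where "0 \<le> l" "0 \<le> C" "step_bound \<epsilon> K l C"
proof -
  obtain C where C: "0 \<le> C"
    and taylor: "\<And>(y::real^'d) \<beta> \<zeta> h. norm y \<le> \<epsilon> \<Longrightarrow> 0 < h \<Longrightarrow> h \<le> 1 \<Longrightarrow> norm \<beta> \<le> K * h \<Longrightarrow>
      (\<epsilon>\<^sup>2 - (norm y)\<^sup>2) ^ 3 - 6 * \<epsilon> * K * h * (\<epsilon>\<^sup>2 - (norm y)\<^sup>2)\<^sup>2 - 6 * (\<epsilon>\<^sup>2 - (norm y)\<^sup>2)\<^sup>2 * (y \<bullet> \<zeta>)
      - 3 * (\<epsilon>\<^sup>2 - (norm y)\<^sup>2)\<^sup>2 * (norm \<zeta>)\<^sup>2 + 12 * (\<epsilon>\<^sup>2 - (norm y)\<^sup>2) * (y \<bullet> \<zeta>)\<^sup>2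
      - C * (h * sqrt h + norm \<zeta> ^ 4 / sqrt h) \<le> bump \<epsilon> (y + \<beta> + \<zeta>)"
    by (rule bump_taylor[OF \<epsilon> K]) (rule that; assumption)
  define l where "l = (6 * \<epsilon> * K + 3 * R\<^sup>2 + 12 * c)\<^sup>2 / (48 * c * \<epsilon>\<^sup>2)"
  define C' where "C' = C * (1 + 9 * (real CARD('m))\<^sup>2 * R ^ 4)"
  have "0 \<le> l" using c_pos by (simp add: l_def)
  moreover have "0 \<le> C'" using C by (simp add: C'_def)
  moreover have "(1 - l * h) * expectation (\<lambda>\<omega>. indicator A \<omega> * bump \<epsilon> (y \<omega>)) - C' * (h * sqrt h)
      \<le> expectation (\<lambda>\<omega>. indicator A \<omega> * bump \<epsilon> (y \<omega> + \<beta> \<omega> + (I (s + h) \<omega> - I s \<omega>)))"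
    if s: "0 \<le> s" and h: "0 < h" "h \<le> 1" "s + h \<le> T"
      and y: "y \<in> borel_measurable (F s)" and \<beta>: "\<beta> \<in> borel_measurable M"
      and \<beta>K: "\<And>\<omega>. \<omega> \<in> space M \<Longrightarrow> norm (\<beta> \<omega>) \<le> K * h"
      and A: "A \<in> sets (F s)" and yA: "\<And>\<omega>. \<omega> \<in> A \<Longrightarrow> norm (y \<omega>) < \<epsilon>"
    for s h A and y \<beta> :: "'a \<Rightarrow> real^'d"
  proof (rule field_le_epsilon)
    fix e :: real assume e: "0 < e"
    define L where "L = 6 * \<epsilon> ^ 5 + \<epsilon> ^ 6 + 12 * \<epsilon> ^ 4 * (1 + c)"
    have L: "0 < L" using \<epsilon> c_pos unfolding L_def by (intro add_pos_pos mult_pos_pos) auto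
    have "(1 - l * h) * expectation (\<lambda>\<omega>. indicator A \<omega> * bump \<epsilon> (y \<omega>)) - C' * (h * sqrt h) - (e / L) * L
      \<le> expectation (\<lambda>\<omega>. indicator A \<omega> * bump \<epsilon> (y \<omega> + \<beta> \<omega> + (I (s + h) \<omega> - I s \<omega>)))"
      unfolding L_def l_def C'_def
      by (rule bump_step_approx[OF \<epsilon> K C taylor s h y \<beta> \<beta>K A yA]) (use h e L in \<open>auto simp: L_def\<close>)
    then show "(1 - l * h) * expectation (\<lambda>\<omega>. indicator A \<omega> * bump \<epsilon> (y \<omega>)) - C' * (h * sqrt h)
      \<le> expectation (\<lambda>\<omega>. indicator A \<omega> * bump \<epsilon> (y \<omega> + \<beta> \<omega> + (I (s + h) \<omega> - I s \<omega>))) + e"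
      using L by simp
  qed
  ultimately show ?thesis by (intro that[of l C']) (auto simp: step_bound_def)
qed

end

section \<open>Iteration of the one-step estimate over dyadic grids\<close>

context elliptic_integral
begin

text \<open>Passing from \<open>A k\<close> to \<open>A (Suc k)\<close> is free because the bump is
  0 on the difference. The starting value at the centre of the ball is
  \<open>\<epsilon> ^ 6\<close>.\<close>

lemma tube_grid_bound:
  fixes Y :: "real \<Rightarrow> 'a \<Rightarrow> real^'d"
  assumes \<epsilon>: "0 < \<epsilon>" and l: "0 \<le> l" and C: "0 \<le> C"
    and step: "step_bound \<epsilon> K l C"
    and t: "0 \<le> t" and h: "0 < h" "h \<le> 1" "l * h \<le> 1" "t + real N * h \<le> T"
    and Ym: "\<And>r. r \<in> {t..T} \<Longrightarrow> Y r \<in> borel_measurable (F r)"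
    and Yt: "\<And>\<omega>. \<omega> \<in> space M \<Longrightarrow> Y t \<omega> = 0"
    and drift: "\<And>r r' \<omega>. r \<in> {t..T} \<Longrightarrow> r' \<in> {t..T} \<Longrightarrow> r \<le> r' \<Longrightarrow> \<omega> \<in> space M \<Longrightarrow>
      norm (Y r' \<omega> - Y r \<omega> - (I r' \<omega> - I r \<omega>)) \<le> K * (r' - r)"
    and B: "B \<in> sets (F t)"
  shows "(1 - l * h) ^ N * (\<epsilon> ^ 6 * prob B) - real N * (C * (h * sqrt h))
      \<le> expectation (\<lambda>\<omega>. indicator {\<omega> \<in> B. \<forall>j\<le>N. norm (Y (t + real j * h) \<omega>) < \<epsilon>} \<omega> * bump \<epsilon> (Y (t + real N * h) \<omega>))"
proof -
  define g where "g k = t + real k * h" for k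
  have g_le: "g k \<le> T" if "k \<le> N" for k
  proof -
    have "real k * h \<le> real N * h" using that h by (intro mult_right_mono) auto
    then show ?thesis unfolding g_def using h(4) by linarith
  qed
  have g_ge: "t \<le> g k" for k using h by (simp add: g_def)
  have g_mono: "g i \<le> g j" if "i \<le> j" for i j
    unfolding g_def using that h by (intro add_left_mono mult_right_mono) auto
  have gS: "g (Suc k) = g k + h" for k by (simp add: g_def algebra_simps)
  define A where "A k = {\<omega> \<in> B. \<forall>j\<le>k. norm (Y (g j) \<omega>) < \<epsilon>}" for k
  have tT: "t \<le> T" using g_le[of 0] by (simp add: g_def)
  have BM: "B \<subseteq> space M" using sets.sets_into_space[OF B] t tT by simp
  have A_sets: "A k \<in> sets (F (g k))" if k: "k \<le> N" for k
  proof -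
    have [measurable]: "Y (g j) \<in> borel_measurable (F (g k))" if "j \<le> k" for j
      using measurable_F_mono[OF Ym[of "g j"], of "g k"] g_ge[of j] g_le[of j] g_le[OF k] g_mono[OF that] that k t by simp
    have [measurable]: "B \<in> sets (F (g k))"
      using sets_F_mono[OF B t g_ge g_le[OF k]] .
    have "A k = B \<inter> (\<Inter>j\<in>{..k}. {\<omega> \<in> space (F (g k)). norm (Y (g j) \<omega>) < \<epsilon>})"
      using BM g_ge[of k] g_le[OF k] t by (auto simp: A_def)
    also have "\<dots> \<in> sets (F (g k))"
      by (intro sets.Int sets.finite_INT) auto
    finally show ?thesis .
  qed
  have main: "k \<le> N \<Longrightarrow> (1 - l * h) ^ k * (\<epsilon> ^ 6 * prob B) - real k * (C * (h * sqrt h))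
      \<le> expectation (\<lambda>\<omega>. indicator (A k) \<omega> * bump \<epsilon> (Y (g k) \<omega>))" for k
  proof (induction k)
    case 0
    have "expectation (\<lambda>\<omega>. indicator (A 0) \<omega> * bump \<epsilon> (Y (g 0) \<omega>)) = expectation (\<lambda>\<omega>. indicator B \<omega> * \<epsilon> ^ 6)"
    proof (intro Bochner_Integration.integral_cong refl)
      fix \<omega> assume "\<omega> \<in> space M"
      then have "Y (g 0) \<omega> = 0" using Yt by (simp add: g_def)
      then show "indicator (A 0) \<omega> * bump \<epsilon> (Y (g 0) \<omega>) = indicator B \<omega> * \<epsilon> ^ 6"
        using \<epsilon> by (simp add: A_def bump_def indicator_def flip: power_mult)
    qed
    also have "\<dots> = \<epsilon> ^ 6 * prob B" using BM by (simp add: Int_absorb2)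
    finally show ?case by simp
  next
    case (Suc k)
    then have k: "k \<le> N" "Suc k \<le> N" by auto
    define e where "e = expectation (\<lambda>\<omega>. indicator (A k) \<omega> * bump \<epsilon> (Y (g k) \<omega>))"
    define \<beta> where "\<beta> \<omega> = Y (g (Suc k)) \<omega> - Y (g k) \<omega> - (I (g (Suc k)) \<omega> - I (g k) \<omega>)" for \<omega>
    have gk: "g k \<in> {t..T}" "g (Suc k) \<in> {t..T}" "g k \<le> g (Suc k)" using g_ge g_le[OF k(1)] g_le[OF k(2)] g_mono[of k "Suc k"] by auto
    have gk0: "0 \<le> g k" "0 \<le> g (Suc k)" using gk t by auto
    have [measurable]: "Y (g k) \<in> borel_measurable M" "Y (g (Suc k)) \<in> borel_measurable M"
      "I (g k) \<in> borel_measurable M" "I (g (Suc k)) \<in> borel_measurable M"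
      using measurable_F[OF Ym[OF gk(1)]] measurable_F[OF Ym[OF gk(2)]] I_measurable gk gk0 by auto
    have IH: "(1 - l * h) ^ k * (\<epsilon> ^ 6 * prob B) - real k * (C * (h * sqrt h)) \<le> e"
      using Suc.IH k by (simp add: e_def)
    have "(1 - l * h) * e - C * (h * sqrt h)
      \<le> expectation (\<lambda>\<omega>. indicator (A k) \<omega> * bump \<epsilon> (Y (g k) \<omega> + \<beta> \<omega> + (I (g k + h) \<omega> - I (g k) \<omega>)))"
      unfolding e_def
    proof (rule step[unfolded step_bound_def, rule_format])
      show "0 \<le> g k" "0 < h" "h \<le> 1" by fact+
      show "g k + h \<le> T" using gk(2) by (simp add: gS)
      show "Y (g k) \<in> borel_measurable (F (g k))" by (rule Ym[OF gk(1)])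
      show "\<beta> \<in> borel_measurable M" unfolding \<beta>_def by measurable
      show "norm (\<beta> \<omega>) \<le> K * h" if "\<omega> \<in> space M" for \<omega>
        unfolding \<beta>_def using drift[OF gk that] by (simp add: gS)
      show "A k \<in> sets (F (g k))" by (rule A_sets[OF k(1)])
      show "norm (Y (g k) \<omega>) < \<epsilon>" if "\<omega> \<in> A k" for \<omega> using that by (simp add: A_def)
    qed
    also have "\<dots> = expectation (\<lambda>\<omega>. indicator (A (Suc k)) \<omega> * bump \<epsilon> (Y (g (Suc k)) \<omega>))"
    proof (intro Bochner_Integration.integral_cong refl)
      fix \<omega> assume "\<omega> \<in> space M"
      have "Y (g k) \<omega> + \<beta> \<omega> + (I (g k + h) \<omega> - I (g k) \<omega>) = Y (g (Suc k)) \<omega>" by (simp add: \<beta>_def gS)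
      moreover have "bump \<epsilon> (Y (g (Suc k)) \<omega>) = 0" if "\<omega> \<in> A k" "\<omega> \<notin> A (Suc k)"
        using that \<epsilon> by (intro bump_eq_0) (auto simp: A_def le_Suc_eq)
      moreover have "\<omega> \<in> A k" if "\<omega> \<in> A (Suc k)" using that by (auto simp: A_def)
      ultimately show "indicator (A k) \<omega> * bump \<epsilon> (Y (g k) \<omega> + \<beta> \<omega> + (I (g k + h) \<omega> - I (g k) \<omega>))
         = indicator (A (Suc k)) \<omega> * bump \<epsilon> (Y (g (Suc k)) \<omega>)"
        by (auto simp: indicator_def)
    qed
    finally have st: "(1 - l * h) * e - C * (h * sqrt h) \<le> expectation (\<lambda>\<omega>. indicator (A (Suc k)) \<omega> * bump \<epsilon> (Y (g (Suc k)) \<omega>))" .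
    have lh: "0 \<le> 1 - l * h" "1 - l * h \<le> 1" using h l by auto
    have "(1 - l * h) ^ Suc k * (\<epsilon> ^ 6 * prob B) - real (Suc k) * (C * (h * sqrt h))
       \<le> (1 - l * h) * ((1 - l * h) ^ k * (\<epsilon> ^ 6 * prob B) - real k * (C * (h * sqrt h))) - C * (h * sqrt h)"
    proof -
      \<comment> \<open>Errors made earlier are multiplied by a factor at most 1, so they simply add
        up.\<close>
      have "(1 - l * h) * (real k * (C * (h * sqrt h))) \<le> 1 * (real k * (C * (h * sqrt h)))"
        using lh C h by (intro mult_right_mono) auto
      then show ?thesis by (simp add: algebra_simps)
    qed
    also have "\<dots> \<le> (1 - l * h) * e - C * (h * sqrt h)"
      using IH lh by (intro diff_right_mono mult_left_mono) auto
    finally show ?case using st by linarith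
  qed
  show "(1 - l * h) ^ N * (\<epsilon> ^ 6 * prob B) - real N * (C * (h * sqrt h))
      \<le> expectation (\<lambda>\<omega>. indicator {\<omega> \<in> B. \<forall>j\<le>N. norm (Y (t + real j * h) \<omega>) < \<epsilon>} \<omega> * bump \<epsilon> (Y (t + real N * h) \<omega>))"
    using main[of N] by (simp add: A_def g_def)
qed

text \<open>\<pi> is fixed before \<open>B\<close>, so this is a lower bound for a conditional
  probability given \<open>F t\<close>. Dyadic grids are nested, hence the survival events decrease
  and continuity of the measure yields the bound for all dyadic times together.\<close>

lemma tube_lower_bound:
  fixes Y :: "real \<Rightarrow> 'a \<Rightarrow> real^'d"
  assumes \<epsilon>: "0 < \<epsilon>" and K: "0 \<le> K" and t: "0 \<le> t" "t \<le> T"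
    and Ym: "\<And>r. r \<in> {t..T} \<Longrightarrow> Y r \<in> borel_measurable (F r)"
    and Yt: "\<And>\<omega>. \<omega> \<in> space M \<Longrightarrow> Y t \<omega> = 0"
    and drift: "\<And>r r' \<omega>. r \<in> {t..T} \<Longrightarrow> r' \<in> {t..T} \<Longrightarrow> r \<le> r' \<Longrightarrow> \<omega> \<in> space M \<Longrightarrow>
      norm (Y r' \<omega> - Y r \<omega> - (I r' \<omega> - I r \<omega>)) \<le> K * (r' - r)"
  obtains \<pi> where "0 < \<pi>"
    and "\<And>B. B \<in> sets (F t) \<Longrightarrow> (\<Inter>n. {\<omega> \<in> B. \<forall>j\<le>2 ^ n. norm (Y (t + real j * ((T - t) / 2 ^ n)) \<omega>) < \<epsilon>}) \<in> sets M"
    and "\<And>B. B \<in> sets (F t) \<Longrightarrow>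
      \<pi> * prob B \<le> prob (\<Inter>n. {\<omega> \<in> B. \<forall>j\<le>2 ^ n. norm (Y (t + real j * ((T - t) / 2 ^ n)) \<omega>) < \<epsilon>})"
proof (cases "t = T")
  \<comment> \<open>All grid points coincide with \<open>t\<close>, where \<open>Y\<close> is 0; the
    intersection is \<open>B\<close> and \<pi> can be 1.\<close>
  case True
  have "(\<Inter>n::nat. {\<omega> \<in> B. \<forall>j\<le>2 ^ n. norm (Y (t + real j * ((T - t) / 2 ^ n)) \<omega>) < \<epsilon>}) = B" if "B \<in> sets (F t)" for B
    using True Yt \<epsilon> sets.sets_into_space[OF that] t by (auto simp: subset_eq)
  then show ?thesis using that[of 1] sets_F t by simp
next
  case False
  define \<tau> where "\<tau> = T - t"
  have \<tau>: "0 < \<tau>" using False t by (simp add: \<tau>_def)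
  obtain l C where l: "0 \<le> l" and C: "0 \<le> C"
    and step: "step_bound \<epsilon> K l C"
    by (rule bump_step[OF \<epsilon> K])
  define h where "h n = \<tau> / 2 ^ n" for n :: nat
  have h0: "0 < h n" for n using \<tau> by (simp add: h_def)
  have hN: "real (2 ^ n) * h n = \<tau>" for n by (simp add: h_def)
  have h_lim: "h \<longlonglongrightarrow> 0"
    unfolding h_def using LIMSEQ_inverse_realpow_zero[of 2] tendsto_mult_right_zero[of "\<lambda>n. inverse (2 ^ n)" sequentially \<tau>]
    by (simp add: divide_inverse)
  have "eventually (\<lambda>n. h n < 1) sequentially" by (rule order_tendstoD(2)[OF h_lim]) simp
  moreover have "eventually (\<lambda>n. l * h n < 1) sequentially"
    by (rule order_tendstoD(2)[OF tendsto_mult_right_zero[OF h_lim]]) simp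
  ultimately have ev: "eventually (\<lambda>n. h n \<le> 1 \<and> l * h n \<le> 1) sequentially"
    by eventually_elim auto
  define A where "A B n = {\<omega> \<in> B. \<forall>j\<le>2 ^ n. norm (Y (t + real j * h n) \<omega>) < \<epsilon>}" for B n
  have A_eq: "(\<Inter>n. {\<omega> \<in> B. \<forall>j\<le>2 ^ n. norm (Y (t + real j * ((T - t) / 2 ^ n)) \<omega>) < \<epsilon>}) = (\<Inter>n. A B n)" for B
    by (simp add: A_def h_def \<tau>_def)
  have A_dec: "decseq (A B)" for B
  proof (rule decseq_SucI, rule subsetI)
    fix n \<omega> assume \<omega>: "\<omega> \<in> A B (Suc n)"
    have "norm (Y (t + real j * h n) \<omega>) < \<epsilon>" if "j \<le> 2 ^ n" for j
    proof -
      have eq: "real j * h n = real (2 * j) * h (Suc n)" by (simp add: h_def)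
      have "2 * j \<le> 2 ^ Suc n" using that by simp
      then have "norm (Y (t + real (2 * j) * h (Suc n)) \<omega>) < \<epsilon>" using \<omega> unfolding A_def by blast
      then show ?thesis unfolding eq .
    qed
    then show "\<omega> \<in> A B n" using \<omega> by (auto simp: A_def)
  qed
  have grid: "A B n \<in> sets M" if B: "B \<in> sets (F t)" for B n
  proof -
    have [measurable]: "Y (t + real j * h n) \<in> borel_measurable M" if "j \<le> 2 ^ n" for j
    proof -
      have "real j * h n \<le> real (2 ^ n) * h n" using that h0[of n] by (intro mult_right_mono) auto
      then have "t + real j * h n \<in> {t..T}" using h0[of n] unfolding hN by (simp add: \<tau>_def)
      then show ?thesis using measurable_F[OF Ym] t by auto
    qed
    have BM: "B \<in> sets M" using sets_F[OF B t] .
    have "A B n = B \<inter> (\<Inter>j\<in>{..2 ^ n}. {\<omega> \<in> space M. norm (Y (t + real j * h n) \<omega>) < \<epsilon>})"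
      using sets.sets_into_space[OF BM] by (auto simp: A_def)
    also have "\<dots> \<in> sets M" using BM by (intro sets.Int sets.finite_INT) auto
    finally show ?thesis .
  qed
  show ?thesis
  proof (rule that[of "exp (- l * \<tau>)"], simp_all only: A_eq)
    fix B assume B: "B \<in> sets (F t)"
    show "(\<Inter>n. A B n) \<in> sets M" using grid[OF B] by auto
    \<comment> \<open>The bump is at most \<open>\<epsilon> ^ 6\<close>, which cancels against the
      starting value. The total error of \<open>2 ^ n\<close> steps is \<tau> times
      \<open>C * sqrt (h n)\<close>.\<close>
    have bound: "(1 - l * h n) ^ (2 ^ n) * prob B - \<tau> * C * sqrt (h n) / \<epsilon> ^ 6 \<le> prob (A B n)"
      if n: "h n \<le> 1" "l * h n \<le> 1" for n
    proof -
      have "(1 - l * h n) ^ (2 ^ n) * (\<epsilon> ^ 6 * prob B) - real (2 ^ n) * (C * (h n * sqrt (h n)))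
        \<le> expectation (\<lambda>\<omega>. indicator (A B n) \<omega> * bump \<epsilon> (Y (t + real (2 ^ n) * h n) \<omega>))"
        unfolding A_def
        by (rule tube_grid_bound[OF \<epsilon> l C step t(1) h0 n _ Ym Yt drift B]) (auto simp: h_def \<tau>_def)
      also have "\<dots> \<le> expectation (\<lambda>\<omega>. \<epsilon> ^ 6 * indicator (A B n) \<omega>)"
      proof (rule integral_mono')
        show "integrable M (\<lambda>\<omega>. \<epsilon> ^ 6 * indicator (A B n) \<omega>)"
          using grid[OF B] by (intro integrable_mult_right integrable_real_indicator) (auto simp: less_top[symmetric])
        show "indicator (A B n) \<omega> * bump \<epsilon> (Y (t + real (2 ^ n) * h n) \<omega>) \<le> \<epsilon> ^ 6 * indicator (A B n) \<omega>" for \<omega>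
          using bump_le[of \<epsilon> "Y (t + real (2 ^ n) * h n) \<omega>"] by (simp add: indicator_def)
        show "0 \<le> \<epsilon> ^ 6 * indicator (A B n) \<omega>" for \<omega> using \<epsilon> by simp
      qed
      also have "\<dots> = \<epsilon> ^ 6 * prob (A B n)" using sets.sets_into_space[OF grid[OF B, of n]] by (simp add: Int_absorb2)
      also have "real (2 ^ n) * (C * (h n * sqrt (h n))) = \<tau> * C * sqrt (h n)" using hN[of n] by (simp add: ac_simps)
      finally have "((1 - l * h n) ^ (2 ^ n) * prob B) * \<epsilon> ^ 6 - \<tau> * C * sqrt (h n) \<le> prob (A B n) * \<epsilon> ^ 6"
        by (simp add: ac_simps)
      then show ?thesis using \<epsilon> by (simp add: field_simps)
    qed
    \<comment> \<open>The subsequence along powers of 2 of the sequence that defines the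
      exponential.\<close>
    have lim1: "(\<lambda>n. (1 - l * h n) ^ (2 ^ n)) \<longlonglongrightarrow> exp (- l * \<tau>)"
    proof -
      have "(\<lambda>n. (1 + (- l * \<tau>) / real n) ^ n) \<longlonglongrightarrow> exp (- l * \<tau>)" by (rule tendsto_exp_limit_sequentially)
      moreover have "strict_mono (\<lambda>n. (2::nat) ^ n)" by (rule strict_monoI) simp
      ultimately have "((\<lambda>n. (1 + (- l * \<tau>) / real n) ^ n) \<circ> (\<lambda>n. 2 ^ n)) \<longlonglongrightarrow> exp (- l * \<tau>)"
        by (rule LIMSEQ_subseq_LIMSEQ)
      then show ?thesis by (simp add: o_def h_def)
    qed
    have lim2: "(\<lambda>n. (1 - l * h n) ^ (2 ^ n) * prob B - \<tau> * C * sqrt (h n) / \<epsilon> ^ 6) \<longlonglongrightarrow> exp (- l * \<tau>) * prob B - \<tau> * C * sqrt 0 / \<epsilon> ^ 6"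
      using \<epsilon> by (intro tendsto_intros lim1 h_lim) auto
    have lim3: "(\<lambda>n. prob (A B n)) \<longlonglongrightarrow> prob (\<Inter>n. A B n)"
      using grid[OF B] A_dec by (intro finite_Lim_measure_decseq) auto
    have "exp (- l * \<tau>) * prob B - \<tau> * C * sqrt 0 / \<epsilon> ^ 6 \<le> prob (\<Inter>n. A B n)"
      by (rule tendsto_le[OF _ lim3 lim2]) (use ev bound in \<open>auto elim: eventually_mono\<close>)
    then show "exp (- l * \<tau>) * prob B \<le> prob (\<Inter>n. A B n)" by simp
  qed simp
qed

end

section \<open>Conditional full support\<close>

lemma le_on_Icc_if_le_on_dyadics:
  fixes g :: "real \<Rightarrow> real"
  assumes g: "continuous_on {t..T} g"
    and le: "\<And>n j. j \<le> 2 ^ n \<Longrightarrow> g (t + real j * ((T - t) / 2 ^ n)) \<le> e" and r: "r \<in> {t..T}"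
  shows "g r \<le> e"
proof (rule ccontr)
  assume n: "\<not> g r \<le> e"
  have "t \<noteq> T" using le[of 0 0] r n by auto
  then have \<tau>: "0 < T - t" using r by auto
  obtain d where d: "0 < d" "\<And>x. x \<in> {t..T} \<Longrightarrow> dist x r < d \<Longrightarrow> dist (g x) (g r) < g r - e"
    using g r n unfolding continuous_on_iff by (metis diff_gt_0_iff_gt not_le)
  obtain n where "(T - t) / d < 2 ^ n" using real_arch_pow[of 2 "(T - t) / d"] by auto
  then have h: "(T - t) / 2 ^ n < d" using d by (simp add: field_simps)
  define h where "h = (T - t) / 2 ^ n"
  have h0: "0 < h" using \<tau> by (simp add: h_def)
  define j where "j = nat \<lfloor>(r - t) / h\<rfloor>"
  have "0 \<le> (r - t) / h" using r h0 by simp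
  then have j: "real j \<le> (r - t) / h" "(r - t) / h < real j + 1" by (auto simp: j_def)
  then have jr: "real j * h \<le> r - t" "r - t < real j * h + h" using h0 by (auto simp: field_simps)
  have "real j \<le> 2 ^ n"
  proof -
    have "real j * h \<le> 2 ^ n * h" using jr r by (simp add: h_def)
    then show ?thesis using h0 by simp
  qed
  then have "j \<le> 2 ^ n" by (metis of_nat_le_iff of_nat_numeral of_nat_power)
  then have "g (t + real j * h) \<le> e" using le by (simp add: h_def)
  moreover have "dist (g (t + real j * h)) (g r) < g r - e"
    using jr r h h0 by (intro d) (auto simp: dist_real_def h_def)
  ultimately show False by (simp add: dist_real_def)
qed

text \<open>The derivative is a polynomial, hence bounded on the interval. This lets the increments
  of the target path count as drift.\<close>

lemma polynomial_function_lipschitz: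
  fixes f :: "real \<Rightarrow> 'b::euclidean_space"
  assumes "polynomial_function f"
  obtains L where "0 \<le> L" "\<And>r r'. r \<in> {a..b} \<Longrightarrow> r' \<in> {a..b} \<Longrightarrow> norm (f r' - f r) \<le> L * norm (r' - r)"
proof -
  obtain p where p: "polynomial_function p" "\<And>x. (f has_vector_derivative p x) (at x)"
    using has_vector_derivative_polynomial_function[OF assms] by blast
  have "continuous_on {a..b} p" by (rule continuous_on_polymonial_function[OF p(1)])
  then have "bounded (p ` {a..b})"
    by (intro compact_imp_bounded compact_continuous_image compact_Icc)
  then obtain L where "\<forall>x\<in>p ` {a..b}. norm x \<le> L" by (auto simp: bounded_iff)
  then have L: "norm (p x) \<le> L" if "x \<in> {a..b}" for x using that by blast
  have "norm (f r' - f r) \<le> max 0 L * norm (r' - r)" if "r \<in> {a..b}" "r' \<in> {a..b}" for r r'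
  proof (rule differentiable_bound[OF convex_closed_interval(1)[of a b, unfolded cbox_interval] _ _ that(2,1)])
    fix x assume x: "x \<in> {a..b}"
    show "(f has_derivative (\<lambda>h. h *\<^sub>R p x)) (at x within {a..b})"
      using p(2)[of x] by (auto simp: has_vector_derivative_def intro: has_derivative_at_withinI)
    show "onorm (\<lambda>h. h *\<^sub>R p x) \<le> max 0 L"
      using L[OF x] by (intro onorm_le) (auto simp: mult.commute intro!: mult_left_mono)
  qed
  then show ?thesis by (intro that[of "max 0 L"]) auto
qed

section \<open>Drift, tubes, and a criterion for positive conditional probability\<close>

context brownian
begin

text \<open>Progressive measurability up to time \<open>r\<close> is what makes a parametrised
  integral over \<open>[0,r]\<close> measurable for \<open>F r\<close>.\<close>

lemma drift_measurable:
  fixes \<mu> :: "real \<Rightarrow> 'a \<Rightarrow> real^'d"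
  assumes "progressive_on T F \<mu>" "0 \<le> r" "r \<le> T"
  shows "(\<lambda>\<omega>. LINT s|restrict_space lborel {0..r}. \<mu> s \<omega>) \<in> borel_measurable (F r)"
proof -
  interpret N: finite_measure "restrict_space lborel {0..r}" by (rule finite_measure_restrict_lborel)
  show ?thesis
    using N.borel_measurable_lebesgue_integral[OF progressive_measurable_pair[OF assms]] by simp
qed

lemma drift_lipschitz:
  fixes \<mu> :: "real \<Rightarrow> 'a \<Rightarrow> real^'d"
  assumes prog: "progressive_on T F \<mu>" and K: "\<And>s \<omega>. s \<in> {0..T} \<Longrightarrow> \<omega> \<in> space M \<Longrightarrow> norm (\<mu> s \<omega>) \<le> K"
    and r: "0 \<le> r" "r \<le> r'" "r' \<le> T" and \<omega>: "\<omega> \<in> space M"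
  shows "norm ((LINT s|restrict_space lborel {0..r'}. \<mu> s \<omega>) - (LINT s|restrict_space lborel {0..r}. \<mu> s \<omega>)) \<le> K * (r' - r)"
proof -
  have T: "0 \<le> T" "T \<le> T" using r by auto
  have \<omega>T: "\<omega> \<in> space (F T)" using \<omega> T by simp
  have "(\<lambda>s. \<mu> s \<omega>) \<in> borel_measurable (restrict_space lborel {0..T})"
    using measurable_compose[OF measurable_Pair1'[OF \<omega>T] progressive_measurable_pair[OF prog T]] by simp
  then have m[measurable]: "(\<lambda>s. indicator {0..T} s *\<^sub>R \<mu> s \<omega>) \<in> borel_measurable lborel"
    by (subst (asm) borel_measurable_restrict_space_iff) auto
  have K0: "0 \<le> K" using K[of 0 \<omega>] T \<omega> order_trans[OF norm_ge_zero] by auto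
  have eq: "indicator S s *\<^sub>R \<mu> s \<omega> = indicator S s *\<^sub>R (indicator {0..T} s *\<^sub>R \<mu> s \<omega>)" if "S \<subseteq> {0..T}" for S s
    using that by (auto simp: indicator_def)
  have int: "integrable lborel (\<lambda>s. indicator S s *\<^sub>R \<mu> s \<omega>)" if S: "S \<subseteq> {0..T}" "S \<in> sets borel" for S
  proof (rule Bochner_Integration.integrable_bound[of _ "\<lambda>s. K * indicator {0..T} s"])
    show "integrable lborel (\<lambda>s. K * indicator {0..T} s)"
      by (intro integrable_mult_right integrable_real_indicator) (auto simp: emeasure_lborel_Icc_eq)
    show "(\<lambda>s. indicator S s *\<^sub>R \<mu> s \<omega>) \<in> borel_measurable lborel"
      unfolding eq[OF S(1)] using S(2) by measurable
    show "AE s in lborel. norm (indicator S s *\<^sub>R \<mu> s \<omega>) \<le> norm (K * indicator {0..T} s)"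
      using S(1) K \<omega> K0 by (auto simp: indicator_def subset_eq intro!: AE_I2)
  qed
  have "(LINT s|restrict_space lborel {0..r'}. \<mu> s \<omega>) - (LINT s|restrict_space lborel {0..r}. \<mu> s \<omega>)
     = (LINT s|lborel. indicator {0..r'} s *\<^sub>R \<mu> s \<omega>) - (LINT s|lborel. indicator {0..r} s *\<^sub>R \<mu> s \<omega>)"
    by (simp add: integral_restrict_space)
  also have "\<dots> = (LINT s|lborel. indicator {0..r'} s *\<^sub>R \<mu> s \<omega> - indicator {0..r} s *\<^sub>R \<mu> s \<omega>)"
    using r by (intro Bochner_Integration.integral_diff[symmetric] int) auto
  also have "\<dots> = (LINT s|lborel. indicator {r<..r'} s *\<^sub>R \<mu> s \<omega>)"
    using r by (intro Bochner_Integration.integral_cong refl) (auto simp: indicator_def)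
  also have "norm \<dots> \<le> (LINT s|lborel. K * indicator {r<..r'} s)"
  proof (rule Bochner_Integration.integral_norm_bound_integral)
    show "integrable lborel (\<lambda>s. indicator {r<..r'} s *\<^sub>R \<mu> s \<omega>)" using r by (intro int) auto
    show "integrable lborel (\<lambda>s. K * indicator {r<..r'} s)"
      using r by (intro integrable_mult_right integrable_real_indicator) auto
    show "norm (indicator {r<..r'} s *\<^sub>R \<mu> s \<omega>) \<le> K * indicator {r<..r'} s" for s
      using K[of s \<omega>] r \<omega> by (auto simp: indicator_def)
  qed
  also have "\<dots> = K * (r' - r)" using r by (simp add: measure_def)
  finally show ?thesis .
qed

text \<open>
  The Ito representation of \<open>X t\<close> holds only almost surely, so that adaptedness of \<open>X\<close> rests on the
  completeness of \<open>F 0\<close>.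
\<close>
lemma AE_eq_measurable_F:
  fixes f g :: "'a \<Rightarrow> 'b::topological_space"
  assumes usual: "usual_conditions M T F" and t: "0 \<le> t" "t \<le> T"
    and f: "f \<in> borel_measurable (F t)" and eq: "AE \<omega> in M. g \<omega> = f \<omega>"
  shows "g \<in> borel_measurable (F t)"
proof (rule measurableI)
  obtain N where N: "{\<omega> \<in> space M. g \<omega> \<noteq> f \<omega>} \<subseteq> N" "emeasure M N = 0" "N \<in> sets M"
    using eq by (rule AE_E)
  have null: "Z \<in> sets (F t)" if "Z \<subseteq> N" for Z
    using usual N that sets_F_mono[of Z 0 t] t unfolding usual_conditions_def by blast
  fix S :: "'b set" assume S: "S \<in> sets borel"
  define Z where "Z = {\<omega> \<in> space M. g \<omega> \<noteq> f \<omega>}"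
  have "g -` S \<inter> space (F t) = (f -` S \<inter> space (F t) - Z) \<union> (g -` S \<inter> Z)"
    using t by (auto simp: Z_def)
  moreover have "f -` S \<inter> space (F t) \<in> sets (F t)" by (rule measurable_sets[OF f S])
  moreover have "Z \<in> sets (F t)" "g -` S \<inter> Z \<in> sets (F t)" using N(1) by (auto simp: Z_def intro!: null)
  ultimately show "g -` S \<inter> space (F t) \<in> sets (F t)" by simp
qed simp

text \<open>By continuity the rational times decide, and \<open>X\<close> at each of them is
  measurable for \<open>F t\<close>. With \<open>t = T\<close> it also gives measurability of open
  sets of paths.\<close>

lemma tube_sets:
  fixes X :: "real \<Rightarrow> 'a \<Rightarrow> 'b::euclidean_space"
  assumes t: "0 \<le> t" "t \<le> T" and X: "\<And>s. 0 \<le> s \<Longrightarrow> s \<le> T \<Longrightarrow> X s \<in> borel_measurable (F s)"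
    and cont: "continuous_paths M T X" and f: "continuous_on {0..t} f"
  shows "{\<omega> \<in> space M. \<forall>s\<in>{0..t}. dist (X s \<omega>) (f s) \<le> e} \<in> sets (F t)"
proof -
  have "{\<omega> \<in> space M. \<forall>s\<in>{0..t}. dist (X s \<omega>) (f s) \<le> e}
      = space (F t) \<inter> (\<Inter>s\<in>\<rat> \<inter> {0..t}. {\<omega> \<in> space (F t). dist (X s \<omega>) (f s) \<le> e})"
  proof (intro set_eqI iffI)
    fix \<omega> assume "\<omega> \<in> space (F t) \<inter> (\<Inter>s\<in>\<rat> \<inter> {0..t}. {\<omega> \<in> space (F t). dist (X s \<omega>) (f s) \<le> e})"
    then have \<omega>: "\<omega> \<in> space M" and le: "\<And>s. s \<in> \<rat> \<Longrightarrow> s \<in> {0..t} \<Longrightarrow> dist (X s \<omega>) (f s) \<le> e" using t by auto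
    have "continuous_on {0..t} (\<lambda>s. X s \<omega>)"
      using cont \<omega> t by (auto simp: continuous_paths_def intro: continuous_on_subset)
    then have "continuous_on {0..t} (\<lambda>s. dist (X s \<omega>) (f s))" by (intro continuous_on_dist f)
    from le_on_Icc_if_le_on_Rats[OF this le] \<omega>
    show "\<omega> \<in> {\<omega> \<in> space M. \<forall>s\<in>{0..t}. dist (X s \<omega>) (f s) \<le> e}" by auto
  qed (use t in auto)
  also have "\<dots> \<in> sets (F t)"
  proof (intro sets.Int sets.top sets.countable_INT')
    show "countable (\<rat> \<inter> {0..t})" by (auto intro: countable_subset[OF _ countable_rat])
    show "\<rat> \<inter> {0..t} \<noteq> {}" using t by (auto intro!: exI[of _ 0])
    have "{\<omega> \<in> space (F t). dist (X s \<omega>) (f s) \<le> e} \<in> sets (F t)" if "s \<in> \<rat> \<inter> {0..t}" for s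
    proof -
      have [measurable]: "X s \<in> borel_measurable (F t)" using that t by (intro measurable_F_mono[OF X]) auto
      show ?thesis by measurable
    qed
    then show "(\<lambda>s. {\<omega> \<in> space (F t). dist (X s \<omega>) (f s) \<le> e}) ` (\<rat> \<inter> {0..t}) \<subseteq> sets (F t)" by blast
  qed
  finally show ?thesis .
qed

text \<open>Test with \<open>B\<close>, the part of \<open>A\<close> where the conditional
  expectation is at most 0: the integral over \<open>B\<close> is both
  \<open>prob (B \<inter> E)\<close> and at most 0, so \<open>B\<close> is a null set.\<close>

lemma real_cond_exp_pos_if_bounded_below:
  assumes t: "0 \<le> t" "t \<le> T" and A: "A \<in> sets (F t)" and E: "E \<in> sets M" and \<pi>: "0 < \<pi>"
    and le: "\<And>B. B \<in> sets (F t) \<Longrightarrow> B \<subseteq> A \<Longrightarrow> \<pi> * prob B \<le> prob (B \<inter> E)"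
  shows "AE \<omega> in M. \<omega> \<in> A \<longrightarrow> 0 < real_cond_exp M (F t) (indicator E) \<omega>"
proof -
  interpret S: finite_measure_subalgebra M "F t"
    using subalgebra_F[OF t] by unfold_locales
  let ?c = "real_cond_exp M (F t) (indicator E)"
  have intE: "integrable M (indicat_real E)" using E by (intro integrable_real_indicator) (auto simp: less_top[symmetric])
  have [measurable]: "?c \<in> borel_measurable (F t)" by (rule borel_measurable_cond_exp)
  note [measurable] = A
  define B where "B = {\<omega> \<in> space (F t). \<omega> \<in> A \<and> ?c \<omega> \<le> 0}"
  have B: "B \<in> sets (F t)" unfolding B_def by measurable
  have BM: "B \<in> sets M" by (rule sets_F[OF B t])
  have "prob (B \<inter> E) = (LINT \<omega>:B|M. indicat_real E \<omega>)"
    using BM E sets.sets_into_space[OF BM]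
    by (simp add: set_lebesgue_integral_def indicator_inter_arith[symmetric] Int_absorb2 le_infI1)
  also have "\<dots> = (LINT \<omega>:B|M. ?c \<omega>)" by (rule S.real_cond_exp_intA[OF intE B])
  also have "\<dots> \<le> 0"
  proof -
    have "0 \<le> (LINT \<omega>|M. - (indicator B \<omega> *\<^sub>R ?c \<omega>))"
      by (rule integral_nonneg_AE) (auto simp: B_def indicator_def)
    then show ?thesis by (simp add: set_lebesgue_integral_def)
  qed
  finally have "prob (B \<inter> E) \<le> 0" .
  moreover have "B \<subseteq> A" by (auto simp: B_def)
  ultimately have "\<pi> * prob B \<le> 0" using le[OF B] by linarith
  then have "prob B = 0" using \<pi> measure_nonneg[of M B] by (simp add: mult_le_0_iff)
  then have "AE \<omega> in M. \<omega> \<notin> B" using BM by (simp add: prob_eq_0)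
  then show ?thesis
    by (rule AE_mp) (rule AE_I2, use t in \<open>auto simp: B_def\<close>)
qed

end

theorem theorem4:
  fixes M :: "'a measure" and T :: real and F :: "real \<Rightarrow> 'a measure"
    and W :: "real \<Rightarrow> 'a \<Rightarrow> real^'m"
    and X :: "real \<Rightarrow> 'a \<Rightarrow> real^'d"
    and \<mu> :: "real \<Rightarrow> 'a \<Rightarrow> real^'d"
    and \<sigma> :: "real \<Rightarrow> 'a \<Rightarrow> real^'m^'d"
  assumes "prob_space M" and "T > 0"
    and "filtration_on M T F" and "usual_conditions M T F"
    and "trivial_sigma M (F 0)"
    and "brownian_motion_on M T F W"
    and "progressive_on T F \<mu>" and "progressive_on T F \<sigma>"
    and "ito_process M T F W \<mu> \<sigma> X"
    and "\<exists>K. \<forall>t\<in>{0..T}. \<forall>\<omega>\<in>space M. norm (\<mu> t \<omega>) \<le> K"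
    and "\<exists>K. \<forall>t\<in>{0..T}. \<forall>\<omega>\<in>space M. norm (\<sigma> t \<omega> ** transpose (\<sigma> t \<omega>)) \<le> K"
    and "\<forall>t\<in>{0..T}. \<forall>\<omega>\<in>space M. invertible (\<sigma> t \<omega> ** transpose (\<sigma> t \<omega>))"
    and "\<exists>K. \<forall>t\<in>{0..T}. \<forall>\<omega>\<in>space M. norm (matrix_inv (\<sigma> t \<omega> ** transpose (\<sigma> t \<omega>))) \<le> K"
  shows "full_support M T X \<and> conditional_full_support M T F X"
proof -
  note usual = \<open>usual_conditions M T F\<close> and prog\<mu> = \<open>progressive_on T F \<mu>\<close>
  have T: "0 \<le> T" using \<open>T > 0\<close> by simp
  interpret prob_space M by fact
  interpret brownian M T F W by unfold_locales fact+
  obtain K\<mu> where K\<mu>: "\<And>t \<omega>. t \<in> {0..T} \<Longrightarrow> \<omega> \<in> space M \<Longrightarrow> norm (\<mu> t \<omega>) \<le> K\<mu>" using assms(10) by blast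
  obtain Ka where Ka: "\<And>t \<omega>. t \<in> {0..T} \<Longrightarrow> \<omega> \<in> space M \<Longrightarrow> norm (\<sigma> t \<omega> ** transpose (\<sigma> t \<omega>)) \<le> Ka" using assms(11) by blast
  obtain Ki where Ki: "\<And>t \<omega>. t \<in> {0..T} \<Longrightarrow> \<omega> \<in> space M \<Longrightarrow> norm (matrix_inv (\<sigma> t \<omega> ** transpose (\<sigma> t \<omega>))) \<le> Ki" using assms(13) by blast
  have cont: "continuous_paths M T X" and X0: "X 0 \<in> borel_measurable (F 0)"
    using assms(9) by (auto simp: ito_process_def)
  obtain I where I: "ito_integral M T F \<sigma> W I"
    and X_eq: "\<And>t. t \<in> {0..T} \<Longrightarrow> AE \<omega> in M. X t \<omega> = X 0 \<omega> + (LINT s|restrict_space lborel {0..t}. \<mu> s \<omega>) + I t \<omega>"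
    using assms(9) unfolding ito_process_def by blast
  \<comment> \<open>The maximum with 1 makes the division safe without first deriving that
    \<open>Ki\<close> is positive.\<close>
  define c where "c = 1 / max 1 Ki"
  interpret elliptic_integral M T F W \<sigma> I "sqrt (CARD('d) * Ka)" c
  proof
    show "ito_integral M T F \<sigma> W I" "progressive_on T F \<sigma>" by fact+
    show "0 < c" by (simp add: c_def)
    fix r \<omega> assume r: "r \<in> {0..T}" and \<omega>: "\<omega> \<in> space M"
    show "norm (\<sigma> r \<omega>) \<le> sqrt (CARD('d) * Ka)"
      by (rule real_le_rsqrt[OF matrix_norm_sq_le[OF Ka[OF r \<omega>]]])
    fix y :: "real^'d"
    have "norm (matrix_inv (\<sigma> r \<omega> ** transpose (\<sigma> r \<omega>))) \<le> max 1 Ki" using Ki[OF r \<omega>] by simp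
    then have "(norm y)\<^sup>2 \<le> max 1 Ki * (norm (y v* \<sigma> r \<omega>))\<^sup>2"
      using assms(12) r \<omega> by (intro matrix_elliptic) auto
    then show "c * (norm y)\<^sup>2 \<le> (norm (y v* \<sigma> r \<omega>))\<^sup>2"
      unfolding c_def by (simp add: field_simps)
  qed
  define D where "D r \<omega> = (LINT s|restrict_space lborel {0..r}. \<mu> s \<omega>)" for r \<omega>
  have Dm: "D r \<in> borel_measurable (F r)" if "0 \<le> r" "r \<le> T" for r
    unfolding D_def by (rule drift_measurable[OF prog\<mu> that])
  have Xm: "X r \<in> borel_measurable (F r)" if r: "0 \<le> r" "r \<le> T" for r
  proof (rule AE_eq_measurable_F[OF usual r])
    show "AE \<omega> in M. X r \<omega> = X 0 \<omega> + D r \<omega> + I r \<omega>" using X_eq[of r] r by (simp add: D_def)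
    show "(\<lambda>\<omega>. X 0 \<omega> + D r \<omega> + I r \<omega>) \<in> borel_measurable (F r)"
      by (intro borel_measurable_add measurable_F_mono[OF X0] Dm I_adapted r order_refl)
  qed
  have path: "path_of T X \<omega> \<in> cpath_space T" if "\<omega> \<in> space M" for \<omega>
  proof -
    have "continuous_on {0..T} (\<lambda>t. X t \<omega>)" using cont that by (auto simp: continuous_paths_def)
    then have "continuous_on {0..T} (restrict (\<lambda>t. X t \<omega>) {0..T})" by (rule continuous_on_eq) simp
    then show ?thesis by (simp add: path_of_def cpath_space_def)
  qed
  have cfs: "AE \<omega> in M. (\<exists>g\<in>G. \<forall>s\<in>{0..t}. X s \<omega> = g s) \<longrightarrow>
           real_cond_exp M (F t) (indicator {\<omega>'\<in>space M. path_of T X \<omega>' \<in> G}) \<omega> > 0"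
    and EM: "{\<omega>'\<in>space M. path_of T X \<omega>' \<in> G} \<in> sets M"
    if t: "t \<in> {0..T}" and G: "uniformly_open T G" for t and G :: "(real \<Rightarrow> real^'d) set"
  proof -
    obtain \<F> where \<F>: "countable \<F>" and poly: "\<And>f \<delta>. (f, \<delta>) \<in> \<F> \<Longrightarrow> polynomial_function f \<and> 0 < \<delta>"
      and inner: "\<And>f \<delta> h. (f, \<delta>) \<in> \<F> \<Longrightarrow> h \<in> cpath_space T \<Longrightarrow> \<forall>s\<in>{0..T}. dist (h s) (f s) \<le> 8 * \<delta> \<Longrightarrow> h \<in> G"
      and cover: "\<And>g. g \<in> G \<Longrightarrow> \<exists>(f, \<delta>)\<in>\<F>. \<forall>s\<in>{0..T}. dist (g s) (f s) \<le> 3 * \<delta>"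
      by (rule uniformly_open_cover[OF G T]) (rule that; assumption)
    have fcont: "continuous_on S f" if "(f, \<delta>) \<in> \<F>" for f \<delta> S
      using poly[OF that] continuous_on_polymonial_function by blast
    define E where "E = {\<omega>'\<in>space M. path_of T X \<omega>' \<in> G}"
    have in_E: "\<omega> \<in> E" if "(f, \<delta>) \<in> \<F>" "\<omega> \<in> space M" "\<And>s. s \<in> {0..T} \<Longrightarrow> dist (X s \<omega>) (f s) \<le> 8 * \<delta>" for \<omega> f \<delta>
      using that inner[OF that(1) path[OF that(2)]] by (simp add: E_def path_of_def)
    \<comment> \<open>The countable cover makes \<open>E\<close> measurable without any
      sigma-algebra on the space of paths.\<close>
    have "E = (\<Union>(f, \<delta>)\<in>\<F>. {\<omega> \<in> space M. \<forall>s\<in>{0..T}. dist (X s \<omega>) (f s) \<le> 3 * \<delta>})"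
    proof (intro set_eqI iffI)
      fix \<omega> assume "\<omega> \<in> E"
      then have \<omega>: "\<omega> \<in> space M" "path_of T X \<omega> \<in> G" by (auto simp: E_def)
      from cover[OF \<omega>(2)] \<omega>(1)
      show "\<omega> \<in> (\<Union>(f, \<delta>)\<in>\<F>. {\<omega> \<in> space M. \<forall>s\<in>{0..T}. dist (X s \<omega>) (f s) \<le> 3 * \<delta>})"
        by (fastforce simp: path_of_def)
    next
      fix \<omega> assume "\<omega> \<in> (\<Union>(f, \<delta>)\<in>\<F>. {\<omega> \<in> space M. \<forall>s\<in>{0..T}. dist (X s \<omega>) (f s) \<le> 3 * \<delta>})"
      then obtain f \<delta> where f: "(f, \<delta>) \<in> \<F>" "\<omega> \<in> space M" "\<And>s. s \<in> {0..T} \<Longrightarrow> dist (X s \<omega>) (f s) \<le> 3 * \<delta>" by auto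
      show "\<omega> \<in> E"
      proof (rule in_E[OF f(1,2)])
        fix s assume "s \<in> {0..T}"
        from f(3)[OF this] show "dist (X s \<omega>) (f s) \<le> 8 * \<delta>" using poly[OF f(1)] by linarith
      qed
    qed
    also have "\<dots> \<in> sets M"
      using \<F>
    proof (rule sets.countable_UN'')
      fix x assume "x \<in> \<F>"
      then obtain f \<delta> where x: "x = (f, \<delta>)" "(f, \<delta>) \<in> \<F>" by (cases x) auto
      have "{\<omega> \<in> space M. \<forall>s\<in>{0..T}. dist (X s \<omega>) (f s) \<le> 3 * \<delta>} \<in> sets (F T)"
        by (rule tube_sets[OF T order_refl Xm cont fcont[OF x(2)]])
      from sets_F[OF this T order_refl]
      show "(case x of (f, \<delta>) \<Rightarrow> {\<omega> \<in> space M. \<forall>s\<in>{0..T}. dist (X s \<omega>) (f s) \<le> 3 * \<delta>}) \<in> sets M"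
        unfolding x(1) by (simp only: prod.case)
    qed
    finally have EM: "E \<in> sets M" .
    then show "{\<omega>'\<in>space M. path_of T X \<omega>' \<in> G} \<in> sets M" by (simp add: E_def)
    have t0: "0 \<le> t" "t \<le> T" using t by auto
    \<comment> \<open>Each pair in the cover contributes its own null set; there are countably many
      of them.\<close>
    have "AE \<omega> in M. \<forall>x\<in>\<F>. \<omega> \<in> (case x of (f, \<delta>) \<Rightarrow> {\<omega> \<in> space M. \<forall>s\<in>{0..t}. dist (X s \<omega>) (f s) \<le> 3 * \<delta>})
       \<longrightarrow> 0 < real_cond_exp M (F t) (indicator E) \<omega>"
      unfolding AE_ball_countable[OF \<F>]
    proof
      fix x assume "x \<in> \<F>"
      then obtain f \<delta> where x: "x = (f, \<delta>)" and f: "(f, \<delta>) \<in> \<F>" by (cases x) auto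
      have \<delta>: "0 < \<delta>" using poly[OF f] by simp
      define A where "A = {\<omega> \<in> space M. \<forall>s\<in>{0..t}. dist (X s \<omega>) (f s) \<le> 3 * \<delta>}"
      have A: "A \<in> sets (F t)" unfolding A_def by (rule tube_sets[OF t0 Xm cont fcont[OF f]])
      obtain L where L: "0 \<le> L" "\<And>r r'. r \<in> {0..T} \<Longrightarrow> r' \<in> {0..T} \<Longrightarrow> norm (f r' - f r) \<le> L * norm (r' - r)"
        by (rule polynomial_function_lipschitz[OF conjunct1[OF poly[OF f]], of 0 T]) (rule that; assumption)
      \<comment> \<open>Built from \<open>D\<close> and \<open>I\<close> instead of
        \<open>X\<close>, so that the value 0 at \<open>t\<close> and the drift bound hold at every
        \<omega>; the representation of \<open>X\<close> holds only almost surely at each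
        time.\<close>
      define Y where "Y r \<omega> = (D r \<omega> - D t \<omega>) - (f r - f t) + (I r \<omega> - I t \<omega>)" for r \<omega>
      have Ym: "Y r \<in> borel_measurable (F r)" if "r \<in> {t..T}" for r
      proof -
        have r: "0 \<le> r" "t \<le> r" "r \<le> T" using that t0 by auto
        have [measurable]: "D r \<in> borel_measurable (F r)" "I r \<in> borel_measurable (F r)"
          "D t \<in> borel_measurable (F r)" "I t \<in> borel_measurable (F r)"
          using Dm[OF r(1,3)] I_adapted[OF r(1,3)] measurable_F_mono[OF Dm[OF t0] t0(1) r(2,3)]
            measurable_F_mono[OF I_adapted[OF t0] t0(1) r(2,3)] by auto
        show ?thesis unfolding Y_def by measurable
      qed
      have drift: "norm (Y r' \<omega> - Y r \<omega> - (I r' \<omega> - I r \<omega>)) \<le> (\<bar>K\<mu>\<bar> + L) * (r' - r)"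
        if r: "r \<in> {t..T}" "r' \<in> {t..T}" "r \<le> r'" and \<omega>: "\<omega> \<in> space M" for r r' \<omega>
      proof -
        have "Y r' \<omega> - Y r \<omega> - (I r' \<omega> - I r \<omega>) = (D r' \<omega> - D r \<omega>) - (f r' - f r)"
          by (simp add: Y_def)
        also have "norm \<dots> \<le> norm (D r' \<omega> - D r \<omega>) + norm (f r' - f r)" by (rule norm_triangle_ineq4)
        also have "\<dots> \<le> K\<mu> * (r' - r) + L * norm (r' - r)"
          unfolding D_def using r t0 by (intro add_mono drift_lipschitz[OF prog\<mu> K\<mu>] L \<omega>) auto
        also have "\<dots> \<le> \<bar>K\<mu>\<bar> * (r' - r) + L * (r' - r)" using r by (intro add_mono mult_right_mono) auto
        finally show ?thesis by (simp add: distrib_right)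
      qed
      have KL: "0 \<le> \<bar>K\<mu>\<bar> + L" using L by simp
      have Yt: "Y t \<omega> = 0" for \<omega> by (simp add: Y_def)
      define grid where "grid B = (\<Inter>n. {\<omega> \<in> B. \<forall>j\<le>2 ^ n. norm (Y (t + real j * ((T - t) / 2 ^ n)) \<omega>) < \<delta>})" for B
      obtain \<pi> where \<pi>: "0 < \<pi>" and low: "\<And>B. B \<in> sets (F t) \<Longrightarrow> \<pi> * prob B \<le> prob (grid B)"
        unfolding grid_def
      proof (rule tube_lower_bound[where \<epsilon>=\<delta> and K="\<bar>K\<mu>\<bar> + L" and t=t and Y=Y])
        show "0 < \<delta>" "0 \<le> \<bar>K\<mu>\<bar> + L" "0 \<le> t" "t \<le> T" by fact+
      qed (use Ym Yt drift in blast)+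
      have g_in: "t + real j * ((T - t) / 2 ^ n) \<in> {t..T}" if "j \<le> 2 ^ n" for j n :: nat
      proof -
        have "real j \<le> 2 ^ n" using that by (metis of_nat_le_iff of_nat_numeral of_nat_power)
        then have "real j * ((T - t) / 2 ^ n) \<le> 2 ^ n * ((T - t) / 2 ^ n)" using t0 by (intro mult_right_mono) auto
        then show ?thesis using t0 by simp
      qed
      \<comment> \<open>The null set in the Ito representation may depend on the time, but only the
        countably many dyadic times are needed.\<close>
      have X_all: "AE \<omega> in M. X t \<omega> = X 0 \<omega> + D t \<omega> + I t \<omega> \<and>
         (\<forall>n j. j \<le> 2 ^ n \<longrightarrow> X (t + real j * ((T - t) / 2 ^ n)) \<omega> =
            X 0 \<omega> + D (t + real j * ((T - t) / 2 ^ n)) \<omega> + I (t + real j * ((T - t) / 2 ^ n)) \<omega>)"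
      proof (intro AE_conjI)
        show "AE \<omega> in M. X t \<omega> = X 0 \<omega> + D t \<omega> + I t \<omega>" using X_eq[OF t] by (simp add: D_def)
        have "AE \<omega> in M. j \<le> 2 ^ n \<longrightarrow> X (t + real j * ((T - t) / 2 ^ n)) \<omega> =
            X 0 \<omega> + D (t + real j * ((T - t) / 2 ^ n)) \<omega> + I (t + real j * ((T - t) / 2 ^ n)) \<omega>" for n j :: nat
          using X_eq[of "t + real j * ((T - t) / 2 ^ n)"] g_in[of j n] t0
          by (cases "j \<le> 2 ^ n") (auto simp: D_def)
        then show "AE \<omega> in M. \<forall>n j. j \<le> 2 ^ n \<longrightarrow> X (t + real j * ((T - t) / 2 ^ n)) \<omega> =
            X 0 \<omega> + D (t + real j * ((T - t) / 2 ^ n)) \<omega> + I (t + real j * ((T - t) / 2 ^ n)) \<omega>"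
          by (simp add: AE_all_countable)
      qed
      have "AE \<omega> in M. \<omega> \<in> A \<longrightarrow> 0 < real_cond_exp M (F t) (indicator E) \<omega>"
      proof (rule real_cond_exp_pos_if_bounded_below[OF t0 A EM \<pi>])
        fix B assume B: "B \<in> sets (F t)" "B \<subseteq> A"
        have "prob (grid B) \<le> prob (B \<inter> E)"
        proof (rule finite_measure_mono_AE)
          show "B \<inter> E \<in> sets M" using sets_F[OF B(1) t0] EM by simp
          show "AE \<omega> in M. \<omega> \<in> grid B \<longrightarrow> \<omega> \<in> B \<inter> E"
            using X_all
          proof eventually_elim
            case (elim \<omega>)
            show ?case
            proof
              assume gB: "\<omega> \<in> grid B"
              then have "\<omega> \<in> B" by (auto simp: grid_def)
              with B(2) have \<omega>: "\<omega> \<in> space M" and near: "\<And>s. s \<in> {0..t} \<Longrightarrow> dist (X s \<omega>) (f s) \<le> 3 * \<delta>"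
                by (auto simp: A_def)
              have Xc: "continuous_on {t..T} (\<lambda>r. X r \<omega>)"
                using cont \<omega> t0 by (auto simp: continuous_paths_def intro: continuous_on_subset)
              \<comment> \<open>Back to \<open>X\<close> itself, whose continuous paths carry the
                bound from the dyadic times to all of \<open>[t,T]\<close>.\<close>
              have le: "norm (X r \<omega> - X t \<omega> - (f r - f t)) \<le> \<delta>" if r: "r \<in> {t..T}" for r
              proof (rule le_on_Icc_if_le_on_dyadics[OF _ _ r])
                show "continuous_on {t..T} (\<lambda>r. norm (X r \<omega> - X t \<omega> - (f r - f t)))"
                  by (intro continuous_intros Xc fcont[OF f])
                fix n j :: nat assume j: "j \<le> 2 ^ n"
                let ?g = "t + real j * ((T - t) / 2 ^ n)"
                have "X ?g \<omega> - X t \<omega> - (f ?g - f t) = Y ?g \<omega>"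
                  using elim j by (simp add: Y_def)
                moreover have "norm (Y ?g \<omega>) < \<delta>" using gB j unfolding grid_def by blast
                ultimately show "norm (X ?g \<omega> - X t \<omega> - (f ?g - f t)) \<le> \<delta>" by simp
              qed
              have "\<omega> \<in> E"
              proof (rule in_E[OF f \<omega>])
                fix s assume s: "s \<in> {0..T}"
                show "dist (X s \<omega>) (f s) \<le> 8 * \<delta>"
                proof (cases "s \<le> t")
                  case True
                  then show ?thesis using near[of s] s \<delta> by simp
                next
                  case False
                  have "X s \<omega> - f s = (X s \<omega> - X t \<omega> - (f s - f t)) + (X t \<omega> - f t)" by simp
                  also have "norm \<dots> \<le> \<delta> + 3 * \<delta>"
                    using le[of s] near[of t] s False t0 by (intro norm_triangle_mono) (auto simp: dist_norm)
                  finally show ?thesis using \<delta> by (simp add: dist_norm)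
                qed
              qed
              then show "\<omega> \<in> B \<inter> E" using \<open>\<omega> \<in> B\<close> by simp
            qed
          qed
        qed
        with low[OF B(1)] show "\<pi> * prob B \<le> prob (B \<inter> E)" by linarith
      qed
      then show "AE \<omega> in M. \<omega> \<in> (case x of (f, \<delta>) \<Rightarrow> {\<omega> \<in> space M. \<forall>s\<in>{0..t}. dist (X s \<omega>) (f s) \<le> 3 * \<delta>})
        \<longrightarrow> 0 < real_cond_exp M (F t) (indicator E) \<omega>" by (simp add: x A_def)
    qed
    \<comment> \<open>A path that follows some \<open>g\<close> of \<open>G\<close> up to
      \<open>t\<close> lies, on \<open>[0,t]\<close>, in the tube of a pair covering
      \<open>g\<close>.\<close>
    then have "AE \<omega> in M. (\<exists>g\<in>G. \<forall>s\<in>{0..t}. X s \<omega> = g s) \<longrightarrow> real_cond_exp M (F t) (indicator E) \<omega> > 0"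
      using AE_space
    proof eventually_elim
      case (elim \<omega>)
      show ?case
      proof (intro impI, elim bexE)
        fix g assume g: "g \<in> G" "\<forall>s\<in>{0..t}. X s \<omega> = g s"
        obtain f \<delta> where f: "(f, \<delta>) \<in> \<F>" "\<And>s. s \<in> {0..T} \<Longrightarrow> dist (g s) (f s) \<le> 3 * \<delta>" using cover[OF g(1)] by auto
        have "\<forall>s\<in>{0..t}. dist (X s \<omega>) (f s) \<le> 3 * \<delta>" using f(2) g(2) t0 by auto
        then show "0 < real_cond_exp M (F t) (indicator E) \<omega>" using elim f(1) by fastforce
      qed
    qed
    then show "AE \<omega> in M. (\<exists>g\<in>G. \<forall>s\<in>{0..t}. X s \<omega> = g s) \<longrightarrow>
           real_cond_exp M (F t) (indicator {\<omega>'\<in>space M. path_of T X \<omega>' \<in> G}) \<omega> > 0"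
      by (simp add: E_def)
  qed
  have "AE \<omega> in M. (\<exists>g\<in>G. X 0 \<omega> = g 0) \<longrightarrow> measure M {\<omega>'\<in>space M. path_of T X \<omega>' \<in> G} > 0"
    if G: "uniformly_open T G" for G :: "(real \<Rightarrow> real^'d) set"
  proof (cases "measure M {\<omega>'\<in>space M. path_of T X \<omega>' \<in> G} > 0")
    \<comment> \<open>If \<open>E\<close> is null, its conditional probability given
      \<open>F 0\<close> is 0 almost surely. Conditional full support at time 0 then shows that the
      premise on \<open>X 0\<close> fails almost surely.\<close>
    case False
    define E where "E = {\<omega>'\<in>space M. path_of T X \<omega>' \<in> G}"
    have T0: "0 \<in> {0..T}" using T by simp
    have EM: "E \<in> sets M" unfolding E_def by (rule EM[OF T0 G])
    have PE: "prob E = 0" using False measure_nonneg[of M E] unfolding E_def[symmetric] by linarith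
    interpret S: finite_measure_subalgebra M "F 0"
      using subalgebra_F[of 0] T by unfold_locales auto
    have intE: "integrable M (indicat_real E)" using EM by (intro integrable_real_indicator) (auto simp: less_top[symmetric])
    have "AE \<omega> in M. real_cond_exp M (F 0) (indicator E) \<omega> = 0"
    proof (subst integral_nonneg_eq_0_iff_AE[symmetric])
      show "integrable M (real_cond_exp M (F 0) (indicator E))" by (rule S.real_cond_exp_int(1)[OF intE])
      show "AE \<omega> in M. 0 \<le> real_cond_exp M (F 0) (indicator E) \<omega>"
        using EM by (intro S.real_cond_exp_pos) auto
      show "integral\<^sup>L M (real_cond_exp M (F 0) (indicator E)) = 0"
        using S.real_cond_exp_int(2)[OF intE] PE sets.sets_into_space[OF EM] by (simp add: Int_absorb2)
    qed
    moreover have "AE \<omega> in M. (\<exists>g\<in>G. \<forall>s\<in>{0..0}. X s \<omega> = g s) \<longrightarrow> real_cond_exp M (F 0) (indicator E) \<omega> > 0"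
      unfolding E_def by (rule cfs[OF T0 G])
    ultimately show ?thesis by eventually_elim auto
  qed simp
  then show ?thesis
    using cfs unfolding full_support_def conditional_full_support_def by blast
qed

end
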